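(* In the setting of the context, at $\mathtt{q}=(x,y)\in\mathcal{Q}$ with $x^{T}y=\Sigma U$ and $K=\alpha+\mathrm{Tr}\,\Sigma$: (i) The $\langle\cdot,\cdot\rangle_*$-orthogonal projection onto the horizontal space is, for $\mathring\omega=(\omega,\bar\omega)\in\mathcal{E}$, $$\mathsf{H}(\mathtt{q})\mathring\omega=\Big(\omega-2xL_\Sigma^{-1}\big((Uy^{T}\omega)_{\mathrm{skew}}\big),\ \bar\omega-2yU^{T}L_\Sigma^{-1}\big((x^{T}\bar\omega U^{T})_{\mathrm{skew}}\big)U\Big).$$ (ii) The Christoffel function $\Gamma^{\mathcal{Q}}(\mathtt{q};\mathring\omega_1,\mathring\omega_2)=(\Gamma_x,\Gamma_y)$ of the Levi-Civita connection of $\mathsf{g}$, at $\mathring\omega_i=(\omega_i,\bar\omega_i)$, is $$\begin{aligned}\Gamma_x=&-\tfrac1K\big(\mathrm{Tr}(\omega_2^{T}yU^{T})\omega_1+\mathrm{Tr}(\omega_1^{T}yU^{T})\omega_2\big)+xL_\Sigma^{-1}\big((U(\bar\omega_1^{T}\omega_2+\bar\omega_2^{T}\omega_1))_{\mathrm{skew}}\big)\\&+\omega_1L_\Sigma^{-1}\big((x^{T}\bar\omega_2U^{T}+\omega_2^{T}yU^{T})_{\mathrm{skew}}\big)+\omega_2L_\Sigma^{-1}\big((x^{T}\bar\omega_1U^{T}+\omega_1^{T}yU^{T})_{\mathrm{skew}}\big)\\&+\tfrac1K\Big(\mathrm{Tr}(x^{T}\bar\omega_2U^{T}-\omega_2^{T}yU^{T})\,xL_\Sigma^{-1}\big((\omega_1^{T}yU^{T})_{\mathrm{skew}}\big)+\mathrm{Tr}(x^{T}\bar\omega_1U^{T}-\omega_1^{T}yU^{T})\,xL_\Sigma^{-1}\big((\omega_2^{T}yU^{T})_{\mathrm{skew}}\big)\Big),\end{aligned}$$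 $$\begin{aligned}\Gamma_y=&-\tfrac1K\big(\mathrm{Tr}(\bar\omega_2^{T}xU)\bar\omega_1+\mathrm{Tr}(\bar\omega_1^{T}xU)\bar\omega_2\big)-yU^{T}L_\Sigma^{-1}\big((U(\bar\omega_1^{T}\omega_2+\bar\omega_2^{T}\omega_1))_{\mathrm{skew}}\big)U\\&+\bar\omega_1U^{T}L_\Sigma^{-1}\big((Uy^{T}\omega_2+U\bar\omega_2^{T}x)_{\mathrm{skew}}\big)U+\bar\omega_2U^{T}L_\Sigma^{-1}\big((Uy^{T}\omega_1+U\bar\omega_1^{T}x)_{\mathrm{skew}}\big)U\\&+\tfrac1K\Big(\mathrm{Tr}(\omega_2^{T}yU^{T}-x^{T}\bar\omega_2U^{T})\,yU^{T}L_\Sigma^{-1}\big((U\bar\omega_1^{T}x)_{\mathrm{skew}}\big)U+\mathrm{Tr}(\omega_1^{T}yU^{T}-x^{T}\bar\omega_1U^{T})\,yU^{T}L_\Sigma^{-1}\big((U\bar\omega_2^{T}x)_{\mathrm{skew}}\big)U\Big).\end{aligned}$$ (iii) For a horizontal $\mathring\eta=(\eta,\bar\eta)$ with $\mathring\eta_{x0}=(\eta,0)$, $\mathring\eta_{0y}=(0,\bar\eta)$, O'Neill's tensor and its norm are $$A_{\mathring\eta_{x0}}\mathring\eta_{0y}=\Big(xL_\Sigma^{-1}\big((U\bar\eta^{T}\eta)_{\mathrm{skew}}\big),\ -yU^{T}L_\Sigma^{-1}\big((\eta^{T}\bar\eta U^{T})_{\mathrm{skew}}\big)U\Big),$$ $$\langle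 A_{\mathring\eta_{x0}}\mathring\eta_{0y},A_{\mathring\eta_{x0}}\mathring\eta_{0y}\rangle_*=\tfrac1K\mathrm{Tr}\Big(L_\Sigma^{-1}\big((U\bar\eta^{T}\eta)_{\mathrm{skew}}\big)\,\Sigma\,L_\Sigma^{-1}\big((\eta^{T}\bar\eta U^{T})_{\mathrm{skew}}\big)\Big)\ \ge0,$$ and the cross-curvature of the Kim–McCann metric of $c$ on $\mathcal{B}$ at $\mathsf{q}'(\mathring\eta)$ is $$\mathfrak{S}(\mathring\eta)=4\langle A_{\mathring\eta_{x0}}\mathring\eta_{0y},A_{\mathring\eta_{x0}}\mathring\eta_{0y}\rangle_*-\langle\mathring\eta,\mathring\eta\rangle_*^2.$$ (iv) Consequently, if $\langle\mathring\eta,\mathring\eta\rangle_*=0$ then $\mathfrak{S}(\mathring\eta)\ge0$, with equality if and only if $U\bar\eta^{T}\eta$ is symmetric.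
   Context: Fix $\alpha>0$, $1\le k\le n$. $\mathbb{R}^{n\times k}_*$ = full-rank $n\times k$ real matrices; $\mathcal{E}=(\mathbb{R}^{n\times k})^2$ with trace inner product; $\mathcal{Q}=\{(x,y)\in(\mathbb{R}^{n\times k}_* )^2: x^{T}y\text{ invertible}\}$; $x^{T}y=\Sigma U$ is the polar decomposition ($\Sigma$ symmetric positive definite, $U$ orthogonal). $A_{\mathrm{sym}}=\frac12(A+A^{T})$, $A_{\mathrm{skew}}=\frac12(A-A^{T})$; $L_\Sigma X=\Sigma X+X\Sigma$. The metric on $\mathcal{Q}$: $\langle\mathring\xi_1,\mathring\xi_2\rangle_*=-\frac{1}{2K^2}(\mathrm{Tr}(\xi_1^{T}yU^{T})\mathrm{Tr}(\bar\xi_2^{T}xU)+\mathrm{Tr}(\xi_2^{T}yU^{T})\mathrm{Tr}(\bar\xi_1^{T}xU))+\frac{1}{2K}(\mathrm{Tr}(\xi_1^{T}\bar\xi_2U^{T})+\mathrm{Tr}(\xi_2^{T}\bar\xi_1U^{T}))$, i.e. $\mathring\xi_1\cdot\mathsf{g}\mathring\xi_2$ for a self-adjoint invertible operator $\mathsf{g}$; vertical vectors are $(xa,yb)$, $a,b$ skew-symmetric; horizontal vectors are their $\langle\cdot,\cdot\rangle_*$-orthogonal complement, equivalently $(\xi,\bar\xi)$ with $x^{T}\bar\xi U^{T}$ and $y^{T}\xi U$ symmetric. $\mathsf{q}(x,y)=([x],[y])$ is a semi-Riemannian submersion onto $\mathcal{B}=\{([x],[y])\in S^+(n,k)^2: x^{T}y$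 invertible$\}$ ($S^+(n,k)$ = rank-$k$ PSD $n\times n$ matrices $\cong\mathbb{R}^{n\times k}_*/O(k)$ via $x\mapsto xx^T$) with the Kim–McCann metric of the cost $c([x],[y])=-\log(\alpha+\mathrm{Tr}\,\Sigma)$, i.e. pairing $-\frac12(D_\xi\bar D_{\bar\eta}c+\bar D_{\bar\xi}D_\eta c)$. The Christoffel function $\Gamma$ of a connection means $\nabla_XY=D_XY+\Gamma(X,Y)$. O'Neill's tensor: $A_\xi\eta=\frac12\mathsf{V}[h_\xi,h_\eta]$ for horizontal $\xi,\eta$ ($\mathsf{V}=I-\mathsf{H}$). Cross-curvature (MTW tensor) of a tangent vector $\mathring\zeta=(\zeta,\bar\zeta)$ of $\mathcal{B}$: $\mathfrak{S}(\mathring\zeta)=\langle R_{\mathring\zeta_{x0},\mathring\zeta_{0y}}\mathring\zeta_{0y},\mathring\zeta_{x0}\rangle_{KM}$, where $R_{X,Y}=\nabla_X\nabla_Y-\nabla_Y\nabla_X-\nabla_{[X,Y]}$ is the curvature of the Levi-Civita connection of the Kim–McCann metric, $\mathring\zeta_{x0}=(\zeta,0)$, $\mathring\zeta_{0y}=(0,\bar\zeta)$; null vectors are those with $\langle\mathring\zeta,\mathring\zeta\rangle_{KM}=0$. *)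

theory Defs
  imports "HOL-Analysis.Analysis"
begin

type_synonym ('k,'n) mat = "real^'k^'n"
type_synonym ('k,'n) amb = "(real^'k^'n) \<times> (real^'k^'n)"

definition msym :: "real^'k^'k \<Rightarrow> real^'k^'k" where
  "msym A = (1/2) *\<^sub>R (A + transpose A)"

definition mskew :: "real^'k^'k \<Rightarrow> real^'k^'k" where
  "mskew A = (1/2) *\<^sub>R (A - transpose A)"

definition sym_posdef :: "real^'k^'k \<Rightarrow> bool" where
  "sym_posdef S \<longleftrightarrow> transpose S = S \<and> (\<forall>v. v \<noteq> 0 \<longrightarrow> v \<bullet> (S *v v) > 0)"

text \<open>Polar decomposition M = Sigma U, Sigma symmetric positive definite, U orthogonal.\<close>
definition polSigma :: "real^'k^'k \<Rightarrow> real^'k^'k" where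
  "polSigma M = (THE S. sym_posdef S \<and> S ** S = M ** transpose M)"

definition polU :: "real^'k^'k \<Rightarrow> real^'k^'k" where
  "polU M = matrix_inv (polSigma M) ** M"

definition Linv :: "real^'k^'k \<Rightarrow> real^'k^'k \<Rightarrow> real^'k^'k" where
  "Linv S A = (THE X. S ** X + X ** S = A)"

definition Qset :: "('k::finite,'n::finite) amb set" where
  "Qset = {(x,y). rank x = CARD('k) \<and> rank y = CARD('k) \<and> invertible (transpose x ** y)}"

definition SigQ :: "('k::finite,'n::finite) amb \<Rightarrow> real^'k^'k" where
  "SigQ q = polSigma (transpose (fst q) ** snd q)"

definition UQ :: "('k::finite,'n::finite) amb \<Rightarrow> real^'k^'k" where
  "UQ q = polU (transpose (fst q) ** snd q)"

definition KQ :: "real \<Rightarrow> ('k::finite,'n::finite) amb \<Rightarrow> real" where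
  "KQ \<alpha> q = \<alpha> + trace (SigQ q)"

definition gQ :: "real \<Rightarrow> ('k::finite,'n::finite) amb \<Rightarrow> ('k,'n) amb \<Rightarrow> ('k,'n) amb \<Rightarrow> real" where
  "gQ \<alpha> q e1 e2 = (let x = fst q; y = snd q; U = UQ q; K = KQ \<alpha> q;
      a = fst e1; ab = snd e1; b = fst e2; bb = snd e2 in
      - 1 / (2 * K^2) * (trace (transpose a ** y ** transpose U) * trace (transpose bb ** x ** U)
                        + trace (transpose b ** y ** transpose U) * trace (transpose ab ** x ** U))
      + 1 / (2 * K) * (trace (transpose a ** bb ** transpose U) + trace (transpose b ** ab ** transpose U)))"

definition Vert :: "('k::finite,'n::finite) amb \<Rightarrow> ('k,'n) amb set" where
  "Vert q = {(fst q ** a, snd q ** b) | a b. transpose a = - a \<and> transpose b = - b}"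

definition Hor :: "real \<Rightarrow> ('k::finite,'n::finite) amb \<Rightarrow> ('k,'n) amb set" where
  "Hor \<alpha> q = {h. \<forall>v\<in>Vert q. gQ \<alpha> q h v = 0}"

definition hproj :: "real \<Rightarrow> ('k::finite,'n::finite) amb \<Rightarrow> ('k,'n) amb \<Rightarrow> ('k,'n) amb" where
  "hproj \<alpha> q w = (THE h. h \<in> Hor \<alpha> q \<and> (\<forall>h'\<in>Hor \<alpha> q. gQ \<alpha> q (w - h) h' = 0))"

definition vproj :: "real \<Rightarrow> ('k::finite,'n::finite) amb \<Rightarrow> ('k,'n) amb \<Rightarrow> ('k,'n) amb" where
  "vproj \<alpha> q w = w - hproj \<alpha> q w"

definition dd :: "'a::real_normed_vector \<Rightarrow> ('a \<Rightarrow> 'b::real_normed_vector) \<Rightarrow> 'a \<Rightarrow> 'b" where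
  "dd v f p = vector_derivative (\<lambda>t::real. f (p + t *\<^sub>R v)) (at 0)"

fun iterdd :: "'a::real_normed_vector list \<Rightarrow> ('a \<Rightarrow> 'b::real_normed_vector) \<Rightarrow> 'a \<Rightarrow> 'b" where
  "iterdd [] f = f"
| "iterdd (v # vs) f = dd v (iterdd vs f)"

definition smooth_on :: "'a::real_normed_vector set \<Rightarrow> ('a \<Rightarrow> 'b::real_normed_vector) \<Rightarrow> bool" where
  "smooth_on W f \<longleftrightarrow> open W \<and> (\<forall>vs. continuous_on W (iterdd vs f) \<and>
      (\<forall>v. \<forall>u\<in>W. (\<lambda>t::real. iterdd vs f (u + t *\<^sub>R v)) differentiable (at 0)))"

text \<open>Christoffel function at p of the Levi-Civita connection of a (pseudo-)metric gm
  (gm p = bilinear form at p) on an open subset of a vector space: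
  nabla_X Y = D_X Y + Gamma(X,Y); torsion-free (symmetric) and metric compatible.\<close>
definition is_lc_christoffel :: "('a::real_normed_vector \<Rightarrow> 'a \<Rightarrow> 'a \<Rightarrow> real) \<Rightarrow> 'a \<Rightarrow> ('a \<Rightarrow> 'a \<Rightarrow> 'a) \<Rightarrow> bool" where
  "is_lc_christoffel gm p G \<longleftrightarrow> (\<forall>a b. G a b = G b a) \<and>
     (\<forall>a b c. dd a (\<lambda>p'. gm p' b c) p = gm p (G a b) c + gm p b (G a c))"

definition lc_christoffel :: "('a::real_normed_vector \<Rightarrow> 'a \<Rightarrow> 'a \<Rightarrow> real) \<Rightarrow> 'a \<Rightarrow> 'a \<Rightarrow> 'a \<Rightarrow> 'a" where
  "lc_christoffel gm p = (THE G. is_lc_christoffel gm p G)"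

text \<open>Curvature R_{X,Y}Z at p for constant vector fields X,Y,Z (so [X,Y]=0).\<close>
definition lc_curv :: "('a::real_normed_vector \<Rightarrow> 'a \<Rightarrow> 'a \<Rightarrow> real) \<Rightarrow> 'a \<Rightarrow> 'a \<Rightarrow> 'a \<Rightarrow> 'a \<Rightarrow> 'a" where
  "lc_curv gm p X Y Z =
     dd X (\<lambda>p'. lc_christoffel gm p' Y Z) p - dd Y (\<lambda>p'. lc_christoffel gm p' X Z) p
     + lc_christoffel gm p X (lc_christoffel gm p Y Z) - lc_christoffel gm p Y (lc_christoffel gm p X Z)"

definition hor_field_at :: "real \<Rightarrow> ('k::finite,'n::finite) amb \<Rightarrow> (('k,'n) amb \<Rightarrow> ('k,'n) amb) \<Rightarrow> bool" where
  "hor_field_at \<alpha> q X \<longleftrightarrow> X differentiable (at q) \<and> (\<exists>r>0. \<forall>p\<in>ball q r. X p \<in> Hor \<alpha> p)"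

text \<open>A_xi eta = 1/2 V [h_xi, h_eta] for horizontal vector fields extending xi, eta
  ([X,Y](q) = D_{X(q)} Y - D_{Y(q)} X in the flat ambient space; the value is tensorial).\<close>
definition oneillA :: "real \<Rightarrow> ('k::finite,'n::finite) amb \<Rightarrow> ('k,'n) amb \<Rightarrow> ('k,'n) amb \<Rightarrow> ('k,'n) amb" where
  "oneillA \<alpha> q xi eta = (THE v. \<forall>X Y. hor_field_at \<alpha> q X \<and> hor_field_at \<alpha> q Y \<and> X q = xi \<and> Y q = eta
       \<longrightarrow> (1/2) *\<^sub>R vproj \<alpha> q (dd xi Y q - dd eta X q) = v)"

definition SplusK :: "'k::finite itself \<Rightarrow> (real^'n::finite^'n) set" where
  "SplusK _ = {x ** transpose x | x :: real^'k^'n. rank x = CARD('k)}"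

definition qmap :: "('k::finite,'n::finite) amb \<Rightarrow> (real^'n^'n) \<times> (real^'n^'n)" where
  "qmap q = (fst q ** transpose (fst q), snd q ** transpose (snd q))"

definition dqmap :: "('k::finite,'n::finite) amb \<Rightarrow> ('k,'n) amb \<Rightarrow> (real^'n^'n) \<times> (real^'n^'n)" where
  "dqmap q e = (fst e ** transpose (fst q) + fst q ** transpose (fst e),
                snd e ** transpose (snd q) + snd q ** transpose (snd e))"

definition Bset :: "'k::finite itself \<Rightarrow> ((real^'n::finite^'n) \<times> (real^'n^'n)) set" where
  "Bset _ = qmap ` (Qset :: ('k,'n) amb set)"

definition fac :: "real^'n::finite^'n \<Rightarrow> real^'k::finite^'n" where
  "fac P = (SOME x. rank x = CARD('k) \<and> x ** transpose x = P)"

definition cost :: "'k::finite itself \<Rightarrow> real \<Rightarrow> real^'n::finite^'n \<Rightarrow> real^'n^'n \<Rightarrow> real" where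
  "cost _ \<alpha> P Q = - ln (\<alpha> + trace (polSigma (transpose (fac P :: real^'k^'n) ** (fac Q :: real^'k^'n))))"

text \<open>A local chart of S^+(n,k): a smooth immersion of an open subset of R^d, d = dim S^+(n,k).\<close>
definition is_chart :: "'k::finite itself \<Rightarrow> (real^'d::finite) set \<Rightarrow> (real^'d \<Rightarrow> real^'n::finite^'n) \<Rightarrow> bool" where
  "is_chart K W \<phi> \<longleftrightarrow>
     CARD('d) = CARD('n) * CARD('k) - CARD('k) * (CARD('k) - 1) div 2 \<and>
     smooth_on W \<phi> \<and> \<phi> ` W \<subseteq> SplusK K \<and> (\<forall>u\<in>W. \<forall>v. v \<noteq> 0 \<longrightarrow> dd v \<phi> u \<noteq> 0)"

definition km_coord :: "'k::finite itself \<Rightarrow> real \<Rightarrow> (real^'d::finite \<Rightarrow> real^'n::finite^'n) \<Rightarrow> (real^'d \<Rightarrow> real^'n^'n)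
     \<Rightarrow> ((real^'d) \<times> (real^'d)) \<Rightarrow> ((real^'d) \<times> (real^'d)) \<Rightarrow> ((real^'d) \<times> (real^'d)) \<Rightarrow> real" where
  "km_coord K \<alpha> \<phi> \<psi> p X Y = (let C = (\<lambda>r. cost K \<alpha> (\<phi> (fst r)) (\<psi> (snd r))) in
      - (1/2) * (dd (fst X, 0) (dd (0, snd Y) C) p + dd (0, snd X) (dd (fst Y, 0) C) p))"

definition cross_curv_coord :: "'k::finite itself \<Rightarrow> real \<Rightarrow> (real^'d::finite \<Rightarrow> real^'n::finite^'n) \<Rightarrow> (real^'d \<Rightarrow> real^'n^'n)
     \<Rightarrow> real^'d \<Rightarrow> real^'d \<Rightarrow> real^'d \<Rightarrow> real^'d \<Rightarrow> real" where
  "cross_curv_coord K \<alpha> \<phi> \<psi> u0 ub0 a ab =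
     (let gm = km_coord K \<alpha> \<phi> \<psi>; p = (u0, ub0); X = (a, 0); Y = (0, ab) in
      gm p (lc_curv gm p X Y Y) X)"

end

theory Submission
  imports Defs
begin

text \<open>
  Absorbing \<open>U\<close> into \<open>y\<close>, that is putting \<open>z = y U\<^sup>T\<close>, gives \<open>x\<^sup>T z = \<Sigma>\<close>, and the metric pairs the
  two components through \<open>\<langle>a, c\<rangle> / 2K - \<langle>a, z\<rangle> \<langle>c, x\<rangle> / 2K\<^sup>2\<close>, a rank-one perturbation of the trace form.
  The Christoffel function and O'Neill's tensor then follow from one derivative formula: if
  \<open>M = \<Sigma> U\<close> then \<open>U' = W U\<close>, where \<open>L\<^sub>\<Sigma> W\<close> is twice the skew part of \<open>M' U\<^sup>T\<close>.

  The cross-curvature is computed without the curvature equation of a submersion. Near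
  \<open>([x], [y])\<close> the quotient map has the explicit smooth section \<open>P \<mapsto> P z sqrt(z\<^sup>T P z)\<^sup>-\<^sup>1\<close>, and likewise
  with \<open>x\<close> in place of \<open>z\<close> for the second factor. Along these sections \<open>U = I\<close> on both coordinate
  slices through the base point, so the only trace that the quotient leaves in \<open>\<partial>\<^sub>s\<^sup>2 \<partial>\<^sub>t\<^sup>2 tr \<Sigma>\<close> comes
  from \<open>\<partial>\<^sub>s \<partial>\<^sub>t U\<close>; this is the O'Neill term. What remains is the cross-curvature of
  \<open>- log (\<alpha> + \<langle>x, z\<rangle>)\<close> on a vector space, namely \<open>- \<langle>\<eta>, \<eta>\<rangle>\<^sup>2\<close>.
\<close>

section \<open>Iterated directional derivatives\<close>

text \<open>The definitions shape the work. The cost takes factors of its arguments from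
  \<open>fac\<close>, an arbitrary choice without any continuity, so smoothness of the cost has to
  be read off from other factors, chosen smoothly near each point and related to the first by
  orthogonal matrices. \<open>polSigma\<close>, \<open>Linv\<close> and the Christoffel functions
  are given by unique existence; their differentiability comes from the equations that they solve,
  and the derivatives solve equations of the same kind. The sections freeze \<open>z\<close> and
  \<open>x\<close> at the base point because \<open>z^T X(u)\<close> and \<open>x^T Z(v)\<close> are
  then positive definite, which kills all pure derivatives of \<open>U\<close>. Second derivatives
  of the sections enter both the fourth derivative of the cost and the Christoffel vectors, and
  cancel. A Kim-McCann metric has no Christoffel components that mix the two factors, so its
  cross-curvature is one fourth derivative minus one pairing of two Christoffel vectors.\<close>

primrec Dk :: "nat \<Rightarrow> ('a::real_normed_vector \<Rightarrow> 'b::real_normed_vector) \<Rightarrow> 'a set \<Rightarrow> bool" where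
  "Dk 0 f D = True"
| "Dk (Suc n) f D = ((\<forall>p\<in>D. f differentiable (at p)) \<and> (\<forall>v. Dk n (dd v f) D))"

text \<open>Every iterated derivative is differentiable in the Frechet sense, whereas
  \<open>smooth_on\<close> asks for continuity and derivatives along lines. The Frechet form is
  closed under products, linear substitution and implicit equations.\<close>

definition smooth :: "('a::real_normed_vector \<Rightarrow> 'b::real_normed_vector) \<Rightarrow> 'a set \<Rightarrow> bool" where
  "smooth f D \<longleftrightarrow> (\<forall>n. Dk n f D)"

section \<open>Rules for directional derivatives and for smoothness\<close>

lemma has_derivative_imp_line:
  assumes "(f has_derivative f') (at p)"
  shows "((\<lambda>t::real. f (p + t *\<^sub>R v)) has_vector_derivative f' v) (at 0)"
proof -
  have "((\<lambda>t::real. p + t *\<^sub>R v) has_derivative (\<lambda>t. t *\<^sub>R v)) (at 0)"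
    by (auto intro!: derivative_eq_intros)
  from has_derivative_compose[OF this, of f f'] assms
  have "((\<lambda>t. f (p + t *\<^sub>R v)) has_derivative (\<lambda>t. f' (t *\<^sub>R v))) (at 0)" by simp
  moreover have "f' (t *\<^sub>R v) = t *\<^sub>R f' v" for t
    using has_derivative_linear[OF assms] by (simp add: linear_scale)
  ultimately show ?thesis by (simp add: has_vector_derivative_def)
qed

lemma dd_eqI:
  assumes "(f has_derivative f') (at p)"
  shows "dd v f p = f' v"
  unfolding dd_def using has_derivative_imp_line[OF assms] by (rule vector_derivative_at)

lemma has_derivative_dd:
  assumes "f differentiable (at p)"
  shows "(f has_derivative (\<lambda>v. dd v f p)) (at p)"
proof -
  obtain f' where f': "(f has_derivative f') (at p)" using assms by (auto simp: differentiable_def)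
  then have "f' = (\<lambda>v. dd v f p)" using dd_eqI[OF f'] by auto
  with f' show ?thesis by simp
qed

lemma linear_dd: "f differentiable (at p) \<Longrightarrow> linear (\<lambda>v. dd v f p)"
  using has_derivative_dd has_derivative_linear by blast

lemma differentiable_line_deriv:
  fixes f :: "'a::real_normed_vector \<Rightarrow> real"
  assumes "f differentiable (at p)"
  shows "((\<lambda>t. f (p + t *\<^sub>R v)) has_real_derivative dd v f p) (at 0)"
  using has_derivative_imp_line[OF has_derivative_dd[OF assms]]
  by (simp add: has_real_derivative_iff_has_vector_derivative)

lemma dd_cong_eventually:
  assumes "eventually (\<lambda>x. f x = g x) (nhds p)"
  shows "dd v f p = dd v g p"
proof -
  have "filterlim (\<lambda>t::real. p + t *\<^sub>R v) (nhds p) (nhds 0)"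
    using tendsto_add[OF tendsto_const[of p] tendsto_scaleR[OF filterlim_ident[of "nhds (0::real)"] tendsto_const[of v]]]
    by simp
  then have ev: "eventually (\<lambda>t::real. f (p + t *\<^sub>R v) = g (p + t *\<^sub>R v)) (nhds 0)"
    using assms unfolding filterlim_iff by blast
  then have "eventually (\<lambda>t::real. t \<in> UNIV \<longrightarrow> f (p + t *\<^sub>R v) = g (p + t *\<^sub>R v)) (nhds 0)"
    by eventually_elim simp
  then show ?thesis unfolding dd_def
    by (intro vector_derivative_cong_eq) auto
qed

lemma dd_cong:
  assumes "open D" "p \<in> D" "\<And>x. x \<in> D \<Longrightarrow> f x = g x"
  shows "dd v f p = dd v g p"
  by (rule dd_cong_eventually) (use assms in \<open>auto simp: eventually_nhds\<close>)

lemma differentiable_cong_open: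
  assumes "open D" "p \<in> D" "\<And>x. x \<in> D \<Longrightarrow> f x = g x" "f differentiable (at p)"
  shows "g differentiable (at p)"
  using assms unfolding differentiable_def
  by (meson has_derivative_transform_within_open)

lemma Dk_cong:
  assumes "open D" "Dk n f D" "\<And>x. x \<in> D \<Longrightarrow> f x = g x"
  shows "Dk n g D"
  using assms(2,3)
proof (induction n arbitrary: f g)
  case (Suc n)
  have "Dk n (dd v g) D" for v
    by (rule Suc.IH[of "dd v f"]) (use Suc.prems dd_cong[OF assms(1), of _ f g] in auto)
  then show ?case using Suc.prems differentiable_cong_open[OF assms(1), of _ f g] by auto
qed simp

lemma smooth_cong:
  assumes "open D" "smooth f D" "\<And>x. x \<in> D \<Longrightarrow> f x = g x"
  shows "smooth g D"
  using assms Dk_cong unfolding smooth_def by metis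

lemma Dk_SucD: "Dk (Suc n) f D \<Longrightarrow> Dk n f D"
  by (induction n arbitrary: f) auto

lemma Dk_subset: "Dk n f D \<Longrightarrow> D' \<subseteq> D \<Longrightarrow> Dk n f D'"
  by (induction n arbitrary: f) auto

lemma smooth_subset: "smooth f D \<Longrightarrow> D' \<subseteq> D \<Longrightarrow> smooth f D'"
  using Dk_subset unfolding smooth_def by blast

lemma Dk_local:
  assumes "\<And>p. p \<in> D \<Longrightarrow> \<exists>D'. p \<in> D' \<and> Dk n f D'"
  shows "Dk n f D"
  using assms
proof (induction n arbitrary: f)
  case (Suc n)
  have "Dk n (dd v f) D" for v
    using Suc.IH[of "dd v f"] Suc.prems by (metis Dk.simps(2))
  moreover have "\<forall>p\<in>D. f differentiable (at p)" using Suc.prems by fastforce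
  ultimately show ?case by simp
qed simp

text \<open>Used for the cost on a whole chart domain: the sections that prove its smoothness depend
  on the base point.\<close>

lemma smooth_local:
  assumes "\<And>p. p \<in> D \<Longrightarrow> \<exists>D'. p \<in> D' \<and> smooth f D'"
  shows "smooth f D"
  using assms Dk_local unfolding smooth_def by metis

lemma smooth_diff: "smooth f D \<Longrightarrow> p \<in> D \<Longrightarrow> f differentiable (at p)"
  unfolding smooth_def using Dk.simps(2) by blast

lemma smooth_dd: "smooth f D \<Longrightarrow> smooth (dd v f) D"
  unfolding smooth_def using Dk.simps(2) by blast

lemma smooth_continuous: "smooth f D \<Longrightarrow> p \<in> D \<Longrightarrow> isCont f p"
  using smooth_diff differentiable_imp_continuous_within by blast

lemma dd_const [simp]: "dd v (\<lambda>_. c) = (\<lambda>_. 0)"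
  by (rule ext, rule dd_eqI) simp

lemma Dk_const: "Dk n (\<lambda>_. c) D"
  by (induction n arbitrary: c) auto

lemma dd_add:
  "f differentiable (at p) \<Longrightarrow> g differentiable (at p) \<Longrightarrow>
    dd v (\<lambda>x. f x + g x) p = dd v f p + dd v g p"
  by (rule dd_eqI) (intro has_derivative_add has_derivative_dd)

lemma dd_bilinear:
  assumes "bounded_bilinear \<beta>" "f differentiable (at p)" "g differentiable (at p)"
  shows "dd v (\<lambda>x. \<beta> (f x) (g x)) p = \<beta> (f p) (dd v g p) + \<beta> (dd v f p) (g p)"
  by (rule dd_eqI) (intro bounded_bilinear.FDERIV[OF assms(1)] has_derivative_dd assms)

lemma differentiable_bilinear:
  assumes "bounded_bilinear \<beta>" "f differentiable (at p)" "g differentiable (at p)"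
  shows "(\<lambda>x. \<beta> (f x) (g x)) differentiable (at p)"
  using bounded_bilinear.FDERIV[OF assms(1) has_derivative_dd[OF assms(2)] has_derivative_dd[OF assms(3)]]
  by (auto simp: differentiable_def)

lemma dd_linear:
  assumes "bounded_linear L" "f differentiable (at p)"
  shows "dd v (\<lambda>x. L (f x)) p = L (dd v f p)"
  by (rule dd_eqI) (intro bounded_linear.has_derivative[OF assms(1)] has_derivative_dd assms)

lemma differentiable_linear:
  assumes "bounded_linear L" "f differentiable (at p)"
  shows "(\<lambda>x. L (f x)) differentiable (at p)"
  using bounded_linear.has_derivative[OF assms(1) has_derivative_dd[OF assms(2)]]
  by (auto simp: differentiable_def)

lemma Dk_add:
  assumes "open D" "Dk n f D" "Dk n g D"
  shows "Dk n (\<lambda>x. f x + g x) D"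
  using assms(2,3)
proof (induction n arbitrary: f g)
  case (Suc n)
  have "Dk n (dd v (\<lambda>x. f x + g x)) D" for v
    by (rule Dk_cong[OF assms(1) Suc.IH[of "dd v f" "dd v g"]]) (use Suc.prems in \<open>auto simp: dd_add\<close>)
  with Suc.prems show ?case by auto
qed simp

lemma Dk_linear:
  assumes "open D" "bounded_linear L" "Dk n f D"
  shows "Dk n (\<lambda>x. L (f x)) D"
  using assms(3)
proof (induction n arbitrary: f)
  case (Suc n)
  have "Dk n (dd v (\<lambda>x. L (f x))) D" for v
    by (rule Dk_cong[OF assms(1) Suc.IH[of "dd v f"]])
      (use Suc.prems in \<open>auto simp: dd_linear assms\<close>)
  with Suc.prems show ?case by (auto intro: differentiable_linear[OF assms(2)])
qed simp

lemma Dk_bilinear: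
  assumes "open D" "bounded_bilinear \<beta>" "Dk n f D" "Dk n g D"
  shows "Dk n (\<lambda>x. \<beta> (f x) (g x)) D"
  using assms(3,4)
proof (induction n arbitrary: f g)
  case (Suc n)
  have f: "Dk n f D" and g: "Dk n g D" using Suc.prems by (auto dest: Dk_SucD simp del: Dk.simps)
  have "Dk n (dd v (\<lambda>x. \<beta> (f x) (g x))) D" for v
    by (rule Dk_cong[OF assms(1) Dk_add[OF assms(1) Suc.IH[of f "dd v g"] Suc.IH[of "dd v f" g]]])
      (use Suc.prems f g in \<open>auto simp: dd_bilinear assms\<close>)
  with Suc.prems show ?case by (auto intro: differentiable_bilinear[OF assms(2)])
qed simp

lemma Dk_precompose:
  assumes "bounded_linear L" "Dk n f D" "\<And>x. x \<in> D' \<Longrightarrow> L x \<in> D" "open D'"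
  shows "Dk n (\<lambda>x. f (L x)) D'"
  using assms(2)
proof (induction n arbitrary: f)
  case (Suc n)
  have *: "((\<lambda>x. f (L x)) has_derivative (\<lambda>v. dd (L v) f (L p))) (at p)" if "p \<in> D'" for p
    by (rule has_derivative_compose[OF bounded_linear_imp_has_derivative[OF assms(1)]])
      (use Suc.prems that assms(3) in \<open>auto intro!: has_derivative_dd\<close>)
  have "Dk n (dd v (\<lambda>x. f (L x))) D'" for v
    by (rule Dk_cong[OF assms(4) Suc.IH[of "dd (L v) f"]])
      (use Suc.prems dd_eqI[OF *] in auto)
  with * show ?case by (auto simp: differentiable_def)
qed simp

section \<open>Linear equations with differentiable coefficients\<close>

lemma has_derivative_zeroI:
  fixes m :: "'a::real_normed_vector \<Rightarrow> 'b::real_normed_vector"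
    and f :: "'a \<Rightarrow> 'c::real_normed_vector"
  assumes m: "m differentiable (at p)" "m p = 0" and e: "(e \<longlongrightarrow> 0) (at p)"
    and bound: "\<And>x. norm (f x) \<le> norm (m x) * e x" and e0: "\<And>x. 0 \<le> e x"
  shows "(f has_derivative (\<lambda>h. 0)) (at p)"
  unfolding has_derivative_within
proof (intro conjI)
  define m' where "m' = (\<lambda>v. dd v m p)"
  have m': "(m has_derivative m') (at p)" using has_derivative_dd[OF m(1)] by (simp add: m'_def)
  obtain B where B: "\<And>h. norm (m' h) \<le> norm h * B" "0 \<le> B"
    using bounded_linear.nonneg_bounded[OF has_derivative_bounded_linear[OF m']] by blast
  \<comment> \<open>\<open>Q y\<close> bounds \<open>norm (m y) / norm (y - p)\<close> and tends to
    \<open>B\<close>, so \<open>f\<close> is at most \<open>norm (y - p)\<close> times a quantity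
    that tends to 0.\<close>
  define Q where "Q y = norm (m y - m p - m' (y - p)) / norm (y - p) + B" for y
  have "((\<lambda>y. (m y - m p - m' (y - p)) /\<^sub>R norm (y - p)) \<longlongrightarrow> 0) (at p)"
    using m' unfolding has_derivative_within by (simp add: divide_inverse algebra_simps)
  then have "((\<lambda>y. norm ((m y - m p - m' (y - p)) /\<^sub>R norm (y - p)) + B) \<longlongrightarrow> 0 + B) (at p)"
    by (intro tendsto_add tendsto_const tendsto_norm_zero)
  from tendsto_mult[OF this e]
  have lim: "((\<lambda>y. Q y * e y) \<longlongrightarrow> 0) (at p)"
    by (simp add: Q_def divide_inverse mult.commute)
  have f0: "f p = 0" using bound[of p] m(2) by simp
  show "((\<lambda>y. (1 / norm (y - p)) *\<^sub>R (f y - (f p + 0))) \<longlongrightarrow> 0) (at p)"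
  proof (rule Lim_null_comparison[OF _ lim], rule always_eventually, rule allI)
    fix y
    show "norm ((1 / norm (y - p)) *\<^sub>R (f y - (f p + 0)))
      \<le> Q y * e y"
    proof (cases "y = p")
      case False
      then have n: "norm (y - p) > 0" by simp
      have "norm (m y) = norm ((m y - m p - m' (y - p)) + m' (y - p))" by (simp add: m(2))
      also have "\<dots> \<le> norm (m y - m p - m' (y - p)) + norm (y - p) * B"
        using norm_triangle_le B(1) by (smt (verit))
      also have "\<dots> = norm (y - p) * Q y"
        using n by (simp add: Q_def field_simps)
      finally have "norm (m y) * e y \<le> (norm (y - p) * Q y) * e y"
        by (rule mult_right_mono[OF _ e0])
      with bound[of y] have "norm (f y) \<le> norm (y - p) * (Q y * e y)"
        by (simp add: mult.assoc)
      then show ?thesis using n by (simp add: f0 divide_simps mult.commute)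
    qed (use B e0 f0 in \<open>simp add: Q_def\<close>)
  qed
qed simp

text \<open>A product rule with a merely continuous factor: as \<open>m\<close> vanishes at
  \<open>p\<close>, the error \<open>\<beta> (m x) (w x - w p)\<close> is a term of first order
  times a term that tends to 0.\<close>

lemma has_derivative_bilinear_vanishing:
  fixes m :: "'a::real_normed_vector \<Rightarrow> 'b::real_normed_vector"
  assumes "bounded_bilinear \<beta>" "(m has_derivative m') (at p)" "m p = 0" "isCont w p"
  shows "((\<lambda>x. \<beta> (m x) (w x)) has_derivative (\<lambda>h. \<beta> (m' h) (w p))) (at p)"
proof -
  interpret bounded_bilinear \<beta> by fact
  obtain K where K: "\<And>a b. norm (\<beta> a b) \<le> norm a * norm b * K" "0 < K" using pos_bounded by blast
  have 1: "((\<lambda>x. \<beta> (m x) (w p)) has_derivative (\<lambda>h. \<beta> (m' h) (w p))) (at p)"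
    by (rule bounded_linear.has_derivative[OF bounded_linear_left assms(2)])
  have "((\<lambda>x. \<beta> (m x) (w x - w p)) has_derivative (\<lambda>h. 0)) (at p)"
  proof (rule has_derivative_zeroI[where e = "\<lambda>x. norm (w x - w p) * K"])
    show "((\<lambda>y. norm (w y - w p) * K) \<longlongrightarrow> 0) (at p)"
      using assms(4) unfolding isCont_def by (intro tendsto_mult_left_zero tendsto_norm_zero) (simp add: LIM_zero)
    show "norm (\<beta> (m x) (w x - w p)) \<le> norm (m x) * (norm (w x - w p) * K)" for x
      using K(1)[of "m x" "w x - w p"] by (simp add: mult.assoc)
  qed (use assms K in \<open>auto simp: differentiable_def\<close>)
  from has_derivative_add[OF 1 this] show ?thesis by (simp add: diff_right)
qed

text \<open>A left inverse \<open>T\<close> of \<open>\<beta> (M p)\<close> turns the equation into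
  \<open>v = T r - T (\<beta> (M - M p) v)\<close>. Near \<open>p\<close> the last term is a small
  multiple of \<open>v\<close>; this gives continuity first and differentiability
  afterwards.\<close>

lemma differentiable_solve:
  fixes \<beta> :: "'m::real_normed_vector \<Rightarrow> 'v::euclidean_space \<Rightarrow> 'v"
    and M :: "'a::real_normed_vector \<Rightarrow> 'm"
  assumes bil: "bounded_bilinear \<beta>" and "open D" "p \<in> D"
    and M: "M differentiable (at p)" and r: "r differentiable (at p)"
    and eq: "\<And>x. x \<in> D \<Longrightarrow> \<beta> (M x) (v x) = r x"
    and inj: "\<And>w. \<beta> (M p) w = 0 \<Longrightarrow> w = 0"
  shows "v differentiable (at p)"
    and "\<beta> (M p) (dd h v p) = dd h r p - \<beta> (dd h M p) (v p)"
proof -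
  interpret bounded_bilinear \<beta> by fact
  have lin: "linear (\<beta> (M p))" by (rule bounded_linear.linear[OF bounded_linear_right])
  have "inj (\<beta> (M p))" using inj linear_injective_0[OF lin] by blast
  then obtain T where T: "linear T" "T \<circ> \<beta> (M p) = id"
    using linear_injective_left_inverse[OF lin] by blast
  then have bT: "bounded_linear T" by (simp add: linear_conv_bounded_linear)
  obtain K where K: "\<And>a. norm (T a) \<le> norm a * K" "K > 0"
    using bounded_linear.pos_bounded[OF bT] by blast
  obtain B where B: "\<And>a b. norm (\<beta> a b) \<le> norm a * norm b * B" "B > 0" using pos_bounded by blast
  have vx: "v x = T (r x) - T (\<beta> (M x - M p) (v x))" if "x \<in> D" for x
  proof -
    have "v x = T (\<beta> (M p) (v x))" using T(2) by (metis comp_apply id_apply)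
    also have "\<beta> (M p) (v x) = r x - \<beta> (M x - M p) (v x)" using eq[OF that] by (simp add: diff_left)
    finally show ?thesis by (simp add: linear_diff[OF T(1)])
  qed
  have evO: "eventually (\<lambda>x. x \<in> D) (at p)"
    using assms(2,3) by (meson eventually_at_topological)
  have cM: "(M \<longlongrightarrow> M p) (at p)" and cr: "(r \<longlongrightarrow> r p) (at p)"
    using M r differentiable_imp_continuous_within continuous_within by blast+
  let ?m = "\<lambda>x. norm (M x - M p)" and ?r = "\<lambda>x. norm (r x - r p)" and ?e = "\<lambda>x. norm (v x - v p)"
    and ?V = "norm (v p)"
  have cv: "isCont v p"
    unfolding isCont_def
  proof (rule LIM_zero_cancel, rule Lim_null_comparison)
    have "((\<lambda>x. ?m x) \<longlongrightarrow> 0) (at p)"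
      using cM by (intro tendsto_norm_zero) (simp add: LIM_zero)
    \<comment> \<open>Below this threshold the coefficient of \<open>norm (v x - v p)\<close> on the
      right is at most 1/2 and is absorbed on the left; hence the factor 2 in the bound.\<close>
    then have "eventually (\<lambda>x. ?m x < 1 / (2 * K * B)) (at p)"
      by (rule order_tendstoD) (use K B in simp)
    then show "eventually (\<lambda>x. ?e x \<le>
      2 * (K * ?r x + K * B * ?m x * ?V)) (at p)"
      using evO
    proof eventually_elim
      case (elim x)
      have "v p = T (r p)" using vx[OF assms(3)] by (simp add: zero_left linear_0[OF T(1)])
      then have "v x - v p = T (r x - r p) - T (\<beta> (M x - M p) (v x))"
        using vx[OF elim(2)] by (simp add: linear_diff[OF T(1)])
      then have "?e x \<le> norm (T (r x - r p)) + norm (T (\<beta> (M x - M p) (v x)))"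
        by (metis norm_triangle_ineq4)
      also have "\<dots> \<le> ?r x * K + norm (\<beta> (M x - M p) (v x)) * K"
        by (intro add_mono K)
      also have "\<dots> \<le> ?r x * K + (?m x * norm (v x) * B) * K"
        using B K by (intro add_left_mono mult_right_mono) auto
      also have "\<dots> \<le> ?r x * K + (?m x * (?e x + ?V) * B) * K"
        using B K norm_triangle_sub[of "v x" "v p"]
        by (intro add_left_mono mult_right_mono mult_left_mono) (auto simp: add.commute)
      also have "\<dots> = K * ?r x + K * B * ?m x * ?V
          + (K * B * ?m x) * ?e x" by (simp add: algebra_simps)
      also have "\<dots> \<le> K * ?r x + K * B * ?m x * ?V
          + (1/2) * ?e x"
        using elim(1) K B by (intro add_left_mono mult_right_mono) (auto simp: field_simps)
      finally show ?case by simp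
    qed
    have "((\<lambda>x. 2 * (K * ?r x + K * B * ?m x * ?V)) \<longlongrightarrow>
       2 * (K * norm (r p - r p) + K * B * norm (M p - M p) * ?V)) (at p)"
      by (intro tendsto_intros cM cr)
    then show "((\<lambda>x. 2 * (K * ?r x + K * B * ?m x * ?V)) \<longlongrightarrow> 0) (at p)"
      by simp
  qed
  \<comment> \<open>As \<open>M x - M p\<close> vanishes at \<open>p\<close>, continuity of
    \<open>v\<close> is enough to differentiate its product with \<open>v\<close>.\<close>
  have "((\<lambda>x. M x - M p) has_derivative (\<lambda>h. dd h M p)) (at p)"
    using has_derivative_diff[OF has_derivative_dd[OF M] has_derivative_const] by simp
  from has_derivative_bilinear_vanishing[OF bil this _ cv]
  have "((\<lambda>x. \<beta> (M x - M p) (v x)) has_derivative (\<lambda>h. \<beta> (dd h M p) (v p))) (at p)" by simp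
  from has_derivative_diff[OF bounded_linear.has_derivative[OF bT has_derivative_dd[OF r]]
      bounded_linear.has_derivative[OF bT this]]
  have "(v has_derivative (\<lambda>h. T (dd h r p) - T (\<beta> (dd h M p) (v p)))) (at p)"
    by (rule has_derivative_transform_within_open[OF _ assms(2,3)]) (use vx in simp)
  then show dv: "v differentiable (at p)" by (auto simp: differentiable_def)
  have "dd h r p = dd h (\<lambda>x. \<beta> (M x) (v x)) p"
    by (rule dd_cong[OF assms(2,3)]) (simp add: eq)
  then show "\<beta> (M p) (dd h v p) = dd h r p - \<beta> (dd h M p) (v p)"
    by (simp add: dd_bilinear[OF bil M dv])
qed

lemma Dk_diff:
  assumes "open D" "Dk n f D" "Dk n g D"
  shows "Dk n (\<lambda>x. f x - g x) D"
  using Dk_add[OF assms(1,2) Dk_linear[OF assms(1) bounded_linear_minus[OF bounded_linear_ident] assms(3)]]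
  by simp

text \<open>The derivative of \<open>v\<close> solves the same equation with right-hand side
  \<open>dd h r - \<beta> (dd h M) v\<close>, so the induction keeps \<open>M\<close> fixed and lets
  \<open>r\<close> and \<open>v\<close> vary.\<close>

lemma Dk_solve:
  fixes \<beta> :: "'m::real_normed_vector \<Rightarrow> 'v::euclidean_space \<Rightarrow> 'v"
    and M :: "'a::real_normed_vector \<Rightarrow> 'm"
  assumes bil: "bounded_bilinear \<beta>" and "open D"
    and "Dk n M D" "Dk n r D"
    and "\<And>x. x \<in> D \<Longrightarrow> \<beta> (M x) (v x) = r x"
    and inj: "\<And>x w. x \<in> D \<Longrightarrow> \<beta> (M x) w = 0 \<Longrightarrow> w = 0"
  shows "Dk n v D"
  using assms(3-5)
proof (induction n arbitrary: r v)
  case (Suc n)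
  have M: "M differentiable (at x)" and r: "r differentiable (at x)" if "x \<in> D" for x
    using Suc.prems that by auto
  note sol = differentiable_solve[OF bil assms(2) _ M r Suc.prems(3) inj]
  have v: "Dk n v D" by (rule Suc.IH[of r v, OF Dk_SucD Dk_SucD]) (use Suc.prems in \<open>auto simp del: Dk.simps\<close>)
  have "Dk n (dd h v) D" for h
  proof (rule Suc.IH)
    show "Dk n M D" using Suc.prems(1) by (rule Dk_SucD)
    show "Dk n (\<lambda>x. dd h r x - \<beta> (dd h M x) (v x)) D"
      by (rule Dk_diff[OF assms(2) _ Dk_bilinear[OF assms(2) bil _ v]])
        (use Suc.prems(1,2) in simp_all)
  qed (rule sol(2))
  moreover have "\<forall>p\<in>D. v differentiable (at p)" by (intro ballI) (rule sol(1))
  ultimately show ?case by simp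
qed simp

text \<open>The reciprocal solves \<open>f * v = 1\<close>.\<close>

lemma Dk_inverse:
  fixes f :: "'a::real_normed_vector \<Rightarrow> real"
  assumes "open D" "Dk n f D" "\<And>x. x \<in> D \<Longrightarrow> f x \<noteq> 0"
  shows "Dk n (\<lambda>x. inverse (f x)) D"
  by (rule Dk_solve[OF bounded_bilinear_mult assms(1,2) Dk_const[of _ 1]]) (use assms(3) in auto)

lemma dd_ln:
  fixes f :: "'a::real_normed_vector \<Rightarrow> real"
  assumes "f differentiable (at p)" "f p > 0"
  shows "dd v (\<lambda>x. ln (f x)) p = dd v f p * inverse (f p)"
  by (rule dd_eqI) (rule has_derivative_ln[OF assms(2) has_derivative_dd[OF assms(1)]])

lemma Dk_ln:
  fixes f :: "'a::real_normed_vector \<Rightarrow> real"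
  assumes "open D" "Dk n f D" "\<And>x. x \<in> D \<Longrightarrow> f x > 0"
  shows "Dk n (\<lambda>x. ln (f x)) D"
proof (cases n)
  case (Suc m)
  have d: "f differentiable (at p)" if "p \<in> D" for p using assms(2) Suc that by auto
  have "Dk m (dd v (\<lambda>x. ln (f x))) D" for v
  proof (rule Dk_cong[OF assms(1), where f = "\<lambda>p. dd v f p * inverse (f p)"])
    have "Dk m (\<lambda>x. inverse (f x)) D"
      using Dk_inverse[OF assms(1) Dk_SucD] assms Suc by fastforce
    then show "Dk m (\<lambda>p. dd v f p * inverse (f p)) D"
      by (intro Dk_bilinear[OF assms(1) bounded_bilinear_mult]) (use assms Suc in auto)
  qed (simp add: dd_ln d assms)
  moreover have "(\<lambda>x. ln (f x)) differentiable (at p)" if "p \<in> D" for p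
    using has_derivative_ln[OF assms(3)[OF that] has_derivative_dd[OF d[OF that]]]
    by (auto simp: differentiable_def)
  ultimately show ?thesis using Suc by simp
qed simp

section \<open>From continuous directional derivatives to Frechet derivatives\<close>

lemma line_has_vector_derivative_dd:
  assumes "(\<lambda>t::real. f ((u + s *\<^sub>R v) + t *\<^sub>R v)) differentiable (at 0)"
  shows "((\<lambda>t. f (u + t *\<^sub>R v)) has_vector_derivative dd v f (u + s *\<^sub>R v)) (at s)"
proof -
  have "((\<lambda>t::real. f ((u + s *\<^sub>R v) + t *\<^sub>R v)) has_vector_derivative dd v f (u + s *\<^sub>R v)) (at (0 + (s - s)))"
    unfolding dd_def using assms by (simp add: vector_derivative_works)
  moreover have "((\<lambda>t. t - s) has_vector_derivative 1) (at s)"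
    by (auto intro!: derivative_eq_intros)
  ultimately have "((\<lambda>t::real. f ((u + s *\<^sub>R v) + t *\<^sub>R v)) \<circ> (\<lambda>t. t - s) has_vector_derivative 1 *\<^sub>R dd v f (u + s *\<^sub>R v)) (at s)"
    by (intro vector_diff_chain_at) auto
  then show ?thesis by (simp add: o_def algebra_simps)
qed

text \<open>Walk from \<open>p\<close> to \<open>p + h\<close> one coordinate at a time. The target
  is a normed space, so each leg uses the mean value inequality instead of an intermediate
  point.\<close>

lemma differentiable_of_continuous_dd:
  fixes f :: "'a::euclidean_space \<Rightarrow> 'b::real_normed_vector"
  assumes W: "open W" "p \<in> W"
    and cont: "\<And>v. continuous_on W (dd v f)"
    and line: "\<And>v u. u \<in> W \<Longrightarrow> (\<lambda>t::real. f (u + t *\<^sub>R v)) differentiable (at 0)"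
  shows "f differentiable (at p)"
proof -
  define f' where "f' h = (\<Sum>i\<in>Basis. (h \<bullet> i) *\<^sub>R dd i f p)" for h
  have "(f has_derivative f') (at p)"
    unfolding has_derivative_at_alt
  proof (intro conjI allI impI)
    show "bounded_linear f'" unfolding f'_def
      by (intro bounded_linear_sum bounded_linear_scaleR_left[THEN bounded_linear_compose]
          bounded_linear_inner_left)
    fix e :: real assume "e > 0"
    \<comment> \<open>One share of \<open>e\<close> for each of the \<open>DIM('a)\<close>
      legs.\<close>
    define e' where "e' = e / DIM('a)"
    have e': "e' > 0" using \<open>e > 0\<close> by (simp add: e'_def)
    have "\<forall>i\<in>Basis. eventually (\<lambda>u. dist (dd i f u) (dd i f p) < e') (nhds p)"
    proof
      fix i :: 'a
      have "isCont (dd i f) p" using cont W continuous_on_eq_continuous_at by blast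
      then show "eventually (\<lambda>u. dist (dd i f u) (dd i f p) < e') (nhds p)"
        using e' unfolding isCont_def
        by (metis tendsto_at_iff_tendsto_nhds tendstoD)
    qed
    then have "eventually (\<lambda>u. (\<forall>i\<in>Basis. dist (dd i f u) (dd i f p) < e') \<and> u \<in> W) (nhds p)"
      using W by (intro eventually_conj eventually_ball_finite) (auto simp: eventually_nhds)
    then obtain d where d: "d > 0" "\<And>u. dist u p < d \<Longrightarrow> (\<forall>i\<in>Basis. dist (dd i f u) (dd i f p) < e') \<and> u \<in> W"
      unfolding eventually_nhds_metric by blast
    have key: "norm (f (p + (\<Sum>i\<in>S. (h \<bullet> i) *\<^sub>R i)) - f p - (\<Sum>i\<in>S. (h \<bullet> i) *\<^sub>R dd i f p)) \<le> card S * (e' * norm h)"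
      if "finite S" "S \<subseteq> Basis" "norm h < d" for S h
      using that(1,2)
    proof (induction S)
      case (insert j S)
      define w where "w = p + (\<Sum>i\<in>S. (h \<bullet> i) *\<^sub>R i)"
      define c where "c = h \<bullet> j"
      \<comment> \<open>The leg in direction \<open>j\<close> over the unit interval, minus its
        linear part at \<open>p\<close>; the derivative of \<open>g\<close> is \<open>c\<close>
        times the small difference \<open>?d\<close>.\<close>
      define g where "g t = f (w + (t * c) *\<^sub>R j) - (t * c) *\<^sub>R dd j f p" for t :: real
      let ?d = "\<lambda>s. dd j f (w + (s * c) *\<^sub>R j) - dd j f p"
      have fin: "finite S" using insert by simp
      have inW: "dist (w + (t * c) *\<^sub>R j) p < d" if "t \<in> {0..1}" for t :: real
      proof -
        \<comment> \<open>Each coordinate of this vector is at most that of \<open>h\<close> in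
          absolute value, so the walk never leaves the ball.\<close>
        have "norm ((\<Sum>i\<in>S. (h \<bullet> i) *\<^sub>R i) + (t * c) *\<^sub>R j) \<le> norm h"
        proof (rule norm_le_componentwise)
          fix b :: 'a assume b: "b \<in> Basis"
          have "(\<Sum>i\<in>S. (h \<bullet> i) *\<^sub>R i) \<bullet> b = (\<Sum>i\<in>S. if i = b then h \<bullet> b else 0)"
            unfolding inner_sum_left using insert.prems b by (intro sum.cong) (auto simp: inner_Basis)
          then have s: "(\<Sum>i\<in>S. (h \<bullet> i) *\<^sub>R i) \<bullet> b = (if b \<in> S then h \<bullet> b else 0)"
            using fin by (simp add: sum.delta)
          have "\<bar>t * c\<bar> \<le> \<bar>c\<bar>" using that by (simp add: abs_mult mult_left_le_one_le)
          then show "\<bar>((\<Sum>i\<in>S. (h \<bullet> i) *\<^sub>R i) + (t * c) *\<^sub>R j) \<bullet> b\<bar> \<le> \<bar>h \<bullet> b\<bar>"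
            using insert.hyps insert.prems b by (auto simp: inner_add_left s inner_Basis c_def)
        qed
        with \<open>norm h < d\<close> show ?thesis by (simp add: dist_norm w_def)
      qed
      have der: "(g has_derivative (\<lambda>t. t *\<^sub>R (c *\<^sub>R ?d s))) (at s within {0..1})" if s: "s \<in> {0..1}" for s
      proof -
        have "((\<lambda>t. f (w + t *\<^sub>R j)) has_vector_derivative dd j f (w + (s * c) *\<^sub>R j)) (at (s * c))"
          by (rule line_has_vector_derivative_dd, rule line) (use inW[OF s] d(2) in blast)
        moreover have "((\<lambda>t. t * c) has_vector_derivative c) (at s)"
          by (auto intro!: derivative_eq_intros)
        ultimately have "((\<lambda>t. f (w + t *\<^sub>R j)) \<circ> (\<lambda>t. t * c) has_vector_derivative c *\<^sub>R dd j f (w + (s * c) *\<^sub>R j)) (at s)"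
          by (intro vector_diff_chain_at) auto
        then have "(g has_vector_derivative c *\<^sub>R dd j f (w + (s * c) *\<^sub>R j) - c *\<^sub>R dd j f p) (at s)"
          unfolding g_def o_def by (auto intro!: derivative_eq_intros)
        then show ?thesis
          by (auto simp: has_vector_derivative_def scaleR_diff_right intro: has_derivative_at_withinI)
      qed
      have "norm (g 1 - g 0) \<le> (norm h * e') * norm ((1::real) - 0)"
      proof (rule differentiable_bound[OF convex_real_interval(5)[of 0 1] der])
        fix s :: real assume s: "s \<in> {0..1}"
        have "norm (?d s) \<le> e'"
          using d(2)[OF inW[OF s]] insert.prems by (auto simp: dist_norm intro: less_imp_le)
        moreover have "\<bar>c\<bar> \<le> norm h" using insert.prems by (simp add: Basis_le_norm c_def)
        ultimately have le: "\<bar>c\<bar> * norm (?d s) \<le> norm h * e'" by (intro mult_mono) auto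
        show "onorm (\<lambda>t. t *\<^sub>R (c *\<^sub>R ?d s)) \<le> norm h * e'"
          by (rule onorm_le)
            (use mult_left_mono[OF le abs_ge_zero] in \<open>simp add: abs_mult mult.assoc mult.commute mult.left_commute\<close>)
      qed auto
      moreover have "f (p + (\<Sum>i\<in>insert j S. (h \<bullet> i) *\<^sub>R i)) - f p - (\<Sum>i\<in>insert j S. (h \<bullet> i) *\<^sub>R dd i f p)
        = (g 1 - g 0) + (f (p + (\<Sum>i\<in>S. (h \<bullet> i) *\<^sub>R i)) - f p - (\<Sum>i\<in>S. (h \<bullet> i) *\<^sub>R dd i f p))"
        using insert.hyps by (simp add: g_def w_def c_def algebra_simps)
      ultimately have "norm (f (p + (\<Sum>i\<in>insert j S. (h \<bullet> i) *\<^sub>R i)) - f p - (\<Sum>i\<in>insert j S. (h \<bullet> i) *\<^sub>R dd i f p))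
        \<le> norm h * e' + card S * (e' * norm h)"
        using insert.IH insert.prems by (metis (no_types, lifting) add_mono insert_subset norm_triangle_le diff_zero mult.right_neutral norm_one)
      then show ?case using insert.hyps by (simp add: algebra_simps)
    qed simp
    show "\<exists>d>0. \<forall>y. norm (y - p) < d \<longrightarrow> norm (f y - f p - f' (y - p)) \<le> e * norm (y - p)"
    proof (intro exI[of _ d] conjI allI impI d)
      fix y assume "norm (y - p) < d"
      from key[OF finite_Basis order_refl this]
      show "norm (f y - f p - f' (y - p)) \<le> e * norm (y - p)"
        by (simp add: euclidean_representation f'_def e'_def)
    qed
  qed
  then show ?thesis by (auto simp: differentiable_def)
qed

text \<open>Each \<open>iterdd vs f\<close> satisfies the hypotheses of
  \<open>differentiable_of_continuous_dd\<close>, so the induction on the order treats all lists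
  \<open>vs\<close> at once.\<close>

lemma smooth_on_imp_smooth:
  fixes f :: "'a::euclidean_space \<Rightarrow> 'b::real_normed_vector"
  assumes "smooth_on W f"
  shows "smooth f W"
proof -
  have "Dk n (iterdd vs f) W" for n vs
  proof (induction n arbitrary: vs)
    case (Suc n)
    have "iterdd vs f differentiable (at p)" if "p \<in> W" for p
    proof (rule differentiable_of_continuous_dd[OF _ that])
      show "continuous_on W (dd v (iterdd vs f))" for v
        using assms iterdd.simps(2)[of v vs f] unfolding smooth_on_def by metis
    qed (use assms in \<open>auto simp: smooth_on_def\<close>)
    moreover have "Dk n (dd v (iterdd vs f)) W" for v using Suc[of "v # vs"] by simp
    ultimately show ?case by simp
  qed simp
  from this[of _ "[]"] show ?thesis by (simp add: smooth_def)
qed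

section \<open>Symmetry of second derivatives\<close>

lemma mixed_difference_quotient:
  fixes f :: "'a::real_normed_vector \<Rightarrow> real"
  assumes f: "smooth f D" and O: "open D" "p \<in> D"
  shows "((\<lambda>t. (f (p + t *\<^sub>R v + t *\<^sub>R w) - f (p + t *\<^sub>R v) - f (p + t *\<^sub>R w) + f p) / t\<^sup>2)
    \<longlongrightarrow> dd w (dd v f) p) (at_right (0::real))"
proof (rule tendstoI)
  fix e :: real assume "e > 0"
  let ?P = "\<lambda>a b. p + a *\<^sub>R v + b *\<^sub>R w" and ?g = "dd w (dd v f)"
  have "isCont ?g p" by (rule smooth_continuous[OF _ O(2)]) (intro smooth_dd f)
  then have "eventually (\<lambda>u. dist (?g u) (?g p) < e) (nhds p)"
    using \<open>e > 0\<close> unfolding isCont_def by (metis tendsto_at_iff_tendsto_nhds tendstoD)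
  then have "eventually (\<lambda>u. dist (?g u) (?g p) < e \<and> u \<in> D) (nhds p)"
    using O by (intro eventually_conj) (auto simp: eventually_nhds)
  then obtain d where d: "d > 0" "\<And>u. dist u p < d \<Longrightarrow> dist (?g u) (?g p) < e \<and> u \<in> D"
    unfolding eventually_nhds_metric by blast
  \<comment> \<open>With both parameters below \<open>d'\<close>, a point of the parallelogram has
    distance less than \<open>d\<close> from \<open>p\<close>; the summand 1 keeps the denominator
    positive.\<close>
  define d' where "d' = d / (norm v + norm w + 1)"
  have d': "d' > 0" using d(1) by (simp add: d'_def add_nonneg_pos)
  have near: "?P a b \<in> D" "dist (?g (?P a b)) (?g p) < e" if "0 \<le> a" "a < d'" "0 \<le> b" "b < d'" for a b
  proof -
    have "dist (?P a b) p \<le> a * norm v + b * norm w"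
      using norm_triangle_ineq[of "a *\<^sub>R v" "b *\<^sub>R w"] that by (simp add: dist_norm algebra_simps)
    also have "\<dots> \<le> d' * norm v + d' * norm w" using that by (intro add_mono mult_right_mono) auto
    also have "\<dots> < d' * (norm v + norm w + 1)" using d' by (simp add: algebra_simps)
    also have "\<dots> = d" by (simp add: d'_def) (smt (verit) norm_ge_zero)
    finally show "?P a b \<in> D" "dist (?g (?P a b)) (?g p) < e" using d(2) by blast+
  qed
  have line: "((\<lambda>t. g (u + t *\<^sub>R z)) has_real_derivative dd z g (u + s *\<^sub>R z)) (at s)"
    if "smooth g D" "u + s *\<^sub>R z \<in> D" for g :: "'a \<Rightarrow> real" and u z s
  proof -
    have "(\<lambda>t. g ((u + s *\<^sub>R z) + t *\<^sub>R z)) differentiable (at 0)"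
      using has_derivative_imp_line[OF has_derivative_dd[OF smooth_diff[OF that]]]
      by (auto simp: has_vector_derivative_def differentiable_def)
    from line_has_vector_derivative_dd[OF this] show ?thesis
      by (simp add: has_real_derivative_iff_has_vector_derivative)
  qed
  show "eventually (\<lambda>t. dist ((f (?P t t) - f (p + t *\<^sub>R v) - f (p + t *\<^sub>R w) + f p) / t\<^sup>2) (?g p) < e)
      (at_right (0::real))"
    unfolding eventually_at_right_field
  proof (intro exI[of _ d'] conjI d' allI impI)
    fix t :: real assume t: "0 < t" "t < d'"
    \<comment> \<open>\<open>k t - k 0\<close> is the second difference. The mean value theorem is
      applied to it in direction \<open>v\<close>, then to the resulting difference of derivatives
      in direction \<open>w\<close>.\<close>
    define k where "k s = f ((p + t *\<^sub>R w) + s *\<^sub>R v) - f (p + s *\<^sub>R v)" for s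
    have "\<exists>\<xi>>0. \<xi> < t \<and> k t - k 0 = (t - 0) * (dd v f ((p + t *\<^sub>R w) + \<xi> *\<^sub>R v) - dd v f (p + \<xi> *\<^sub>R v))"
    proof (rule MVT2)
      fix s assume s: "0 \<le> s" "s \<le> t"
      show "(k has_real_derivative dd v f ((p + t *\<^sub>R w) + s *\<^sub>R v) - dd v f (p + s *\<^sub>R v)) (at s)"
        unfolding k_def
        by (intro DERIV_diff line f) (use near(1)[of s t] near(1)[of s 0] s t d' in \<open>auto simp: algebra_simps\<close>)
    qed (use t in simp)
    then obtain \<xi> where \<xi>: "0 < \<xi>" "\<xi> < t" "k t - k 0 = t * (dd v f (?P \<xi> t) - dd v f (?P \<xi> 0))"
      by (auto simp: algebra_simps)
    have "\<exists>\<eta>>0. \<eta> < t \<and> dd v f (?P \<xi> t) - dd v f (?P \<xi> 0) = (t - 0) * ?g (?P \<xi> \<eta>)"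
    proof (rule MVT2)
      fix s assume s: "0 \<le> s" "s \<le> t"
      show "((\<lambda>s. dd v f (?P \<xi> s)) has_real_derivative ?g (?P \<xi> s)) (at s)"
        by (intro line smooth_dd f near) (use \<xi> s t in auto)
    qed (use t in simp)
    then obtain \<eta> where \<eta>: "0 < \<eta>" "\<eta> < t" "dd v f (?P \<xi> t) - dd v f (?P \<xi> 0) = t * ?g (?P \<xi> \<eta>)"
      by auto
    have "f (?P t t) - f (p + t *\<^sub>R v) - f (p + t *\<^sub>R w) + f p = k t - k 0"
      by (simp add: k_def algebra_simps)
    also have "\<dots> / t\<^sup>2 = ?g (?P \<xi> \<eta>)" unfolding \<xi>(3) \<eta>(3) using t by (simp add: power2_eq_square)
    finally show "dist ((f (?P t t) - f (p + t *\<^sub>R v) - f (p + t *\<^sub>R w) + f p) / t\<^sup>2) (?g p) < e"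
      using near(2)[of \<xi> \<eta>] \<xi> \<eta> t by simp
  qed
qed

text \<open>The second difference is symmetric in \<open>v\<close> and \<open>w\<close>, while its
  limit can be computed in either order.\<close>

lemma dd_commute:
  fixes f :: "'a::real_normed_vector \<Rightarrow> real"
  assumes f: "smooth f D" and O: "open D" "p \<in> D"
  shows "dd v (dd w f) p = dd w (dd v f) p"
proof (rule tendsto_unique[OF trivial_limit_at_right_real mixed_difference_quotient[OF assms]])
  show "((\<lambda>t. (f (p + t *\<^sub>R w + t *\<^sub>R v) - f (p + t *\<^sub>R w) - f (p + t *\<^sub>R v) + f p) / t\<^sup>2)
    \<longlongrightarrow> dd w (dd v f) p) (at_right (0::real))"
    using mixed_difference_quotient[OF assms, of v w] by (simp add: algebra_simps)
qed

section \<open>Matrix algebra\<close>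

abbreviation tp :: "real^'m^'n \<Rightarrow> real^'n^'m" where "tp \<equiv> transpose"

lemma tp_add: "tp (A + B) = tp A + tp (B :: real^'m^'n)"
  and tp_diff: "tp (A - B) = tp A - tp (B :: real^'m^'n)"
  and tp_minus: "tp (- A) = - tp (A :: real^'m^'n)"
  and tp_scaleR: "tp (c *\<^sub>R A) = c *\<^sub>R tp (A :: real^'m^'n)"
  and tp_zero: "tp (0 :: real^'m^'n) = 0"
  by (simp_all add: transpose_def vec_eq_iff)

lemma linear_transpose: "bounded_linear (tp :: real^'m^'n \<Rightarrow> _)"
  unfolding linear_conv_bounded_linear[symmetric] by (intro linearI) (simp_all add: tp_add tp_scaleR)

interpretation mm: bounded_bilinear "(**) :: real^'m^'n \<Rightarrow> real^'k^'m \<Rightarrow> real^'k^'n"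
  unfolding bilinear_conv_bounded_bilinear[symmetric] bilinear_def
  by (auto intro!: linearI simp: matrix_matrix_mult_def vec_eq_iff sum.distrib sum_distrib_left
      algebra_simps)

lemmas bilinear_matmul = mm.bounded_bilinear_axioms
lemmas [simp] = tp_zero mm.zero_left mm.zero_right
lemmas matrix_linear = mm.minus_left mm.minus_right mm.diff_left mm.diff_right mm.add_left mm.add_right
  mm.scaleR_left mm.scaleR_right tp_add tp_diff tp_minus tp_scaleR

lemma inner_matrix_def: "(A :: real^'m^'n) \<bullet> B = (\<Sum>i\<in>UNIV. \<Sum>j\<in>UNIV. A$i$j * B$i$j)"
  by (simp add: inner_vec_def)

text \<open>The trace form is the Euclidean inner product, so traces are moved around by the adjoint
  rules \<open>inner_mm_left\<close> and \<open>inner_mm_right\<close>.\<close>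

lemma trace_transpose_mult: "trace (tp A ** B) = (A :: real^'m^'n) \<bullet> B"
  unfolding inner_matrix_def trace_def matrix_matrix_mult_def transpose_def
  by (simp) (rule sum.swap)

lemma inner_transpose: "tp (A :: real^'m^'n) \<bullet> tp B = A \<bullet> B"
  unfolding inner_matrix_def transpose_def by simp (rule sum.swap)

lemma trace_inner_mat1: "trace A = (A :: real^'n^'n) \<bullet> mat 1"
  using trace_transpose_mult[of "mat 1" A] by (simp add: inner_commute)

lemma inner_mm_left: "((A :: real^'m^'n) ** (X :: real^'k^'m)) \<bullet> B = X \<bullet> (tp A ** B)"
  by (simp add: trace_transpose_mult[symmetric] matrix_transpose_mul matrix_mul_assoc)

lemma inner_mm_right: "((X :: real^'m^'n) ** (A :: real^'k^'m)) \<bullet> B = X \<bullet> (B ** tp A)"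
proof -
  have "(X ** A) \<bullet> B = tp (X ** A) \<bullet> tp B" by (simp only: inner_transpose)
  also have "\<dots> = tp X \<bullet> tp (B ** tp A)"
    by (simp only: matrix_transpose_mul inner_mm_left transpose_transpose)
  finally show ?thesis by (simp only: inner_transpose)
qed

lemma bounded_linear_trace: "bounded_linear (trace :: real^'n^'n \<Rightarrow> real)"
  unfolding trace_inner_mat1[abs_def] by (rule bounded_linear_inner_left)

lemma transpose_mskew: "tp (mskew A) = - mskew A"
  by (simp add: mskew_def matrix_linear algebra_simps flip: scaleR_minus_right)

lemma mskew_add: "mskew (A + B) = mskew A + mskew B"
  and mskew_diff: "mskew (A - B) = mskew A - mskew B"
  and mskew_transpose: "mskew (tp A) = - mskew A"
  and mskew_scaleR: "mskew (c *\<^sub>R A) = c *\<^sub>R mskew A"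
  by (simp_all add: mskew_def matrix_linear algebra_simps)

lemma mskew_eq_0_iff: "mskew A = 0 \<longleftrightarrow> tp A = A"
  by (auto simp: mskew_def)

lemma mskew_inner_skew: "tp B = - B \<Longrightarrow> mskew A \<bullet> B = A \<bullet> B"
  using inner_transpose[of A B] by (simp add: mskew_def inner_diff_left)

lemma inner_skew_sym: "tp A = - A \<Longrightarrow> tp S = S \<Longrightarrow> A \<bullet> (S :: real^'n^'n) = 0"
  using inner_transpose[of A S] by simp

section \<open>Positive definite matrices\<close>

lemma posdef_sym: "sym_posdef S \<Longrightarrow> tp S = S"
  by (simp add: sym_posdef_def)

lemma inner_matrix_columns: "(D :: real^'k^'n) \<bullet> E = (\<Sum>j\<in>UNIV. column j D \<bullet> column j E)"
  unfolding inner_matrix_def by (simp add: inner_vec_def column_def) (rule sum.swap)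

lemma column_matrix_mult: "column j ((A :: real^'m^'n) ** B) = A *v column j B"
  by (simp add: column_def matrix_matrix_mult_def matrix_vector_mult_def vec_eq_iff)

lemma posdef_inner_pos:
  fixes D :: "real^'k^'n"
  assumes "sym_posdef S" "D \<noteq> 0"
  shows "D \<bullet> (S ** D) > 0"
proof -
  have nn: "0 \<le> column j D \<bullet> (S *v column j D)" for j
    using assms(1) by (cases "column j D = 0") (auto simp: sym_posdef_def less_imp_le)
  obtain j where "column j D \<noteq> 0" using assms(2) by (auto simp: column_def vec_eq_iff)
  then have "0 < column j D \<bullet> (S *v column j D)" using assms(1) by (simp add: sym_posdef_def)
  then show ?thesis unfolding inner_matrix_columns column_matrix_mult
    by (intro sum_pos2[of _ j]) (use nn in auto)
qed

lemma posdef_inner_pos_right: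
  assumes "sym_posdef S" "D \<noteq> 0"
  shows "D \<bullet> (D ** S) > 0"
  using posdef_inner_pos[OF assms(1), of "tp D"] assms(2)
    inner_transpose[of "tp D" "S ** tp D"]
  by (auto simp: matrix_transpose_mul posdef_sym[OF assms(1)])
     (metis tp_zero transpose_transpose)

lemma posdef_nonneg_right: "sym_posdef S \<Longrightarrow> D \<bullet> (D ** S) \<ge> 0"
  using less_imp_le[OF posdef_inner_pos_right[of S D]] by (cases "D = 0") auto

lemma posdef_trace_pos:
  assumes "sym_posdef (S :: real^'n^'n)"
  shows "trace S > 0"
proof -
  have "(mat 1 :: real^'n^'n) \<noteq> 0" by (auto simp: mat_def vec_eq_iff)
  from posdef_inner_pos[OF assms this] show ?thesis by (simp add: trace_inner_mat1 inner_commute)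
qed

text \<open>Pairing with \<open>X\<close> gives a positive plus a nonnegative term. Allowing two
  different matrices lets \<open>X = S - S'\<close> yield uniqueness of square roots as
  well.\<close>

lemma sylvester_injective:
  assumes "sym_posdef S" "sym_posdef S'" "S ** X + X ** S' = 0"
  shows "X = 0"
proof (rule ccontr)
  assume "X \<noteq> 0"
  then have "X \<bullet> (S ** X + X ** S') > 0"
    using posdef_inner_pos[OF assms(1) \<open>X \<noteq> 0\<close>] posdef_nonneg_right[OF assms(2), of X]
    by (simp add: inner_add_right)
  with assms(3) show False by simp
qed

lemma sym_posdef_unique_sqrt:
  assumes "sym_posdef S" "sym_posdef S'" "S ** S = S' ** S'"
  shows "S = S'"
proof -
  have "S ** (S - S') + (S - S') ** S' = 0"
    using assms(3) by (simp add: matrix_linear)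
  from sylvester_injective[OF assms(1,2) this] show ?thesis by simp
qed

lemma posdef_invertible:
  assumes "sym_posdef (S :: real^'n^'n)"
  shows "invertible S"
proof -
  have "x = 0" if "S *v x = 0" for x
    using assms that unfolding sym_posdef_def by (metis inner_zero_right less_irrefl)
  then show ?thesis using invertible_left_inverse matrix_left_invertible_ker by blast
qed

lemma matrix_inv_cancel:
  assumes "invertible (A :: real^'n^'n)"
  shows "A ** matrix_inv A = mat 1" "matrix_inv A ** A = mat 1"
proof -
  have "\<exists>A'. A ** A' = mat 1 \<and> A' ** A = mat 1" using assms by (simp add: invertible_def)
  from someI_ex[OF this] show "A ** matrix_inv A = mat 1" "matrix_inv A ** A = mat 1"
    by (simp_all add: matrix_inv_def)
qed

lemma bilinear_sylvester:
  "bounded_bilinear (\<lambda>(S :: real^'n^'n) X. S ** X + X ** S)"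
  unfolding bilinear_conv_bounded_bilinear[symmetric] bilinear_def
  by (auto intro!: linearI simp: matrix_linear algebra_simps)

lemma Linv_eqI:
  assumes "sym_posdef S" "S ** X + X ** S = A"
  shows "Linv S A = X"
  unfolding Linv_def
proof (rule the_equality[where P = "\<lambda>X. S ** X + X ** S = A", OF assms(2)])
  fix Y assume Y: "S ** Y + Y ** S = A"
  have "S ** (Y - X) + (Y - X) ** S = 0" using Y assms(2) by (simp add: matrix_linear algebra_simps)
  from sylvester_injective[OF assms(1) assms(1) this] show "Y = X" by simp
qed

text \<open>Injectivity gives surjectivity in finite dimension.\<close>

lemma Linv_solves:
  assumes "sym_posdef (S :: real^'n^'n)"
  shows "S ** Linv S A + Linv S A ** S = A"
proof -
  let ?L = "\<lambda>X. S ** X + X ** S"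
  have lin: "linear ?L" by (rule linearI) (simp_all add: matrix_linear algebra_simps)
  have "inj ?L" using sylvester_injective[OF assms assms] linear_injective_0[OF lin] by blast
  then have "surj ?L" using linear_injective_imp_surjective[OF lin] by blast
  from surjD[OF this, of A] obtain X where "?L X = A" by auto
  with Linv_eqI[OF assms this] show ?thesis by simp
qed

lemma Linv_iff: "sym_posdef S \<Longrightarrow> Linv S A = X \<longleftrightarrow> S ** X + X ** S = A"
  using Linv_eqI Linv_solves by blast

lemma Linv_add: "sym_posdef S \<Longrightarrow> Linv S (A + B) = Linv S A + Linv S B"
proof (rule Linv_eqI)
  assume S: "sym_posdef S"
  have "S ** (Linv S A + Linv S B) + (Linv S A + Linv S B) ** S
    = (S ** Linv S A + Linv S A ** S) + (S ** Linv S B + Linv S B ** S)"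
    by (simp add: mm.add_left mm.add_right)
  then show "S ** (Linv S A + Linv S B) + (Linv S A + Linv S B) ** S = A + B"
    by (simp only: Linv_solves[OF S])
qed

lemma Linv_scaleR: "sym_posdef S \<Longrightarrow> Linv S (c *\<^sub>R A) = c *\<^sub>R Linv S A"
  by (rule Linv_eqI)
    (simp_all only: mm.scaleR_left mm.scaleR_right Linv_solves flip: scaleR_add_right)

lemma Linv_minus: "sym_posdef S \<Longrightarrow> Linv S (- A) = - Linv S A"
  using Linv_scaleR[of S "-1" A] by simp

lemma Linv_zero [simp]: "sym_posdef S \<Longrightarrow> Linv S 0 = 0"
  by (rule Linv_eqI) simp_all

lemma transpose_Linv: "sym_posdef S \<Longrightarrow> tp (Linv S A) = Linv S (tp A)"
  by (rule Linv_eqI[symmetric])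
    (use arg_cong[OF Linv_solves[of S A], of tp] posdef_sym[of S] in
      \<open>auto simp: tp_add matrix_transpose_mul add.commute\<close>)

lemma Linv_mskew_skew: "sym_posdef S \<Longrightarrow> tp (Linv S (mskew A)) = - Linv S (mskew A)"
  by (simp add: transpose_Linv transpose_mskew Linv_minus)

text \<open>The Sylvester operator of a symmetric \<open>S\<close> is self-adjoint, hence so is its
  inverse.\<close>

lemma Linv_adjoint:
  assumes "sym_posdef S"
  shows "Linv S A \<bullet> B = A \<bullet> Linv S B"
proof -
  have T: "tp S = S" using assms by (rule posdef_sym)
  have "Linv S A \<bullet> B = Linv S A \<bullet> (S ** Linv S B + Linv S B ** S)" by (simp add: Linv_solves assms)
  also have "\<dots> = (S ** Linv S A + Linv S A ** S) \<bullet> Linv S B"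
    unfolding inner_add_right inner_add_left inner_mm_left[of S] inner_mm_right[of _ S] T
    by (simp add: inner_commute[of "Linv S A"] add.commute) 
  finally show ?thesis by (simp add: Linv_solves assms)
qed

section \<open>Polar decomposition\<close>

definition outer :: "real^'n \<Rightarrow> real^'n \<Rightarrow> real^'n^'n" where
  "outer a b = (\<chi> i j. a$i * b$j)"

lemma outer_mult: "outer a b ** outer c d = (b \<bullet> c) *\<^sub>R outer a d"
  by (simp add: outer_def matrix_matrix_mult_def vec_eq_iff inner_vec_def sum_distrib_left
      sum_distrib_right mult_ac)

lemma inner_outer: "N \<bullet> outer a b = a \<bullet> (N *v b)"
  by (simp add: inner_matrix_def outer_def inner_vec_def matrix_vector_mult_def sum_distrib_left mult_ac)

lemma transpose_outer: "tp (outer a b) = outer b a"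
  by (simp add: outer_def transpose_def mult.commute)

text \<open>The reflection in the hyperplane orthogonal to \<open>v\<close>. Single reflections and
  products of two are the competitors in the maximisation that produces the polar
  decomposition.\<close>

definition householder :: "real^'n \<Rightarrow> real^'n^'n" where
  "householder v = mat 1 - (2 / (v \<bullet> v)) *\<^sub>R outer v v"

lemma orthogonal_householder: "v \<noteq> 0 \<Longrightarrow> orthogonal_matrix (householder v)"
  by (simp add: orthogonal_matrix householder_def matrix_linear outer_mult transpose_outer algebra_simps
      flip: scaleR_add_left)

lemma orthogonal_mult: "orthogonal_matrix A \<Longrightarrow> orthogonal_matrix B \<Longrightarrow> orthogonal_matrix (A ** B :: real^'n^'n)"
  by (metis orthogonal_matrix_mul)

lemma linear_le_quadratic_imp_zero:
  assumes "\<And>t::real. t * a \<le> t\<^sup>2 * c"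
  shows "a = 0"
proof (rule ccontr)
  assume a: "a \<noteq> 0"
  define C where "C = \<bar>c\<bar> + 1"
  have C: "C > 0" "c < C" by (auto simp: C_def)
  have "(a / C) * a \<le> (a / C)\<^sup>2 * c" by (rule assms)
  then have "a\<^sup>2 * C \<le> a\<^sup>2 * c" using C by (simp add: power2_eq_square field_simps)
  then show False using a C by (simp add: mult_le_cancel_left)
qed

lemma compact_orthogonal: "compact {U :: real^'n^'n. orthogonal_matrix U}"
  unfolding compact_eq_bounded_closed
proof
  have "norm U = sqrt (real CARD('n))" if "orthogonal_matrix U" for U :: "real^'n^'n"
  proof -
    have "U \<bullet> U = trace (mat 1 :: real^'n^'n)"
      using that by (simp add: trace_transpose_mult[symmetric] orthogonal_matrix)
    then show ?thesis by (simp add: norm_eq_sqrt_inner trace_I)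
  qed
  then show "bounded {U :: real^'n^'n. orthogonal_matrix U}"
    by (auto simp: bounded_iff intro: exI[of _ "sqrt (real CARD('n))"])
  have "continuous_on UNIV (\<lambda>U :: real^'n^'n. tp U ** U)"
    by (intro bounded_bilinear.continuous_on[OF bilinear_matmul] continuous_on_id
      bounded_linear.continuous_on[OF linear_transpose])
  then have "closed ((\<lambda>U :: real^'n^'n. tp U ** U) -` {mat 1})"
    by (intro closed_vimage) auto
  moreover have "(\<lambda>U :: real^'n^'n. tp U ** U) -` {mat 1} = {U. orthogonal_matrix U}"
    by (auto simp: orthogonal_matrix)
  ultimately show "closed {U :: real^'n^'n. orthogonal_matrix U}" by simp
qed

text \<open>Replacing the identity by a reflection lowers the pairing by a positive multiple of
  \<open>v . N v\<close>, which gives semidefiniteness. Symmetry is the first-order condition along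
  rotations of coordinate planes, written as products of two reflections so that everything is
  rational in \<open>t\<close>.\<close>

lemma symmetric_psd_of_orthogonal_max:
  fixes N :: "real^'n^'n"
  assumes max: "\<And>W. orthogonal_matrix W \<Longrightarrow> N \<bullet> W \<le> N \<bullet> mat 1"
  shows "tp N = N" "v \<bullet> (N *v v) \<ge> 0"
proof -
  let ?n = "\<lambda>u v. u \<bullet> (N *v v)"
  have "N$i$j = N$j$i" for i j
  proof (cases "i = j")
    case False
    let ?a = "axis i 1 :: real^'n" and ?b = "axis j 1 :: real^'n"
    have ab: "?a \<bullet> ?a = 1" "?b \<bullet> ?b = 1" "?a \<bullet> ?b = 0" "?b \<bullet> ?a = 0"
      using False by (auto simp: inner_axis_axis)
    have "t * (?n ?a ?b - ?n ?b ?a) \<le> t\<^sup>2 * (?n ?a ?a + ?n ?b ?b)" for t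
    proof -
      \<comment> \<open>The product of the reflections along \<open>?a\<close> and \<open>?v\<close>
        is a rotation in the plane of \<open>?a\<close> and \<open>?b\<close>, and the identity for
        \<open>t = 0\<close>.\<close>
      let ?v = "?a + t *\<^sub>R ?b"
      have vv: "?v \<bullet> ?v = 1 + t\<^sup>2" and av: "?a \<bullet> ?v = 1"
        by (simp_all add: inner_add_left inner_add_right ab power2_eq_square)
      have s: "1 + t\<^sup>2 > 0" by (simp add: add_pos_nonneg)
      have "?v \<noteq> 0" using vv s by (metis inner_zero_left less_irrefl)
      moreover have "?a \<noteq> 0" by simp
      ultimately have "N \<bullet> (householder ?a ** householder ?v) \<le> N \<bullet> mat 1"
        by (intro max orthogonal_mult orthogonal_householder)
      moreover have "householder ?a ** householder ?v = mat 1 - 2 *\<^sub>R outer ?a ?a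
          - (2 / (1 + t\<^sup>2)) *\<^sub>R outer ?v ?v + (4 / (1 + t\<^sup>2)) *\<^sub>R outer ?a ?v"
        unfolding householder_def vv ab av
        by (simp add: matrix_linear outer_mult vv av ab(1) scaleR_diff_right)
      ultimately have "- 2 * (?n ?a ?a) - 2 / (1 + t\<^sup>2) * (?n ?v ?v)
        + 4 / (1 + t\<^sup>2) * (?n ?a ?v) \<le> 0"
        by (simp add: inner_diff_right inner_add_right inner_outer)
      note le = this
      have sc: "s * (- 2 * A - 2 / s * B + 4 / s * C) = - 2 * s * A - 2 * B + 4 * C"
        if "s > 0" for s A B C :: real using that by (simp add: field_simps)
      from le have "(1 + t\<^sup>2) * (- 2 * (?n ?a ?a) - 2 / (1 + t\<^sup>2) * (?n ?v ?v)
        + 4 / (1 + t\<^sup>2) * (?n ?a ?v)) \<le> 0"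
        using s by (simp add: mult_le_0_iff)
      then have "- 2 * (1 + t\<^sup>2) * (?n ?a ?a) - 2 * (?n ?v ?v) + 4 * (?n ?a ?v) \<le> 0"
        unfolding sc[OF s] .
      then show ?thesis
        by (simp add: matrix_vector_right_distrib matrix_vector_mult_scaleR inner_add_left
            inner_add_right power2_eq_square algebra_simps)
    qed
    from linear_le_quadratic_imp_zero[OF this]
    have "?n ?a ?b = ?n ?b ?a" by simp
    then show ?thesis
      by (simp add: matrix_vector_mult_basis inner_axis' column_def)
  qed simp
  then show "tp N = N" by (simp add: transpose_def vec_eq_iff)
  show "?n v v \<ge> 0"
  proof (cases "v = 0")
    case False
    then have "N \<bullet> householder v \<le> N \<bullet> mat 1" by (intro max orthogonal_householder)
    then have "0 \<le> 2 / (v \<bullet> v) * (?n v v)"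
      by (simp add: householder_def inner_diff_right inner_outer)
    moreover have "v \<bullet> v > 0" using False by simp
    ultimately show ?thesis by (simp add: zero_le_mult_iff zero_le_divide_iff)
  qed simp
qed

text \<open>If \<open>v . N v = 0\<close>, nonnegativity at \<open>v + t (N v)\<close> for all
  \<open>t\<close> forces the linear coefficient, a multiple of \<open>|N v|^2\<close>, to
  vanish.\<close>

lemma psd_invertible_imp_posdef:
  fixes N :: "real^'n^'n"
  assumes "tp N = N" "\<And>v. v \<bullet> (N *v v) \<ge> 0" "invertible N"
  shows "sym_posdef N"
  unfolding sym_posdef_def
proof (intro conjI allI impI assms(1))
  fix v :: "real^'n" assume v: "v \<noteq> 0"
  show "v \<bullet> (N *v v) > 0"
  proof (rule ccontr)
    assume "\<not> ?thesis"
    then have z: "v \<bullet> (N *v v) = 0" using assms(2)[of v] by linarith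
    define w where "w = N *v v"
    have sw: "v \<bullet> (N *v w) = w \<bullet> w" using assms(1)
      by (metis dot_lmul_matrix transpose_matrix_vector w_def)
    have "t * (- 2 * (w \<bullet> w)) \<le> t\<^sup>2 * (w \<bullet> (N *v w))" for t
      using assms(2)[of "v + t *\<^sub>R w"] z sw
      by (simp add: matrix_vector_right_distrib matrix_vector_mult_scaleR inner_add_left
            inner_add_right power2_eq_square algebra_simps flip: w_def)
    from linear_le_quadratic_imp_zero[OF this] have "N *v v = 0" by (simp add: w_def)
    then show False using v assms(3) invertible_left_inverse matrix_left_invertible_ker by blast
  qed
qed

text \<open>Let \<open>U\<close> maximise the pairing with \<open>M\<close> over the compact
  orthogonal group. Then the identity maximises the pairing with \<open>M U^T\<close>, which is
  therefore symmetric and positive semidefinite.\<close>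

lemma polar_decomposition_exists:
  fixes M :: "real^'n^'n"
  assumes "invertible M"
  obtains S U where "sym_posdef S" "orthogonal_matrix U" "M = S ** U"
proof -
  have "continuous_on {U. orthogonal_matrix U} (\<lambda>U. M \<bullet> U)" by (intro continuous_intros)
  moreover have "{U :: real^'n^'n. orthogonal_matrix U} \<noteq> {}" using orthogonal_matrix_id by blast
  ultimately obtain U where U: "orthogonal_matrix U" "\<And>V. orthogonal_matrix V \<Longrightarrow> M \<bullet> V \<le> M \<bullet> U"
    using continuous_attains_sup[OF compact_orthogonal] by (metis mem_Collect_eq)
  define N where "N = M ** tp U"
  have NW: "N \<bullet> W = M \<bullet> (W ** U)" for W by (simp add: N_def inner_mm_right)
  have max: "N \<bullet> W \<le> N \<bullet> mat 1" if "orthogonal_matrix W" for W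
    using U(2)[OF orthogonal_mult[OF that U(1)]] by (simp add: NW)
  have "invertible (tp U)" using U(1) by (auto simp: orthogonal_matrix_def invertible_def)
  then have "invertible N" using assms by (simp add: N_def invertible_mult)
  then have "sym_posdef N"
    using psd_invertible_imp_posdef symmetric_psd_of_orthogonal_max[OF max] by blast
  moreover have "M = N ** U"
    using U(1) by (simp add: N_def matrix_mul_assoc[symmetric] orthogonal_matrix)
  ultimately show ?thesis using that U(1) by blast
qed

lemma polar_unique:
  assumes "sym_posdef S" "orthogonal_matrix U"
  shows "polSigma (S ** U) = S" "polU (S ** U) = U"
proof -
  have e: "(S ** U) ** tp (S ** U) = S ** S"
  proof -
    have "(S ** U) ** tp (S ** U) = S ** (U ** tp U) ** tp S"
      by (simp only: matrix_transpose_mul matrix_mul_assoc)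
    then show ?thesis using assms by (simp add: orthogonal_matrix_def posdef_sym)
  qed
  show S: "polSigma (S ** U) = S"
    unfolding polSigma_def e
    by (rule the_equality) (use assms sym_posdef_unique_sqrt in auto)
  show "polU (S ** U) = U"
    using matrix_inv_cancel(2)[OF posdef_invertible[OF assms(1)]]
    by (simp add: polU_def S matrix_mul_assoc)
qed

lemma polar_decomposition:
  fixes M :: "real^'n^'n"
  assumes "invertible M"
  shows "sym_posdef (polSigma M)" "orthogonal_matrix (polU M)" "polSigma M ** polU M = M"
    "polSigma M ** polSigma M = M ** tp M"
proof -
  obtain S U where *: "sym_posdef S" "orthogonal_matrix U" "M = S ** U"
    using polar_decomposition_exists[OF assms] by blast
  from polar_unique[OF this(1,2)] * show 1: "sym_posdef (polSigma M)" "orthogonal_matrix (polU M)"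
    "polSigma M ** polU M = M" by auto
  have "M ** tp M = polSigma M ** (polU M ** tp (polU M)) ** tp (polSigma M)"
    by (subst (1 2) 1(3)[symmetric]) (simp only: matrix_transpose_mul matrix_mul_assoc)
  then show "polSigma M ** polSigma M = M ** tp M"
    using 1 by (simp add: orthogonal_matrix_def posdef_sym)
qed

text \<open>This invariance makes the cost independent of the factors picked by
  \<open>fac\<close>.\<close>

lemma polar_orthogonal_conj:
  fixes M :: "real^'n^'n"
  assumes "invertible M" "orthogonal_matrix O1" "orthogonal_matrix O2"
  shows "trace (polSigma (O1 ** M ** O2)) = trace (polSigma M)"
proof -
  let ?S = "O1 ** polSigma M ** tp O1"
  note P = polar_decomposition[OF assms(1)]
  have O1: "tp O1 ** O1 = mat 1" "O1 ** tp O1 = mat 1"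
    using assms by (simp_all add: orthogonal_matrix_def)
  have "sym_posdef ?S"
    unfolding sym_posdef_def
  proof (intro conjI allI impI)
    show "tp ?S = ?S"
      by (simp add: matrix_transpose_mul posdef_sym[OF P(1)] matrix_mul_assoc)
    fix v :: "real^'n" assume "v \<noteq> 0"
    have "tp O1 *v v \<noteq> 0"
    proof
      assume "tp O1 *v v = 0"
      then have "O1 *v (tp O1 *v v) = 0" by (metis matrix_vector_mult_0_right)
      then show False using \<open>v \<noteq> 0\<close> O1 by (simp only: matrix_vector_mul_assoc matrix_vector_mul_lid)
    qed
    then have "(tp O1 *v v) \<bullet> (polSigma M *v (tp O1 *v v)) > 0"
      using P(1) by (simp add: sym_posdef_def)
    moreover have "v \<bullet> (?S *v v) = (tp O1 *v v) \<bullet> (polSigma M *v (tp O1 *v v))"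
      by (simp add: dot_lmul_matrix matrix_vector_mul_assoc[symmetric])
    ultimately show "v \<bullet> (?S *v v) > 0" by simp
  qed
  moreover have "orthogonal_matrix (O1 ** polU M ** O2)"
    by (intro orthogonal_mult assms P)
  moreover have "O1 ** M ** O2 = ?S ** (O1 ** polU M ** O2)"
  proof -
    have "?S ** (O1 ** polU M ** O2) = O1 ** polSigma M ** (tp O1 ** O1) ** polU M ** O2"
      by (simp only: matrix_mul_assoc)
    also have "\<dots> = O1 ** (polSigma M ** polU M) ** O2" by (simp add: O1 matrix_mul_assoc)
    finally show ?thesis by (simp add: P)
  qed
  ultimately have "polSigma (O1 ** M ** O2) = ?S" using polar_unique(1) by metis
  then have "trace (polSigma (O1 ** M ** O2)) = trace (tp O1 ** (O1 ** polSigma M))"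
    by (simp only: trace_mul_sym[of "O1 ** polSigma M" "tp O1"])
  then show ?thesis by (simp add: matrix_mul_assoc O1)
qed

section \<open>Smoothness of the square root and of the polar factors\<close>

text \<open>Pair \<open>S' S' - S S = S E + E S'\<close> with \<open>E = S' - S\<close>: the term
  with \<open>S'\<close> is nonnegative, and the other is at least \<open>l |E|^2\<close>, where
  \<open>l\<close> is the minimum over the unit sphere. The constant depends on \<open>S\<close>
  alone.\<close>

lemma sqrt_lipschitz:
  fixes S :: "real^'n^'n"
  assumes "sym_posdef S"
  obtains c where "c > 0"
    "\<And>S'. sym_posdef S' \<Longrightarrow> norm (S' - S) \<le> c * norm (S' ** S' - S ** S)"
proof -
  let ?f = "\<lambda>E :: real^'n^'n. E \<bullet> (S ** E)"
  have "continuous_on (sphere 0 1) ?f"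
    by (intro continuous_intros bounded_bilinear.continuous_on[OF bilinear_matmul])
  then obtain E0 where E0: "E0 \<in> sphere 0 1" "\<And>E. E \<in> sphere 0 1 \<Longrightarrow> ?f E0 \<le> ?f E"
    using continuous_attains_inf[of "sphere 0 1 :: (real^'n^'n) set" ?f] by auto
  define l where "l = ?f E0"
  have l: "l > 0" unfolding l_def by (rule posdef_inner_pos[OF assms]) (use E0(1) in auto)
  have lb: "l * (norm E)\<^sup>2 \<le> ?f E" for E
  proof (cases "E = 0")
    case False
    have "l \<le> ?f (E /\<^sub>R norm E)" unfolding l_def by (rule E0(2)) (use False in simp)
    also have "\<dots> = ?f E / (norm E)\<^sup>2" by (simp add: matrix_linear power2_eq_square divide_inverse)
    finally show ?thesis using False by (simp add: field_simps)
  qed simp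
  show ?thesis
  proof (rule that[of "1 / l"])
    fix S' :: "real^'n^'n" assume S': "sym_posdef S'"
    define E where "E = S' - S"
    have "S ** E + E ** S' = S' ** S' - S ** S" by (simp add: E_def matrix_linear)
    then have "E \<bullet> (S' ** S' - S ** S) = ?f E + E \<bullet> (E ** S')"
      by (metis inner_add_right)
    then have "l * (norm E)\<^sup>2 \<le> norm E * norm (S' ** S' - S ** S)"
      using lb[of E] posdef_nonneg_right[OF S', of E] norm_cauchy_schwarz[of E "S' ** S' - S ** S"] by linarith
    then have "l * norm E \<le> norm (S' ** S' - S ** S)"
      by (cases "E = 0") (simp_all add: power2_eq_square)
    then show "norm (S' - S) \<le> 1 / l * norm (S' ** S' - S ** S)"
      using l by (simp add: E_def field_simps)
  qed (use l in simp)
qed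

text \<open>The increment \<open>E\<close> solves
  \<open>s p ** E + E ** s p = P - P p - E ** E\<close>. By the Lipschitz bound \<open>E\<close> is
  of the order of \<open>P - P p\<close>, so \<open>E ** E\<close> has derivative zero and the
  equation can be solved like a linear one.\<close>

lemma differentiable_sqrt:
  fixes s :: "'a::real_normed_vector \<Rightarrow> real^'n^'n"
  assumes O: "open D" "p \<in> D" and s: "\<And>x. x \<in> D \<Longrightarrow> sym_posdef (s x)"
    and P: "P differentiable (at p)" and eq: "\<And>x. x \<in> D \<Longrightarrow> s x ** s x = P x"
  shows "s differentiable (at p)"
proof -
  obtain c where c: "c > 0" "\<And>S'. sym_posdef S' \<Longrightarrow> norm (S' - s p) \<le> c * norm (S' ** S' - s p ** s p)"
    using sqrt_lipschitz[OF s[OF O(2)]] by blast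
  \<comment> \<open>Set to 0 outside \<open>D\<close>, where \<open>s\<close> is not controlled, so
    that the bound holds at every point.\<close>
  define E where "E x = (if x \<in> D then s x - s p else 0)" for x
  have Dn: "norm (E x) \<le> c * norm (P x - P p)" for x
    using c(2)[OF s, of x] eq[OF O(2)] eq[of x] c(1) by (auto simp: E_def)
  obtain B where B: "\<And>(a :: real^'n^'n) (b :: real^'n^'n). norm (a ** b) \<le> norm a * norm b * B" "B > 0"
    using bounded_bilinear.pos_bounded[OF bilinear_matmul] by blast
  have dP: "(\<lambda>x. P x - P p) differentiable (at p)" using P by (intro differentiable_diff) auto
  have "((\<lambda>x. E x ** E x) has_derivative (\<lambda>h. 0)) (at p)"
  proof (rule has_derivative_zeroI[OF dP, where e = "\<lambda>x. norm (P x - P p) * (c * c * B)"])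
    have "isCont P p" using P differentiable_imp_continuous_within by blast
    then show "((\<lambda>y. norm (P y - P p) * (c * c * B)) \<longlongrightarrow> 0) (at p)"
      unfolding isCont_def by (intro tendsto_mult_left_zero tendsto_norm_zero) (simp add: LIM_zero)
    show "norm (E x ** E x) \<le> norm (P x - P p) * (norm (P x - P p) * (c * c * B))" for x
    proof -
      have "norm (E x ** E x) \<le> norm (E x) * norm (E x) * B" by (rule B)
      also have "\<dots> \<le> (c * norm (P x - P p)) * (c * norm (P x - P p)) * B"
        using Dn B c by (intro mult_right_mono mult_mono) auto
      finally show ?thesis by (simp add: mult_ac)
    qed
  qed (use B c in auto)
  then have d2: "(\<lambda>x. P x - P p - E x ** E x) differentiable (at p)"
    by (intro differentiable_diff[OF dP]) (unfold differentiable_def, rule exI)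
  have "E differentiable (at p)"
  proof (rule differentiable_solve(1)[OF bilinear_sylvester O _ d2])
    show "(\<lambda>x. s p) differentiable at p" by simp
    show "s p ** E x + E x ** s p = P x - P p - E x ** E x" if "x \<in> D" for x
      using eq[OF that] eq[OF O(2)] that by (simp add: E_def matrix_linear algebra_simps)
  qed (use sylvester_injective s O in blast)
  then have "(\<lambda>x. E x + s p) differentiable (at p)" by (intro differentiable_add) auto
  then show ?thesis by (rule differentiable_cong_open[OF O, rotated]) (simp add: E_def)
qed

text \<open>Differentiating \<open>s s = P\<close> gives a Sylvester equation whose coefficient is
  \<open>s\<close> itself, so order \<open>n\<close> of \<open>s\<close> yields order
  \<open>n\<close> of its derivatives.\<close>

lemma Dk_sqrt:
  fixes s :: "'a::real_normed_vector \<Rightarrow> real^'n^'n"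
  assumes O: "open D" and s: "\<And>x. x \<in> D \<Longrightarrow> sym_posdef (s x)"
    and eq: "\<And>x. x \<in> D \<Longrightarrow> s x ** s x = P x" and P: "Dk n P D"
  shows "Dk n s D"
  using P
proof (induction n)
  case (Suc n)
  have ds: "s differentiable (at p)" if "p \<in> D" for p
    by (rule differentiable_sqrt[OF O that s _ eq]) (use Suc.prems that in auto)
  have sD: "Dk n s D" using Suc Dk_SucD by blast
  have "Dk n (dd v s) D" for v
  proof (rule Dk_solve[OF bilinear_sylvester O sD])
    show "Dk n (dd v P) D" using Suc.prems by simp
    show "s x ** dd v s x + dd v s x ** s x = dd v P x" if "x \<in> D" for x
      using dd_bilinear[OF bilinear_matmul ds[OF that] ds[OF that]]
        dd_cong[OF O that, of "\<lambda>x. s x ** s x" P] eq by simp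
  qed (use sylvester_injective s in blast)
  with ds show ?case by simp
qed simp

lemma smooth_sqrt:
  fixes s :: "'a::real_normed_vector \<Rightarrow> real^'n^'n"
  assumes "open D" "\<And>x. x \<in> D \<Longrightarrow> sym_posdef (s x)"
    and "\<And>x. x \<in> D \<Longrightarrow> s x ** s x = P x" "smooth P D"
  shows "smooth s D"
  using assms Dk_sqrt unfolding smooth_def by blast

section \<open>Smoothness and first derivatives of the polar factors\<close>

lemma smooth_bilinear:
  "open D \<Longrightarrow> bounded_bilinear \<beta> \<Longrightarrow> smooth f D \<Longrightarrow> smooth g D \<Longrightarrow> smooth (\<lambda>x. \<beta> (f x) (g x)) D"
  using Dk_bilinear unfolding smooth_def by blast

lemma smooth_linear:
  "open D \<Longrightarrow> bounded_linear L \<Longrightarrow> smooth f D \<Longrightarrow> smooth (\<lambda>x. L (f x)) D"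
  using Dk_linear unfolding smooth_def by blast

lemma smooth_const: "smooth (\<lambda>_. c) D"
  using Dk_const unfolding smooth_def by blast

lemma smooth_add: "open D \<Longrightarrow> smooth f D \<Longrightarrow> smooth g D \<Longrightarrow> smooth (\<lambda>x. f x + g x) D"
  using Dk_add unfolding smooth_def by blast

lemma invertible_mult_eq_0:
  assumes "invertible (A :: real^'n^'n)" "A ** X = 0"
  shows "X = (0 :: real^'k^'n)"
  using assms matrix_inv_cancel(2)[OF assms(1)] by (metis matrix_mul_assoc matrix_mul_lid mm.zero_right)

lemma smooth_matrix_solve:
  fixes M X A :: "'a::real_normed_vector \<Rightarrow> real^'n^'n"
  assumes "open D" "smooth M D" "smooth A D" "\<And>x. x \<in> D \<Longrightarrow> invertible (M x)"
    "\<And>x. x \<in> D \<Longrightarrow> M x ** X x = A x"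
  shows "smooth X D"
  using Dk_solve[OF bilinear_matmul, of D _ M A X] invertible_mult_eq_0 assms
  unfolding smooth_def by blast

lemma smooth_polar:
  fixes M :: "'a::real_normed_vector \<Rightarrow> real^'n^'n"
  assumes O: "open D" and M: "smooth M D" "\<And>x. x \<in> D \<Longrightarrow> invertible (M x)"
  shows "smooth (\<lambda>x. polSigma (M x)) D" "smooth (\<lambda>x. polU (M x)) D"
proof -
  note P = polar_decomposition[OF M(2)]
  have "smooth (\<lambda>x. M x ** tp (M x)) D"
    by (intro smooth_bilinear[OF O bilinear_matmul] smooth_linear[OF O linear_transpose] M)
  then show S: "smooth (\<lambda>x. polSigma (M x)) D"
    by (rule smooth_sqrt[OF O, rotated 2]) (use P in auto)
  show "smooth (\<lambda>x. polU (M x)) D"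
    by (rule smooth_matrix_solve[OF O S M(1)]) (use P posdef_invertible[OF P(1)] in auto)
qed

lemma dd_orthogonal_skew:
  fixes U :: "'a::real_normed_vector \<Rightarrow> real^'n^'n"
  assumes O: "open D" "p \<in> D" and U: "U differentiable (at p)"
    and orth: "\<And>x. x \<in> D \<Longrightarrow> orthogonal_matrix (U x)"
  shows "tp (dd v U p ** tp (U p)) = - (dd v U p ** tp (U p))"
proof -
  have "dd v (\<lambda>x. U x ** tp (U x)) p = dd v (\<lambda>x. mat 1) p"
    by (rule dd_cong[OF O]) (use orth in \<open>simp add: orthogonal_matrix_def\<close>)
  then have "U p ** tp (dd v U p) + dd v U p ** tp (U p) = 0"
    by (simp add: dd_bilinear[OF bilinear_matmul U differentiable_linear[OF linear_transpose U]]
        dd_linear[OF linear_transpose U])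
  then show ?thesis by (simp add: matrix_transpose_mul eq_neg_iff_add_eq_0)
qed

text \<open>With \<open>W = U' U^T\<close> skew and \<open>S'\<close> symmetric,
  \<open>M' U^T = S W + S'\<close>. The skew part of this equation determines \<open>W\<close>; its
  trace is that of \<open>S'\<close>, because \<open>S W\<close> is traceless.\<close>

lemma dd_polar:
  fixes M :: "'a::real_normed_vector \<Rightarrow> real^'n^'n"
  assumes O: "open D" "p \<in> D" and M: "M differentiable (at p)" "\<And>x. x \<in> D \<Longrightarrow> invertible (M x)"
  shows "(\<lambda>x. polSigma (M x)) differentiable (at p)" "(\<lambda>x. polU (M x)) differentiable (at p)"
    "dd v (\<lambda>x. polU (M x)) p
      = (2 *\<^sub>R Linv (polSigma (M p)) (mskew (dd v M p ** tp (polU (M p))))) ** polU (M p)"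
    "dd v (\<lambda>x. trace (polSigma (M x))) p = dd v M p \<bullet> polU (M p)"
proof -
  let ?S = "\<lambda>x. polSigma (M x)" and ?U = "\<lambda>x. polU (M x)"
  note P = polar_decomposition[OF M(2)]
  have "(\<lambda>x. M x ** tp (M x)) differentiable (at p)"
    by (intro differentiable_bilinear[OF bilinear_matmul] differentiable_linear[OF linear_transpose] M)
  then show dS: "?S differentiable (at p)" by (rule differentiable_sqrt[OF O, rotated]) (use P in auto)
  have inv: "invertible (?S p)" using P(1)[OF O(2)] by (rule posdef_invertible)
  show dU: "?U differentiable (at p)"
    by (rule differentiable_solve(1)[OF bilinear_matmul O dS M(1) P(3)])
      (use invertible_mult_eq_0[OF inv] in auto)
  define W where "W = dd v ?U p ** tp (?U p)"
  have UU: "?U p ** tp (?U p) = mat 1" "tp (?U p) ** ?U p = mat 1"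
    using P(2)[OF O(2)] by (simp_all add: orthogonal_matrix_def)
  have Ud: "dd v ?U p = W ** ?U p" by (simp add: W_def matrix_mul_assoc[symmetric] UU)
  have skew: "tp W = - W" unfolding W_def by (rule dd_orthogonal_skew[OF O dU P(2)])
  have "dd v M p = dd v (\<lambda>x. ?S x ** ?U x) p" by (rule dd_cong[OF O]) (simp add: P)
  also have "\<dots> = ?S p ** dd v ?U p + dd v ?S p ** ?U p"
    by (rule dd_bilinear[OF bilinear_matmul dS dU])
  finally have MU: "dd v M p ** tp (?U p) = ?S p ** W + dd v ?S p"
    by (simp add: matrix_linear W_def matrix_mul_assoc[symmetric] UU)
  have ST: "tp (?S p) = ?S p" using P(1)[OF O(2)] by (rule posdef_sym)
  have "dd v (\<lambda>x. tp (?S x)) p = dd v ?S p"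
    by (rule dd_cong[OF O]) (use P(1) posdef_sym in blast)
  then have dST: "tp (dd v ?S p) = dd v ?S p" by (simp add: dd_linear[OF linear_transpose dS])
  have "?S p ** W + W ** ?S p = 2 *\<^sub>R mskew (dd v M p ** tp (?U p))"
    unfolding MU mskew_def by (simp add: matrix_linear dST matrix_transpose_mul ST skew algebra_simps)
  then have "W = Linv (?S p) (2 *\<^sub>R mskew (dd v M p ** tp (?U p)))"
    using Linv_iff[OF P(1)[OF O(2)]] by metis
  then show "dd v ?U p = (2 *\<^sub>R Linv (?S p) (mskew (dd v M p ** tp (?U p)))) ** ?U p"
    unfolding Ud by (simp add: Linv_scaleR[OF P(1)[OF O(2)]])
  have "dd v (\<lambda>x. trace (?S x)) p = trace (dd v ?S p)" by (rule dd_linear[OF bounded_linear_trace dS])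
  also have "\<dots> = trace (?S p ** W + dd v ?S p)"
    using inner_skew_sym[OF skew ST]
    by (simp add: trace_add) (metis ST inner_commute trace_transpose_mult)
  also have "\<dots> = dd v M p \<bullet> ?U p"
    unfolding MU[symmetric] by (simp add: trace_inner_mat1 inner_mm_right)
  finally show "dd v (\<lambda>x. trace (?S x)) p = dd v M p \<bullet> ?U p" .
qed

section \<open>The ambient metric in polar gauge\<close>

definition crossB :: "real \<Rightarrow> real^'k^'n \<Rightarrow> real^'k^'n \<Rightarrow> real^'k^'n \<Rightarrow> real^'k^'n \<Rightarrow> real" where
  "crossB K x z a c = (a \<bullet> c) / (2 * K) - (a \<bullet> z) * (c \<bullet> x) / (2 * K\<^sup>2)"

definition "ell S A = Linv S (mskew A)"

lemma crossB_swap: "crossB K x z a c = crossB K z x c a"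
  by (simp add: crossB_def inner_commute)

lemma crossB_linear:
  "crossB K x z (a + b) c = crossB K x z a c + crossB K x z b c"
  "crossB K x z a (b + c) = crossB K x z a b + crossB K x z a c"
  "crossB K x z (a - b) c = crossB K x z a c - crossB K x z b c"
  "crossB K x z a (b - c) = crossB K x z a b - crossB K x z a c"
  "crossB K x z (r *\<^sub>R a) c = r * crossB K x z a c"
  "crossB K x z a (r *\<^sub>R c) = r * crossB K x z a c"
  by (simp_all add: crossB_def inner_add_left inner_add_right inner_diff_left inner_diff_right
      add_divide_distrib diff_divide_distrib ring_distribs)

lemma crossB_zero_left [simp]: "crossB K x z 0 c = 0" and crossB_zero_right [simp]: "crossB K x z a 0 = 0"
  by (simp_all add: crossB_def)

text \<open>The data of a point after absorbing \<open>U\<close>. The conditions are symmetric in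
  \<open>x\<close> and \<open>z\<close>, so by \<open>gauge_swap\<close> each fact about first
  components has a twin for second components.\<close>

locale gauge =
  fixes \<alpha> K :: real and S :: "real^'k::finite^'k" and x z :: "real^'k^'n::finite"
  assumes pos: "\<alpha> > 0" and S: "sym_posdef S" and xz: "tp x ** z = S"
    and K: "K = \<alpha> + trace S"
begin

lemma ST: "tp S = S" using S by (rule posdef_sym)

lemma zx: "tp z ** x = S"
  using arg_cong[OF xz, of tp] by (simp add: matrix_transpose_mul ST)

lemma gauge_swap: "gauge \<alpha> K S z x"
  using pos S zx K by unfold_locales

lemma inner_xz: "x \<bullet> z = K - \<alpha>"
  by (simp add: trace_transpose_mult[symmetric] xz K)

lemma K_pos: "K > 0" using posdef_trace_pos[OF S] pos K by simp

text \<open>A vector in the kernel equals \<open>(a . z) / K\<close> times \<open>x\<close>. Pairing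
  with \<open>z\<close> and using \<open>x . z = K - \<alpha>\<close> leaves
  \<open>\<alpha> (a . z) = 0\<close>, so positivity of \<alpha> keeps the rank-one perturbation
  invertible.\<close>

lemma crossB_nondegenerate:
  assumes "\<And>c. crossB K x z a c = 0"
  shows "a = 0"
proof -
  have "(a - ((a \<bullet> z) / K) *\<^sub>R x) \<bullet> c = 0" for c
    using assms[of c] K_pos
    by (simp add: crossB_def inner_diff_left inner_commute[of c] field_simps power2_eq_square)
  from this[of "a - ((a \<bullet> z) / K) *\<^sub>R x"] have a: "a = ((a \<bullet> z) / K) *\<^sub>R x" by simp
  then have "a \<bullet> z = ((a \<bullet> z) / K) * (K - \<alpha>)" by (metis inner_scaleR_left inner_xz)
  then have "(a \<bullet> z) * \<alpha> = 0" using K_pos by (simp add: field_simps)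
  then show ?thesis using a pos by simp
qed

lemma ell_skew: "tp (ell S A) = - ell S A"
  unfolding ell_def by (rule Linv_mskew_skew[OF S])

lemma ell_transpose: "ell S (tp A) = - ell S A"
  by (simp add: ell_def mskew_transpose Linv_minus[OF S])

lemma ell_add: "ell S (A + B) = ell S A + ell S B"
  by (simp add: ell_def mskew_add Linv_add[OF S])

text \<open>\<open>Linv S\<close> is self-adjoint, and \<open>ell\<close> takes skew values, so
  either argument may be replaced by its skew part.\<close>

lemma ell_inner_commute: "ell S A \<bullet> C = ell S C \<bullet> A"
proof -
  have "ell S A \<bullet> C = ell S A \<bullet> mskew C"
    using mskew_inner_skew[OF ell_skew, of C] by (simp add: inner_commute)
  also have "\<dots> = mskew A \<bullet> ell S C" unfolding ell_def by (rule Linv_adjoint[OF S])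
  also have "\<dots> = ell S C \<bullet> A" using mskew_inner_skew[OF ell_skew] by (simp add: inner_commute)
  finally show ?thesis .
qed

lemma ell_inner_transpose: "ell S A \<bullet> tp C = - (ell S A \<bullet> C)"
  using inner_transpose[of "ell S A" C] unfolding ell_skew by simp

lemma ell_eq_0_iff: "ell S A = 0 \<longleftrightarrow> tp A = A"
  unfolding ell_def Linv_iff[OF S] mskew_eq_0_iff[symmetric] by auto

lemma mskew_S_skew: "tp a = - a \<Longrightarrow> mskew (S ** a) = (1/2) *\<^sub>R (S ** a + a ** S)"
  by (simp add: mskew_def matrix_transpose_mul ST matrix_linear)

text \<open>For skew \<open>a\<close>, the skew part of \<open>S a\<close> is half of
  \<open>L_S a\<close>; the factors 2 in the projections come from here.\<close>

lemma ell_S_skew: "tp a = - a \<Longrightarrow> ell S (S ** a) = (1/2) *\<^sub>R a"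
  unfolding ell_def
  by (rule Linv_eqI[OF S])
    (simp only: mskew_S_skew mm.scaleR_left mm.scaleR_right flip: scaleR_add_right)

lemma skew_inner_vertical: "tp a = - a \<Longrightarrow> (x ** a) \<bullet> z = 0"
  by (simp add: inner_mm_left xz inner_skew_sym ST)

lemma crossB_vertical_left:
  "tp a = - a \<Longrightarrow> crossB K x z (x ** a) c = (a \<bullet> (tp x ** c)) / (2 * K)"
  by (simp add: crossB_def skew_inner_vertical) (simp add: inner_mm_left)

text \<open>The decisive test vector is the skew part of \<open>x^T c\<close> itself.\<close>

lemma vertical_orthogonal_iff:
  "(\<forall>a. tp a = - a \<longrightarrow> crossB K x z (x ** a) c = 0) \<longleftrightarrow> mskew (tp x ** c) = 0"
proof
  assume *: "\<forall>a. tp a = - a \<longrightarrow> crossB K x z (x ** a) c = 0"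
  let ?A = "tp x ** c"
  have "mskew ?A \<bullet> ?A = 0"
    using *[rule_format, OF transpose_mskew, of ?A] K_pos
    by (simp add: crossB_vertical_left transpose_mskew)
  then have "mskew ?A \<bullet> mskew ?A = 0"
    using mskew_inner_skew[OF transpose_mskew, of ?A ?A] by (simp add: inner_commute)
  then show "mskew ?A = 0" by simp
next
  assume *: "mskew (tp x ** c) = 0"
  show "\<forall>a. tp a = - a \<longrightarrow> crossB K x z (x ** a) c = 0"
  proof (intro allI impI)
    fix a :: "real^'k^'k" assume a: "tp a = - a"
    have "a \<bullet> (tp x ** c) = 0"
      using mskew_inner_skew[OF a, of "tp x ** c"] * by (simp add: inner_commute)
    then show "crossB K x z (x ** a) c = 0" using a by (simp add: crossB_vertical_left)
  qed
qed

end

text \<open>The two halves of the Christoffel function in the gauge \<open>U = I\<close>: the part that is linear in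
  the component of the second argument on the same side, and the one linear in the other component.
  Swapping the roles of \<open>x\<close> and \<open>z\<close> turns the first component into the second.\<close>

definition "chr_same S K x z d dh b =
    - ((1/K) *\<^sub>R ((b \<bullet> z) *\<^sub>R d + (d \<bullet> z) *\<^sub>R b)) + x ** ell S (tp dh ** b)
    + d ** ell S (tp b ** z) + b ** ell S (tp x ** dh + tp d ** z)
    + (1/K) *\<^sub>R ((dh \<bullet> x - d \<bullet> z) *\<^sub>R (x ** ell S (tp b ** z))
               - (b \<bullet> z) *\<^sub>R (x ** ell S (tp d ** z)))"

definition "chr_cross S K x z d dh bh = x ** ell S (tp bh ** d) + d ** ell S (tp x ** bh)
    + ((bh \<bullet> x) / K) *\<^sub>R (x ** ell S (tp d ** z))"

text \<open>The derivative of \<open>crossB\<close> along \<open>(d, dh)\<close> when \<open>U\<close> has derivative \<open>W U\<close>.\<close>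

definition "crossB_deriv K W x z d dh b c =
    - (b \<bullet> (c ** W)) / (2 * K) - (b \<bullet> c) * (d \<bullet> z + dh \<bullet> x) / (2 * K\<^sup>2)
    - ((b \<bullet> dh - b \<bullet> (z ** W)) * (c \<bullet> x) + (b \<bullet> z) * (c \<bullet> d + c \<bullet> (x ** W))) / (2 * K\<^sup>2)
    + (b \<bullet> z) * (c \<bullet> x) * (d \<bullet> z + dh \<bullet> x) / K^3"

context gauge begin

lemma ell_right: "(v ** ell S A) \<bullet> w = ell S A \<bullet> (tp v ** w)"
  by (simp add: inner_mm_left)

lemma transpose_mult_swap: "tp w ** v = tp (tp v ** (w :: real^'k^'n))"
  by (simp add: matrix_transpose_mul)

lemma crossB_inverse:
  "crossB K x z a c = inverse K / 2 * (a \<bullet> c) - (inverse K)\<^sup>2 / 2 * (a \<bullet> z) * (c \<bullet> x)"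
  using K_pos by (simp add: crossB_def field_simps)

lemma crossB_deriv_inverse:
  "crossB_deriv K W x z d dh b c = - (b \<bullet> (c ** W)) * inverse K / 2
    - (b \<bullet> c) * (d \<bullet> z + dh \<bullet> x) * (inverse K)\<^sup>2 / 2
    - ((b \<bullet> dh - b \<bullet> (z ** W)) * (c \<bullet> x) + (b \<bullet> z) * (c \<bullet> d + c \<bullet> (x ** W))) * (inverse K)\<^sup>2 / 2
    + (b \<bullet> z) * (c \<bullet> x) * (d \<bullet> z + dh \<bullet> x) * (inverse K)^3"
  unfolding crossB_deriv_def using K_pos by (simp add: field_simps)

lemma ell_inner_gauge: "ell S A \<bullet> (tp x ** z) = 0"
  unfolding xz by (rule inner_skew_sym[OF ell_skew ST])

lemma chr_commute:
  "chr_same S K x z d dh b + chr_cross S K x z d dh bh = chr_same S K x z b bh d + chr_cross S K x z b bh dh"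
  by (simp add: chr_same_def chr_cross_def ell_add matrix_linear algebra_simps scaleR_diff_left
      scaleR_add_right scaleR_diff_right inner_commute)

text \<open>The metric pairs first with second components only. In the compatibility equation, the
  terms that contain the same-side components of both arguments have no counterpart in the
  derivative of the metric and must cancel.\<close>

lemma chr_cross_skew:
  "crossB K x z (chr_cross S K x z d dh b) c + crossB K x z (chr_cross S K x z d dh c) b = 0"
proof -
  define \<Phi> where "\<Phi> A C = ell S A \<bullet> C" for A C :: "real^'k^'k"
  have e: "(v ** ell S A) \<bullet> w = \<Phi> A (tp v ** w)" for v w :: "real^'k^'n" and A
    by (simp add: \<Phi>_def ell_right)
  have s: "\<Phi> A C = \<Phi> C A" for A C unfolding \<Phi>_def by (rule ell_inner_commute)
  have t: "\<Phi> (tp u ** d) C = - \<Phi> (tp d ** u) C" for C and u :: "real^'k^'n"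
    unfolding transpose_mult_swap[of u d] \<Phi>_def ell_transpose by simp
  have V: "\<Phi> A (tp x ** z) = 0" for A unfolding \<Phi>_def by (rule ell_inner_gauge)
  show ?thesis
    unfolding crossB_inverse chr_cross_def divide_inverse inner_add_left inner_scaleR_left e t V
      s[of "tp x ** b"] s[of "tp x ** c"]
    by (simp add: algebra_simps power2_eq_square)
qed

lemma chr_same_compat:
  assumes W: "W = 2 *\<^sub>R ell S (tp d ** z + tp x ** dh)"
  shows "crossB_deriv K W x z d dh b c
    = crossB K x z (chr_same S K x z d dh b) c + crossB K x z b (chr_same S K z x dh d c)"
proof -
  \<comment> \<open>All terms with \<open>ell\<close> become values of a symmetric form that changes
    sign when either argument is transposed. In this normal form the two sides agree by polynomial
    arithmetic.\<close>
  define \<Phi> where "\<Phi> A C = ell S A \<bullet> C" for A C :: "real^'k^'k"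
  have s: "\<Phi> A C = \<Phi> C A" for A C unfolding \<Phi>_def by (rule ell_inner_commute)
  have ad: "\<Phi> (A + A') C = \<Phi> A C + \<Phi> A' C" for A A' C by (simp add: \<Phi>_def ell_add inner_add_left)
  have r: "(v ** ell S A) \<bullet> w = \<Phi> A (tp v ** w)"
     "w \<bullet> (v ** ell S A) = \<Phi> A (tp v ** w)" for v w :: "real^'k^'n" and A
    by (simp_all add: \<Phi>_def ell_right inner_commute[of w])
  have t: "\<Phi> (tp u ** v) C = - \<Phi> (tp v ** u) C"
          "\<Phi> C (tp u ** v) = - \<Phi> C (tp v ** u)" for C and u v :: "real^'k^'n"
    unfolding transpose_mult_swap[of u v] \<Phi>_def ell_transpose ell_inner_transpose by simp_all
  have W': "w \<bullet> (v ** W) = 2 * (\<Phi> (tp d ** z) (tp v ** w) + \<Phi> (tp x ** dh) (tp v ** w))"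
    for v w :: "real^'k^'n" by (simp add: W mm.scaleR_right r ad)
  have V: "\<Phi> A (tp x ** z) = 0" "\<Phi> (tp x ** z) A = 0" for A
    unfolding s[of "tp x ** z"] unfolding \<Phi>_def by (rule ell_inner_gauge)+
  show ?thesis
    unfolding crossB_deriv_inverse crossB_inverse chr_same_def W' divide_inverse inner_add_left inner_add_right inner_diff_left
       inner_diff_right inner_scaleR_left inner_scaleR_right inner_minus_left inner_minus_right r ad
       t[where u = c] t[where u = z] t[where u = dh] V
    by (simp add: algebra_simps power2_eq_square power3_eq_cube s inner_commute)
qed

end

section \<open>Points of \<open>Qset\<close>\<close>

lemma open_invertible: "open {M :: real^'n^'n. invertible M}"
proof -
  have "continuous_on UNIV (det :: real^'n^'n \<Rightarrow> real)"
    unfolding det_def by (intro continuous_intros)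
  then have "open (det -` (- {0}) :: (real^'n^'n) set)" by (intro open_vimage) auto
  moreover have "det -` (- {0}) = {M :: real^'n^'n. invertible M}" by (auto simp: invertible_det_nz)
  ultimately show ?thesis by simp
qed

lemma rank_invertible:
  assumes "invertible (A :: real^'n^'n)"
  shows "rank A = CARD('n)"
  using assms full_rank_injective[of A] invertible_left_inverse matrix_left_invertible_injective
  by blast

lemma invertible_imp_full_rank:
  fixes x y :: "real^'k^'n"
  assumes "invertible (tp x ** y)"
  shows "rank x = CARD('k)" "rank y = CARD('k)"
proof -
  have r: "rank (tp x ** y) = CARD('k)" by (rule rank_invertible[OF assms])
  have "rank (tp x ** y) \<le> rank x" by (metis rank_mul_le_left rank_transpose)
  moreover have "rank x \<le> CARD('k)" using rank_bound[of x] by simp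
  ultimately show "rank x = CARD('k)" using r by simp
  have "rank (tp x ** y) \<le> rank y" by (rule rank_mul_le_right)
  moreover have "rank y \<le> CARD('k)" using rank_bound[of y] by simp
  ultimately show "rank y = CARD('k)" using r by simp
qed

text \<open>The rank of a product is at most that of each factor. In this form \<open>Qset\<close>
  is visibly the preimage of an open set.\<close>

lemma Qset_iff: "q \<in> Qset \<longleftrightarrow> invertible (tp (fst q) ** snd q)"
  unfolding Qset_def using invertible_imp_full_rank by (auto simp: case_prod_beta)

lemma smooth_bounded_linear:
  assumes "bounded_linear L"
  shows "smooth L D"
proof -
  have "Dk n L D" for n
  proof (cases n)
    case (Suc m)
    have "dd v L = (\<lambda>_. L v)" for v
      by (rule ext, rule dd_eqI, rule bounded_linear_imp_has_derivative[OF assms])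
    then show ?thesis
      using Suc bounded_linear_imp_differentiable[OF assms] Dk_const by auto
  qed simp
  then show ?thesis by (simp add: smooth_def)
qed

lemma smooth_gram: "smooth (\<lambda>q :: ('k::finite,'n::finite) amb. tp (fst q) ** snd q) UNIV"
  by (intro smooth_bilinear[OF open_UNIV bilinear_matmul] smooth_bounded_linear
      bounded_linear_compose[OF linear_transpose] bounded_linear_fst bounded_linear_snd)

lemma open_Qset: "open (Qset :: ('k::finite,'n::finite) amb set)"
proof -
  have "continuous_on UNIV (\<lambda>q :: ('k,'n) amb. tp (fst q) ** snd q)"
    using smooth_continuous[OF smooth_gram] continuous_at_imp_continuous_on by blast
  then have "open ((\<lambda>q :: ('k,'n) amb. tp (fst q) ** snd q) -` {M. invertible M})"
    by (intro open_vimage open_invertible)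
  then show ?thesis by (simp add: vimage_def Qset_iff[symmetric])
qed

lemma gQ_crossB:
  "gQ \<alpha> q e1 e2 =
    crossB (KQ \<alpha> q) (fst q) (snd q ** tp (UQ q)) (fst e1) (snd e2 ** tp (UQ q))
  + crossB (KQ \<alpha> q) (fst q) (snd q ** tp (UQ q)) (fst e2) (snd e1 ** tp (UQ q))"
  unfolding gQ_def Let_def crossB_def matrix_mul_assoc[symmetric] trace_transpose_mult
  by (simp add: inner_mm_right algebra_simps add_divide_distrib)

locale Qpoint =
  fixes \<alpha> :: real and q :: "('k::finite,'n::finite) amb"
  assumes alpha: "\<alpha> > 0" and q: "q \<in> Qset"
begin

abbreviation "x \<equiv> fst q"
abbreviation "S \<equiv> SigQ q"
abbreviation "U \<equiv> UQ q"
abbreviation "K \<equiv> KQ \<alpha> q"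
abbreviation "z \<equiv> snd q ** tp (UQ q)"

lemma inv: "invertible (tp x ** snd q)"
  using q by (simp add: Qset_iff)

lemma U: "U ** tp U = mat 1" "tp U ** U = mat 1"
  using polar_decomposition(2)[OF inv] by (simp_all add: UQ_def orthogonal_matrix_def)

lemma U_cancel [simp]: "A ** tp U ** U = A" "A ** U ** tp U = A"
  by (simp_all add: matrix_mul_assoc[symmetric] U)

lemma SU: "tp x ** snd q = S ** U"
  using polar_decomposition(3)[OF inv] by (simp add: UQ_def SigQ_def)

sublocale gauge \<alpha> K S x z
proof
  show "sym_posdef S" using polar_decomposition(1)[OF inv] by (simp add: SigQ_def)
  show "tp x ** z = S" by (simp add: matrix_mul_assoc SU)
qed (use alpha in \<open>simp_all add: KQ_def\<close>)

sublocale sw: gauge \<alpha> K S z x by (rule gauge_swap)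

lemmas gQ_eq = gQ_crossB[of \<alpha> q]

lemma gQ_commute: "gQ \<alpha> q e1 e2 = gQ \<alpha> q e2 e1"
  by (simp add: gQ_eq)

lemma gQ_diff_left: "gQ \<alpha> q (a - b) c = gQ \<alpha> q a c - gQ \<alpha> q b c"
  by (simp add: gQ_eq crossB_linear matrix_linear)

lemma gQ_add_left: "gQ \<alpha> q (a + b) c = gQ \<alpha> q a c + gQ \<alpha> q b c"
  by (simp add: gQ_eq crossB_linear matrix_linear)

lemma gQ_nondegenerate:
  assumes "\<And>c. gQ \<alpha> q a c = 0"
  shows "a = 0"
proof -
  have "fst a = 0"
    by (rule crossB_nondegenerate) (use assms[of "(0, _ ** U)"] in \<open>simp add: gQ_eq\<close>)
  moreover have "snd a ** tp U = 0"
    by (rule sw.crossB_nondegenerate, subst crossB_swap)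
      (use assms[of "(_, 0)"] in \<open>simp add: gQ_eq\<close>)
  then have "snd a = 0" by (metis U_cancel(1) mm.zero_left)
  ultimately show ?thesis by (simp add: prod_eq_iff)
qed

section \<open>The horizontal space and its projection\<close>

lemma skew_conj: "tp b = - b \<Longrightarrow> tp ((A :: real^'k^'k) ** b ** tp A) = - (A ** b ** tp A)"
  by (simp add: matrix_transpose_mul matrix_linear matrix_mul_assoc)

text \<open>The vertical space is a product, so testing with \<open>a = 0\<close> or
  \<open>b = 0\<close> separates the components; conjugation by \<open>U\<close> matches skew
  matrices acting on \<open>y\<close> with those acting on \<open>z\<close>.\<close>

lemma Hor_iff:
  "e \<in> Hor \<alpha> q \<longleftrightarrow> mskew (tp z ** fst e) = 0 \<and> mskew (tp x ** (snd e ** tp U)) = 0"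
proof -
  have "e \<in> Hor \<alpha> q \<longleftrightarrow> (\<forall>a b. tp a = - a \<longrightarrow> tp b = - b \<longrightarrow>
     crossB K x z (fst e) (snd q ** b ** tp U) + crossB K x z (x ** a) (snd e ** tp U) = 0)"
    unfolding Hor_def Vert_def by (auto simp: gQ_eq)
  also have "\<dots> \<longleftrightarrow> (\<forall>b. tp b = - b \<longrightarrow> crossB K x z (fst e) (snd q ** b ** tp U) = 0)
      \<and> (\<forall>a. tp a = - a \<longrightarrow> crossB K x z (x ** a) (snd e ** tp U) = 0)"
    (is "?l \<longleftrightarrow> ?r1 \<and> ?r2")
  proof (intro iffI conjI allI impI)
    assume l: ?l
    show "crossB K x z (fst e) (snd q ** b ** tp U) = 0" if "tp b = - b" for b
      using l[rule_format, of 0 b] that by simp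
    show "crossB K x z (x ** a) (snd e ** tp U) = 0" if "tp a = - a" for a
      using l[rule_format, of a 0] that by simp
  qed auto
  also have "?r1 \<longleftrightarrow> (\<forall>b. tp b = - b \<longrightarrow> crossB K z x (z ** b) (fst e) = 0)"
  proof (intro iffI allI impI)
    fix b :: "real^'k^'k" assume *: ?r1 and b: "tp b = - b"
    have "tp (tp U ** b ** U) = - (tp U ** b ** U)"
      using skew_conj[OF b, of "tp U"] by simp
    from *[rule_format, OF this] show "crossB K z x (z ** b) (fst e) = 0"
      by (simp add: crossB_swap[of K z] matrix_mul_assoc)
  next
    fix b :: "real^'k^'k" assume *: "\<forall>b. tp b = - b \<longrightarrow> crossB K z x (z ** b) (fst e) = 0" and b: "tp b = - b"
    from *[rule_format, OF skew_conj[OF b, of U]]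
    show "crossB K x z (fst e) (snd q ** b ** tp U) = 0"
      by (simp add: crossB_swap[of K z] matrix_mul_assoc)
  qed
  finally show ?thesis unfolding vertical_orthogonal_iff sw.vertical_orthogonal_iff .
qed

lemma gQ_zero_diff: "gQ \<alpha> q c a = 0 \<Longrightarrow> gQ \<alpha> q c b = 0 \<Longrightarrow> gQ \<alpha> q (a - b) c = 0"
  using gQ_diff_left[of a b c] gQ_commute[of a c] gQ_commute[of b c] by simp

lemma gQ_zero_add: "gQ \<alpha> q d h = 0 \<Longrightarrow> gQ \<alpha> q d (c - h) = 0 \<Longrightarrow> gQ \<alpha> q d c = 0"
  using gQ_add_left[of h "c - h" d] gQ_commute[of h d] gQ_commute[of "c - h" d] gQ_commute[of c d] by simp

lemma horizontal_part:
  "(fst w - 2 *\<^sub>R (x ** ell S (tp z ** fst w)),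
    snd w - 2 *\<^sub>R (z ** ell S (tp x ** (snd w ** tp U)) ** U)) \<in> Hor \<alpha> q"
proof -
  \<comment> \<open>The skew part of \<open>S (2 ell S A)\<close> is \<open>L_S (ell S A)\<close>,
    that is, the skew part of \<open>A\<close>.\<close>
  have *: "mskew (A - 2 *\<^sub>R (S ** ell S A)) = 0" for A
    using Linv_solves[OF S, of "mskew A"]
    by (simp add: mskew_diff mskew_scaleR mskew_S_skew[OF ell_skew]) (simp add: ell_def)
  show ?thesis
    using *[of "tp z ** fst w"] *[of "tp x ** (snd w ** tp U)"]
    by (simp add: Hor_iff matrix_linear matrix_mul_assoc zx)
      (simp add: xz[unfolded matrix_mul_assoc])
qed

lemma hproj_eq:
  "hproj \<alpha> q w = (fst w - 2 *\<^sub>R (x ** ell S (tp z ** fst w)),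
    snd w - 2 *\<^sub>R (z ** ell S (tp x ** (snd w ** tp U)) ** U))"
  (is "_ = ?h w")
proof -
  have h: "?h w \<in> Hor \<alpha> q" for w by (rule horizontal_part)
  have v: "gQ \<alpha> q (w - ?h w) h' = 0" if "h' \<in> Hor \<alpha> q" for h' w
  proof -
    let ?A = "2 *\<^sub>R ell S (tp z ** fst w)" and ?B = "2 *\<^sub>R ell S (tp x ** (snd w ** tp U))"
    have "w - ?h w = (x ** ?A, snd q ** (tp U ** ?B ** U))"
      by (simp add: prod_eq_iff matrix_linear matrix_mul_assoc)
    moreover have "tp (tp U ** ?B ** U) = - (tp U ** ?B ** U)"
      using skew_conj[of ?B "tp U"] by (simp add: tp_scaleR ell_skew)
    ultimately have "w - ?h w \<in> Vert q"
      unfolding Vert_def using ell_skew by (force simp: tp_scaleR)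
    then have "gQ \<alpha> q h' (w - ?h w) = 0" using that unfolding Hor_def by blast
    then show ?thesis by (simp only: gQ_commute[of h'])
  qed
  show ?thesis
    unfolding hproj_def
  proof (rule the_equality)
    show "?h w \<in> Hor \<alpha> q \<and> (\<forall>h'\<in>Hor \<alpha> q. gQ \<alpha> q (w - ?h w) h' = 0)" using h v by blast
    fix h' assume h': "h' \<in> Hor \<alpha> q \<and> (\<forall>h''\<in>Hor \<alpha> q. gQ \<alpha> q (w - h') h'' = 0)"
    \<comment> \<open>The metric is indefinite, so positivity cannot give uniqueness. Instead, the
      difference of two projections is orthogonal to both the horizontal and the vertical part of
      every \<open>c\<close>, and nondegeneracy applies.\<close>
    have "gQ \<alpha> q (?h w - h') c = 0" for c
    proof -
      have "gQ \<alpha> q (?h w - h') (?h c) = gQ \<alpha> q (w - h') (?h c) - gQ \<alpha> q (w - ?h w) (?h c)"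
        by (simp add: gQ_diff_left)
      also have "\<dots> = 0" using h v h' by simp
      finally have 1: "gQ \<alpha> q (?h w - h') (?h c) = 0" .
      have 2: "gQ \<alpha> q (?h w - h') (c - ?h c) = 0"
        by (rule gQ_zero_diff) (use v h h' in blast)+
      show ?thesis by (rule gQ_zero_add[OF 1 2])
    qed
    from gQ_nondegenerate[OF this] show "h' = ?h w" by simp
  qed
qed

lemma hproj_horizontal: "hproj \<alpha> q w \<in> Hor \<alpha> q"
  unfolding hproj_eq by (rule horizontal_part)

lemma vproj_eq:
  "vproj \<alpha> q w = (2 *\<^sub>R (x ** ell S (tp z ** fst w)),
    2 *\<^sub>R (z ** ell S (tp x ** (snd w ** tp U)) ** U))"
  by (simp add: vproj_def hproj_eq prod_eq_iff)

section \<open>Derivatives of the polar data on the ambient space\<close>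

lemma dd_gram:
  "dd v (\<lambda>p. tp (fst p) ** snd p) q = tp (fst v) ** snd q + tp x ** snd v"
proof -
  have f: "((\<lambda>p :: ('k,'n) amb. tp (fst p)) has_derivative (\<lambda>v. tp (fst v))) (at q)"
    by (intro bounded_linear_imp_has_derivative bounded_linear_compose[OF linear_transpose] bounded_linear_fst)
  from bounded_bilinear.FDERIV[OF bilinear_matmul f bounded_linear_imp_has_derivative[OF bounded_linear_snd]]
  show ?thesis by (simp add: dd_eqI)
qed

lemma polar_derivatives:
  shows "UQ differentiable (at q)" "SigQ differentiable (at q)"
    "dd v UQ q = (2 *\<^sub>R ell S (tp (fst v) ** z + tp x ** (snd v ** tp U))) ** U"
    "KQ \<alpha> differentiable (at q)"
    "dd v (KQ \<alpha>) q = fst v \<bullet> z + (snd v ** tp U) \<bullet> x"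
proof -
  let ?M = "\<lambda>p :: ('k,'n) amb. tp (fst p) ** snd p"
  have M: "?M differentiable (at q)" using smooth_diff[OF smooth_gram] by blast
  note P = dd_polar[OF open_Qset q M, unfolded Qset_iff]
  have U': "UQ = (\<lambda>p :: ('k,'n) amb. polU (?M p))" and S': "SigQ = (\<lambda>p :: ('k,'n) amb. polSigma (?M p))"
    by (auto simp: UQ_def SigQ_def)
  show "UQ differentiable (at q)" unfolding U' by (rule P(2))
  show dS: "SigQ differentiable (at q)" unfolding S' by (rule P(1))
  show "dd v UQ q = (2 *\<^sub>R ell S (tp (fst v) ** z + tp x ** (snd v ** tp U))) ** U"
    using P(3)[of v] unfolding dd_gram by (simp add: U' S' ell_def matrix_linear matrix_mul_assoc)
  have K': "KQ \<alpha> = (\<lambda>p :: ('k,'n) amb. \<alpha> + trace (SigQ p))" by (auto simp: KQ_def)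
  have dt: "(\<lambda>p :: ('k,'n) amb. trace (SigQ p)) differentiable (at q)" by (rule differentiable_linear[OF bounded_linear_trace dS])
  then show "KQ \<alpha> differentiable (at q)" unfolding K' by (intro differentiable_add) auto
  have "dd v (KQ \<alpha>) q = dd v (\<lambda>p. trace (SigQ p)) q" unfolding K' using dt by (simp add: dd_add)
  also have "\<dots> = (tp (fst v) ** snd q + tp x ** snd v) \<bullet> U"
    using P(4)[of v] unfolding dd_gram by (simp add: U' S')
  also have "\<dots> = fst v \<bullet> z + (snd v ** tp U) \<bullet> x"
    using inner_mm_left[of "fst v" U "snd q"] inner_mm_left[of x U "snd v"]
      inner_mm_right[of "fst v" U "snd q"] inner_mm_right[of x U "snd v"]
    by (simp add: inner_add_left inner_add_right inner_commute)
  finally show "dd v (KQ \<alpha>) q = fst v \<bullet> z + (snd v ** tp U) \<bullet> x" .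
qed

end

section \<open>Levi-Civita connection of the ambient metric\<close>

text \<open>The difference of two candidates, lowered by the metric, is symmetric in its first two
  slots and skew in its last two; going once around the six permutations shows that it is
  zero.\<close>

lemma lc_christoffel_eqI:
  assumes sym: "\<And>u v. gm p u v = gm p v u"
    and diff: "\<And>u v w. gm p (u - v) w = gm p u w - gm p v w"
    and nondeg: "\<And>u. (\<And>w. gm p u w = 0) \<Longrightarrow> u = 0"
    and G: "is_lc_christoffel gm p G"
  shows "lc_christoffel gm p = G"
  unfolding lc_christoffel_def
proof (rule the_equality[where P = "is_lc_christoffel gm p", OF G])
  fix G' assume G': "is_lc_christoffel gm p G'"
  define T where "T a b c = gm p (G' a b - G a b) c" for a b c
  have 1: "T a b c = T b a c" for a b c
    using G G' unfolding is_lc_christoffel_def T_def by metis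
  have 2: "T a b c = - T a c b" for a b c
  proof -
    have "gm p (G' a b) c + gm p b (G' a c) = gm p (G a b) c + gm p b (G a c)"
      using G G' unfolding is_lc_christoffel_def by metis
    then show ?thesis unfolding T_def diff by (simp add: sym[of b])
  qed
  have "T a b c = 0" for a b c
    using 1[of a b c] 2[of b a c] 1[of b c a] 2[of c b a] 1[of c a b] 2[of a c b] by linarith
  then have "G' a b - G a b = 0" for a b unfolding T_def by (rule nondeg)
  then show "G' = G" by (intro ext) simp
qed

abbreviation "dx a \<equiv> dd (a, 0)"
abbreviation "dy b \<equiv> dd (0, b)"

context Qpoint begin

lemma mult_tp_UQ:
  assumes Y: "Y differentiable (at q)"
  shows "(\<lambda>p. Y p ** tp (UQ p)) differentiable (at q)"
    "dd v (\<lambda>p. Y p ** tp (UQ p)) q = Y q ** tp (dd v UQ q) + dd v Y q ** tp U"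
  using differentiable_linear[OF linear_transpose polar_derivatives(1)]
    dd_linear[OF linear_transpose polar_derivatives(1)]
  by (simp_all add: differentiable_bilinear[OF bilinear_matmul Y] dd_bilinear[OF bilinear_matmul Y])

lemma projections:
  "fst differentiable (at q)" "snd differentiable (at q)" "dd v fst q = fst v" "dd v snd q = snd v"
  by (auto intro!: dd_eqI bounded_linear_imp_has_derivative bounded_linear_imp_differentiable
      bounded_linear_fst bounded_linear_snd)

lemma dd_crossB:
  fixes b c v
  defines "W \<equiv> 2 *\<^sub>R ell S (tp (fst v) ** z + tp x ** (snd v ** tp U))"
  shows "((\<lambda>t::real. let p = q + t *\<^sub>R v in crossB (KQ \<alpha> p) (fst p) (snd p ** tp (UQ p)) b (c ** tp (UQ p)))
    has_real_derivative crossB_deriv K W x z (fst v) (snd v ** tp U) b (c ** tp U)) (at 0)"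
proof -
  have WT: "tp W = - W" by (simp add: W_def tp_scaleR ell_skew)
  have dU: "tp (dd v UQ q) = - (tp U ** W)"
    unfolding polar_derivatives(3) W_def[symmetric] by (simp add: matrix_transpose_mul WT matrix_linear)
  note cU = mult_tp_UQ[OF differentiable_const[of c]] and zU = mult_tp_UQ[OF projections(2)]
  define n1 where "n1 p = b \<bullet> (c ** tp (UQ p))" for p :: "('k,'n) amb"
  define n2 where "n2 p = b \<bullet> (snd p ** tp (UQ p))" for p :: "('k,'n) amb"
  define n3 where "n3 p = (c ** tp (UQ p)) \<bullet> fst p" for p :: "('k,'n) amb"
  have n1: "n1 differentiable (at q)" "dd v n1 q = - (b \<bullet> ((c ** tp U) ** W))"
    unfolding n1_def[abs_def]
    by (simp_all add: differentiable_linear[OF bounded_linear_inner_right cU(1)]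
        dd_linear[OF bounded_linear_inner_right cU(1)] cU(2) dU matrix_linear matrix_mul_assoc)
  have n2: "n2 differentiable (at q)" "dd v n2 q = b \<bullet> (snd v ** tp U) - b \<bullet> (z ** W)"
    unfolding n2_def[abs_def]
    by (simp_all add: differentiable_linear[OF bounded_linear_inner_right zU(1)]
        dd_linear[OF bounded_linear_inner_right zU(1)] zU(2) dU projections matrix_linear matrix_mul_assoc inner_diff_right)
  have n3: "n3 differentiable (at q)" "dd v n3 q = (c ** tp U) \<bullet> fst v + (c ** tp U) \<bullet> (x ** W)"
    unfolding n3_def[abs_def] using inner_mm_right[of "c ** tp U" W x]
    by (simp_all add: differentiable_bilinear[OF bounded_bilinear_inner cU(1) projections(1)]
        dd_bilinear[OF bounded_bilinear_inner cU(1) projections(1)] cU(2) projections dU WT matrix_linear matrix_mul_assoc)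
  note L = differentiable_line_deriv[OF n1(1)] differentiable_line_deriv[OF n2(1)]
    differentiable_line_deriv[OF n3(1)] differentiable_line_deriv[OF polar_derivatives(4)]
  have Li: "((\<lambda>t. inverse (KQ \<alpha> (q + t *\<^sub>R v))) has_real_derivative - (dd v (KQ \<alpha>) q * (inverse K)\<^sup>2)) (at 0)"
    using DERIV_inverse_fun[OF L(4)] K_pos by (simp add: power2_eq_square)
  have "((\<lambda>t. n1 (q + t *\<^sub>R v) * inverse (KQ \<alpha> (q + t *\<^sub>R v)) / 2
      - n2 (q + t *\<^sub>R v) * n3 (q + t *\<^sub>R v) * (inverse (KQ \<alpha> (q + t *\<^sub>R v)) * inverse (KQ \<alpha> (q + t *\<^sub>R v))) / 2)
     has_real_derivative crossB_deriv K W x z (fst v) (snd v ** tp U) b (c ** tp U)) (at 0)"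
    unfolding crossB_deriv_inverse
    by (rule DERIV_cong[OF DERIV_diff[OF DERIV_cdivide[OF DERIV_mult[OF L(1) Li]]
        DERIV_cdivide[OF DERIV_mult[OF DERIV_mult[OF L(2) L(3)] DERIV_mult[OF Li Li]]]]],
        simp add: n1(2) n2(2) n3(2) polar_derivatives(5) n1_def n2_def n3_def)
      (simp add: algebra_simps power2_eq_square power3_eq_cube add_divide_distrib diff_divide_distrib)
  moreover have "a / (2 * k) - b * c / (2 * k\<^sup>2) = a * inverse k / 2 - b * c * (inverse k * inverse k) / 2"
    for a b c k :: real by (cases "k = 0") (simp_all add: field_simps power2_eq_square)
  ultimately show ?thesis unfolding Let_def crossB_def n1_def n2_def n3_def by (simp only:)
qed

text \<open>The second component arises from the first by exchanging \<open>x\<close> and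
  \<open>z\<close>; the final factor \<open>U\<close> undoes the substitution
  \<open>z = y U^T\<close>.\<close>

definition chrQ :: "('k,'n) amb \<Rightarrow> ('k,'n) amb \<Rightarrow> ('k,'n) amb" where
  "chrQ v b = (let dh = snd v ** tp U; bh = snd b ** tp U in
    (chr_same S K x z (fst v) dh (fst b) + chr_cross S K x z (fst v) dh bh,
     (chr_same S K z x dh (fst v) bh + chr_cross S K z x dh (fst v) (fst b)) ** U))"

lemma chrQ_is_lc: "is_lc_christoffel (gQ \<alpha>) q chrQ"
  unfolding is_lc_christoffel_def
proof (intro conjI allI)
  fix a b
  show "chrQ a b = chrQ b a"
    unfolding chrQ_def Let_def using chr_commute sw.chr_commute by (metis (no_types))
next
  fix v b c
  define W where "W = 2 *\<^sub>R ell S (tp (fst v) ** z + tp x ** (snd v ** tp U))"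
  have "((\<lambda>t::real. gQ \<alpha> (q + t *\<^sub>R v) b c) has_real_derivative
     crossB_deriv K W x z (fst v) (snd v ** tp U) (fst b) (snd c ** tp U)
     + crossB_deriv K W x z (fst v) (snd v ** tp U) (fst c) (snd b ** tp U)) (at 0)"
    using DERIV_add[OF dd_crossB[of v "fst b" "snd c"] dd_crossB[of v "fst c" "snd b"]]
    unfolding gQ_crossB Let_def W_def .
  then have "dd v (\<lambda>p. gQ \<alpha> p b c) q = crossB_deriv K W x z (fst v) (snd v ** tp U) (fst b) (snd c ** tp U)
     + crossB_deriv K W x z (fst v) (snd v ** tp U) (fst c) (snd b ** tp U)"
    unfolding dd_def by (simp add: vector_derivative_at has_real_derivative_iff_has_vector_derivative)
  \<comment> \<open>The same-side parts account for the derivative of the metric, and the cross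
    parts cancel in pairs.\<close>
  also have "\<dots> = gQ \<alpha> q (chrQ v b) c + gQ \<alpha> q b (chrQ v c)"
    unfolding chr_same_compat[OF W_def] gQ_eq chrQ_def Let_def
    using chr_cross_skew[of "fst v" "snd v ** tp U" "snd b ** tp U" "snd c ** tp U"]
      sw.chr_cross_skew[of "snd v ** tp U" "fst v" "fst b" "fst c"]
    by (simp add: crossB_linear crossB_swap[of K z])
  finally show "dd v (\<lambda>p. gQ \<alpha> p b c) q = gQ \<alpha> q (chrQ v b) c + gQ \<alpha> q b (chrQ v c)" .
qed

lemma lc_christoffel_gQ: "lc_christoffel (gQ \<alpha>) q = chrQ"
  by (rule lc_christoffel_eqI[OF gQ_commute gQ_diff_left gQ_nondegenerate chrQ_is_lc])

lemma trace_gauge: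
  "trace (tp b ** snd q ** tp U) = b \<bullet> z"
  "trace (tp c ** x ** U) = (c ** tp U) \<bullet> x"
  "trace (tp x ** c ** tp U) = (c ** tp U) \<bullet> x"
  using inner_mm_right[of c "tp U" x]
  by (simp_all add: matrix_mul_assoc[symmetric] trace_transpose_mult inner_commute)

lemma ell_swap: "ell S (tp a ** b ** tp U) = - ell S (U ** tp b ** a)"
  unfolding ell_transpose[symmetric] by (simp add: matrix_transpose_mul matrix_mul_assoc)

section \<open>O'Neill's tensor\<close>

abbreviation "oA e eb \<equiv> oneillA \<alpha> q (e, 0) (0, eb)"
abbreviation "gq \<equiv> gQ \<alpha> q"

text \<open>Horizontality removes both skew contributions to the derivative of \<open>U\<close>, so
  no derivative of \<open>U\<close> appears when brackets of horizontal fields are computed.\<close>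

lemma dd_UQ_horizontal:
  assumes "mskew (tp z ** fst v) = 0" "mskew (tp x ** (snd v ** tp U)) = 0"
  shows "dd v UQ q = 0"
proof -
  have "tp (tp z ** fst v) = tp z ** fst v" using assms(1) by (simp only: mskew_eq_0_iff)
  then have "mskew (tp (fst v) ** z) = 0" unfolding mskew_eq_0_iff by (simp add: matrix_transpose_mul)
  then have "ell S (tp (fst v) ** z + tp x ** (snd v ** tp U)) = 0"
    unfolding ell_def mskew_add assms(2) by (simp add: S)
  then show ?thesis by (simp add: polar_derivatives(3))
qed

lemma bounded_linear_mskew: "bounded_linear (mskew :: real^'k^'k \<Rightarrow> _)"
  unfolding linear_conv_bounded_linear[symmetric] by (intro linearI) (simp_all add: mskew_add mskew_scaleR)

text \<open>The two symmetry conditions for horizontality are differentiated along a direction in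
  which \<open>U\<close> is stationary.\<close>

lemma hor_field_derivative:
  assumes X: "hor_field_at \<alpha> q X" and v: "dd v UQ q = 0"
  shows "mskew (tp (snd v ** tp U) ** fst (X q) + tp z ** fst (dd v X q)) = 0"
    and "mskew (tp (fst v) ** (snd (X q) ** tp U) + tp x ** (snd (dd v X q) ** tp U)) = 0"
proof -
  note bb = bilinear_matmul and bt = linear_transpose
  obtain r where r: "r > 0" "\<And>p. p \<in> ball q r \<Longrightarrow> X p \<in> Hor \<alpha> p" and dX: "X differentiable (at q)"
    using X unfolding hor_field_at_def by blast
  define D where "D = ball q r \<inter> Qset"
  have O: "open D" "q \<in> D" using open_Qset q r by (auto simp: D_def)
  have H: "mskew (tp (snd p ** tp (UQ p)) ** fst (X p)) = 0"
    "mskew (tp (fst p) ** (snd (X p) ** tp (UQ p))) = 0" if "p \<in> D" for p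
  proof -
    interpret p: Qpoint \<alpha> p using that alpha by unfold_locales (auto simp: D_def)
    show "mskew (tp (snd p ** tp (UQ p)) ** fst (X p)) = 0"
      "mskew (tp (fst p) ** (snd (X p) ** tp (UQ p))) = 0"
      using p.Hor_iff r(2)[of p] that by (auto simp: D_def)
  qed
  have fX: "(\<lambda>p. fst (X p)) differentiable (at q)" "(\<lambda>p. snd (X p)) differentiable (at q)"
    "dd v (\<lambda>p. fst (X p)) q = fst (dd v X q)" "dd v (\<lambda>p. snd (X p)) q = snd (dd v X q)"
    using differentiable_linear[OF bounded_linear_fst dX] differentiable_linear[OF bounded_linear_snd dX]
      dd_linear[OF bounded_linear_fst dX] dd_linear[OF bounded_linear_snd dX] by auto
  note zU = mult_tp_UQ[OF projections(2)] and XU = mult_tp_UQ[OF fX(2)]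
  note tz = differentiable_linear[OF bt zU(1)] and tx = differentiable_linear[OF bt projections(1)]
  have "dd v (\<lambda>p. mskew (tp (snd p ** tp (UQ p)) ** fst (X p))) q = dd v (\<lambda>p. 0) q"
    by (rule dd_cong[OF O]) (rule H)
  then show "mskew (tp (snd v ** tp U) ** fst (X q) + tp z ** fst (dd v X q)) = 0"
    by (simp add: dd_linear[OF bounded_linear_mskew differentiable_bilinear[OF bb tz fX(1)]]
        dd_bilinear[OF bb tz fX(1)] dd_linear[OF bt zU(1)] zU(2) projections v fX add.commute)
  have "dd v (\<lambda>p. mskew (tp (fst p) ** (snd (X p) ** tp (UQ p)))) q = dd v (\<lambda>p. 0) q"
    by (rule dd_cong[OF O]) (rule H)
  then show "mskew (tp (fst v) ** (snd (X q) ** tp U) + tp x ** (snd (dd v X q) ** tp U)) = 0"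
    by (simp add: dd_linear[OF bounded_linear_mskew differentiable_bilinear[OF bb tx XU(1)]]
        dd_bilinear[OF bb tx XU(1)] dd_linear[OF bt projections(1)] XU(2) projections v fX add.commute)
qed

lemma differentiable_ell:
  assumes A: "A differentiable (at q)"
  shows "(\<lambda>p. ell (SigQ p) (A p)) differentiable (at q)"
proof (rule differentiable_solve(1)[OF bilinear_sylvester open_Qset q polar_derivatives(2)
      differentiable_linear[OF bounded_linear_mskew A]])
  fix p :: "('k,'n) amb" assume "p \<in> Qset"
  then interpret p: Qpoint \<alpha> p using alpha by unfold_locales
  show "SigQ p ** ell (SigQ p) (A p) + ell (SigQ p) (A p) ** SigQ p = mskew (A p)"
    unfolding ell_def by (rule Linv_solves[OF p.S])
qed (use sylvester_injective S in blast)

text \<open>Projected constant fields provide horizontal extensions, so the condition inside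
  \<open>oneillA\<close> is not vacuous and pins down one vector.\<close>

lemma hor_field_hproj:
  "hor_field_at \<alpha> q (\<lambda>p. hproj \<alpha> p w)"
  unfolding hor_field_at_def
proof
  note bb = bilinear_matmul and bt = linear_transpose
  have eq: "hproj \<alpha> p w = (fst w - 2 *\<^sub>R (fst p ** ell (SigQ p) (tp (snd p ** tp (UQ p)) ** fst w)),
      snd w - 2 *\<^sub>R (snd p ** tp (UQ p) ** ell (SigQ p) (tp (fst p) ** (snd w ** tp (UQ p))) ** UQ p))"
    (is "_ = ?f p") if "p \<in> Qset" for p
  proof -
    interpret p: Qpoint \<alpha> p using that alpha by unfold_locales
    show ?thesis by (rule p.hproj_eq)
  qed
  note d = differentiable_bilinear[OF bb] differentiable_linear[OF bt] differentiable_ell polar_derivatives(1) projections(1,2)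
     differentiable_const
  have "?f differentiable (at q)"
    unfolding scaleR_2
    by (intro differentiable_Pair differentiable_diff differentiable_add d)
  then show "(\<lambda>p. hproj \<alpha> p w) differentiable (at q)"
    by (rule differentiable_cong_open[OF open_Qset q, rotated]) (rule eq[symmetric])
  obtain r where r: "r > 0" "ball q r \<subseteq> Qset" using open_Qset q open_contains_ball by blast
  have "hproj \<alpha> p w \<in> Hor \<alpha> p" if "p \<in> Qset" for p
  proof -
    interpret p: Qpoint \<alpha> p using that alpha by unfold_locales
    show ?thesis by (rule p.hproj_horizontal)
  qed
  with r show "\<exists>r>0. \<forall>p\<in>ball q r. hproj \<alpha> p w \<in> Hor \<alpha> p" by blast
qed

lemma hproj_of_horizontal: "w \<in> Hor \<alpha> q \<Longrightarrow> hproj \<alpha> q w = w"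
  by (simp add: hproj_eq Hor_iff ell_def S)

lemma oneillA_eq:
  assumes "(e, eb) \<in> Hor \<alpha> q"
  shows "oA e eb =
    (x ** ell S (U ** tp eb ** e), - (z ** ell S (tp e ** eb ** tp U) ** U))"
    (is "_ = ?A")
proof -
  have h: "mskew (tp z ** e) = 0" "mskew (tp x ** (eb ** tp U)) = 0"
    using assms by (simp_all add: Hor_iff)
  have h0: "(e, 0) \<in> Hor \<alpha> q" "(0, eb) \<in> Hor \<alpha> q" using h by (simp_all add: Hor_iff mskew_eq_0_iff)
  have u: "dx e UQ q = 0" "dy eb UQ q = 0"
    using h by (auto intro!: dd_UQ_horizontal simp: mskew_eq_0_iff)
  have main: "(1/2) *\<^sub>R vproj \<alpha> q (dx e Y q - dy eb X q) = ?A"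
    if XY: "hor_field_at \<alpha> q X" "hor_field_at \<alpha> q Y" "X q = (e, 0)" "Y q = (0, eb)" for X Y
  proof -
    let ?D = "dx e Y q - dy eb X q"
    \<comment> \<open>The vertical projection sees only these skew parts of the bracket, and they
      depend on the fields through their values at \<open>q\<close> alone.\<close>
    have "mskew (tp z ** fst ?D) = mskew (U ** tp eb ** e)"
      using hor_field_derivative(1)[OF XY(1) u(2)] hor_field_derivative(1)[OF XY(2) u(1)] XY(3,4)
      by (simp add: matrix_linear mskew_diff mskew_add matrix_transpose_mul add_eq_0_iff)
    moreover have "mskew (tp x ** (snd ?D ** tp U)) = - mskew (tp e ** eb ** tp U)"
      using hor_field_derivative(2)[OF XY(1) u(2)] hor_field_derivative(2)[OF XY(2) u(1)] XY(3,4)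
      by (simp add: matrix_linear mskew_diff mskew_add matrix_mul_assoc eq_neg_iff_add_eq_0 add.commute)
    ultimately have "ell S (tp z ** fst ?D) = ell S (U ** tp eb ** e)"
      "ell S (tp x ** (snd ?D ** tp U)) = - ell S (tp e ** eb ** tp U)"
      unfolding ell_def by (simp_all add: Linv_minus S)
    then show ?thesis unfolding vproj_eq by (simp add: matrix_linear)
  qed
  show ?thesis
    unfolding oneillA_def
  proof (rule the_equality)
    show "\<forall>X Y. hor_field_at \<alpha> q X \<and> hor_field_at \<alpha> q Y \<and> X q = (e, 0) \<and> Y q = (0, eb) \<longrightarrow>
      (1/2) *\<^sub>R vproj \<alpha> q (dx e Y q - dy eb X q) = ?A" using main by blast
    fix v assume "\<forall>X Y. hor_field_at \<alpha> q X \<and> hor_field_at \<alpha> q Y \<and> X q = (e, 0) \<and> Y q = (0, eb) \<longrightarrow>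
      (1/2) *\<^sub>R vproj \<alpha> q (dx e Y q - dy eb X q) = v"
    with main[OF hor_field_hproj hor_field_hproj hproj_of_horizontal[OF h0(1)] hproj_of_horizontal[OF h0(2)]]
      hor_field_hproj hproj_of_horizontal[OF h0(1)] hproj_of_horizontal[OF h0(2)]
    show "v = ?A" by metis
  qed
qed

text \<open>By \<open>ell_swap\<close> the components of the tensor are \<open>x O\<close> and
  \<open>z O U\<close> with the same skew \<open>O\<close>, so the norm is twice the pairing of
  \<open>x O\<close> with \<open>z O\<close>.\<close>

lemma oneillA_norm:
  assumes "(e, eb) \<in> Hor \<alpha> q"
  shows "gq (oA e eb) (oA e eb) =
      (1/K) * trace (ell S (U ** tp eb ** e) ** S ** ell S (tp e ** eb ** tp U))"
    and "gq (oA e eb) (oA e eb) =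
      (ell S (U ** tp eb ** e) \<bullet> (S ** ell S (U ** tp eb ** e))) / K"
proof -
  let ?O = "ell S (U ** tp eb ** e)"
  note t = ell_swap[of e eb]
  show 1: "gq (oA e eb) (oA e eb) = (?O \<bullet> (S ** ?O)) / K"
    unfolding oneillA_eq[OF assms] t gQ_eq
    by (simp add: matrix_linear crossB_vertical_left ell_skew matrix_mul_assoc)
      (simp add: xz[unfolded matrix_mul_assoc])
  have "trace (?O ** S ** (- ?O)) = trace (tp ?O ** (S ** ?O))"
    by (simp add: ell_skew matrix_linear matrix_mul_assoc)
  then show "gq (oA e eb) (oA e eb) =
      (1/K) * trace (?O ** S ** ell S (tp e ** eb ** tp U))"
    unfolding 1 t by (simp add: trace_transpose_mult)
qed

lemma oneillA_norm_nonneg: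
  assumes "(e, eb) \<in> Hor \<alpha> q"
  shows "gq (oA e eb) (oA e eb) \<ge> 0"
    "gq (oA e eb) (oA e eb) = 0 \<longleftrightarrow>
      tp (U ** tp eb ** e) = U ** tp eb ** e"
proof -
  let ?O = "ell S (U ** tp eb ** e)"
  have "?O \<noteq> 0 \<Longrightarrow> ?O \<bullet> (S ** ?O) > 0" by (rule posdef_inner_pos[OF S])
  then have "?O \<bullet> (S ** ?O) \<ge> 0" "?O \<bullet> (S ** ?O) = 0 \<longleftrightarrow> ?O = 0"
    by (cases "?O = 0"; force)+
  then show "gq (oA e eb) (oA e eb) \<ge> 0"
    "gq (oA e eb) (oA e eb) = 0 \<longleftrightarrow>
      tp (U ** tp eb ** e) = U ** tp eb ** e"
    unfolding oneillA_norm(2)[OF assms] ell_eq_0_iff using K_pos by auto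
qed

end

section \<open>Cross-curvature of a Kim--McCann metric in coordinates\<close>

lemma smooth_dd_commute:
  fixes f :: "'a::real_normed_vector \<Rightarrow> real"
  assumes "smooth f D" "open D" "p \<in> D"
  shows "dd u (dd v (dd w f)) p = dd u (dd w (dd v f)) p"
  by (rule dd_cong[OF assms(2,3)]) (rule dd_commute[OF assms(1,2)])

lemma linear_basis_sum:
  fixes g :: "real^'d::finite \<Rightarrow> real"
  assumes "linear g"
  shows "g c = (\<Sum>i\<in>UNIV. c$i * g (axis i 1))"
proof -
  have "g c = g (\<Sum>i\<in>UNIV. c$i *\<^sub>R axis i 1)"
    by (simp add: basis_expansion[of c, unfolded scalar_mult_eq_scaleR])
  then show ?thesis using assms by (simp add: linear_sum linear_scale)
qed

text \<open>Nondegeneracy on one side is injectivity of \<open>T\<close>, hence surjectivity,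
  because both factors have the same dimension.\<close>

lemma nondegenerate_represents:
  fixes h :: "real^'d::finite \<Rightarrow> real^'d \<Rightarrow> real"
  assumes lin: "\<And>c. linear (\<lambda>b. h b c)" "\<And>b. linear (h b)"
    and nondeg: "\<And>b. (\<And>c. h b c = 0) \<Longrightarrow> b = 0" and f: "linear f"
  shows "\<exists>b. \<forall>c. h b c = f c"
proof -
  define T where "T b = (\<chi> i. h b (axis i 1))" for b
  have T: "linear T" unfolding T_def
    by (rule linearI) (simp_all add: vec_eq_iff linear_add[OF lin(1)] linear_scale[OF lin(1)])
  have "b = 0" if "T b = 0" for b
  proof (rule nondeg)
    show "h b c = 0" for c
      using that linear_basis_sum[OF lin(2), of b c] by (simp add: T_def vec_eq_iff)
  qed
  then have "inj T" using linear_injective_0[OF T] by blast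
  then have "surj T" using linear_injective_imp_surjective[OF T] by auto
  then obtain b where "(\<chi> i. f (axis i 1)) = T b" using surjD by metis
  then have "h b (axis i 1) = f (axis i 1)" for i by (simp add: T_def vec_eq_iff)
  then have "h b c = f c" for c using linear_basis_sum[OF lin(2), of b c] linear_basis_sum[OF f, of c] by simp
  then show ?thesis by blast
qed

lemma differentiable_vec_lambda:
  fixes f :: "'a::real_normed_vector \<Rightarrow> 'n::finite \<Rightarrow> 'b::euclidean_space"
  assumes "\<And>i. (\<lambda>p. f p i) differentiable (at p)"
  shows "(\<lambda>p. \<chi> i. f p i) differentiable (at p)"
proof (subst differentiable_componentwise_within, rule ballI)
  fix b :: "'b^'n" assume "b \<in> Basis"
  then obtain i u where "b = axis i u" by (auto simp: Basis_vec_def)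
  then show "(\<lambda>p. (\<chi> i. f p i) \<bullet> b) differentiable (at p)"
    using differentiable_linear[OF bounded_linear_inner_left assms] by (simp add: inner_axis)
qed

text \<open>The off-diagonal block \<open>h\<close> of the Kim-McCann metric, which pairs
  \<open>X\<close> and \<open>Y\<close> as
  \<open>h (fst X) (snd Y) + h (fst Y) (snd X)\<close>.\<close>

definition mixed_hessian :: "((real^'d::finite) \<times> (real^'d) \<Rightarrow> real) \<Rightarrow> (real^'d) \<times> (real^'d) \<Rightarrow> real^'d \<Rightarrow> real^'d \<Rightarrow> real" where
  "mixed_hessian C p b c = - (1/2) * dy c (dx b C) p"

locale km_coordinates =
  fixes D :: "((real^'d::finite) \<times> (real^'d)) set" and C :: "(real^'d) \<times> (real^'d) \<Rightarrow> real"
    and gm :: "(real^'d) \<times> (real^'d) \<Rightarrow> (real^'d) \<times> (real^'d) \<Rightarrow> (real^'d) \<times> (real^'d) \<Rightarrow> real"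
  assumes op: "open D" and smooth_C: "smooth C D"
    and gm_def: "\<And>p X Y. gm p X Y =
       - (1/2) * (dx (fst X) (dy (snd Y) C) p + dy (snd X) (dx (fst Y) C) p)"
    and nondeg_left: "\<And>p b. p \<in> D \<Longrightarrow> (\<And>c. mixed_hessian C p b c = 0) \<Longrightarrow> b = 0"
    and nondeg_right: "\<And>p c. p \<in> D \<Longrightarrow> (\<And>b. mixed_hessian C p b c = 0) \<Longrightarrow> c = 0"
begin

abbreviation "h \<equiv> mixed_hessian C"

lemma smooth_h: "smooth (\<lambda>p. h p b c) D"
  unfolding mixed_hessian_def
  by (intro smooth_linear[OF op bounded_linear_mult_right] smooth_dd smooth_C)

lemma dd_h:
  assumes "p \<in> D"
  shows "dd v (\<lambda>p. h p b c) p = - (1/2) * dd v (dy c (dx b C)) p"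
  unfolding mixed_hessian_def
  by (intro dd_linear[OF bounded_linear_mult_right] smooth_diff[OF _ assms] smooth_dd smooth_C)

lemma gm_eq: "p \<in> D \<Longrightarrow> gm p X Y = h p (fst X) (snd Y) + h p (fst Y) (snd X)"
  unfolding gm_def mixed_hessian_def using dd_commute[OF smooth_C op] by (simp add: algebra_simps)

lemma linear_dd_fst:
  assumes "smooth f D" "p \<in> D"
  shows "linear (\<lambda>b. dx b f p)"
  by (rule linear_compose[OF _ linear_dd[OF smooth_diff[OF assms]], of "\<lambda>b. (b, 0)", unfolded o_def])
    (auto intro!: linearI)

lemma linear_dd_snd:
  assumes "smooth f D" "p \<in> D"
  shows "linear (\<lambda>b. dy b f p)"
  by (rule linear_compose[OF _ linear_dd[OF smooth_diff[OF assms]], of "\<lambda>b. (0, b)", unfolded o_def])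
    (auto intro!: linearI)

lemma dd_split:
  fixes f :: "(real^'d) \<times> (real^'d) \<Rightarrow> real"
  assumes "smooth f D" "p \<in> D"
  shows "dd v f p = dd (fst v, 0) f p + dd (0, snd v) f p"
  using linear_add[OF linear_dd[OF smooth_diff[OF assms]], of "(fst v, 0)" "(0, snd v)"] by simp

lemma linear_h_right: "p \<in> D \<Longrightarrow> linear (h p b)"
  unfolding mixed_hessian_def
  using linear_compose[OF linear_dd_snd[OF smooth_dd[OF smooth_C]] linear_scaleR[of "- (1/2)"]]
  by (simp add: o_def)

lemma linear_h_left:
  assumes "p \<in> D"
  shows "linear (\<lambda>b. h p b c)"
  unfolding mixed_hessian_def dd_commute[OF smooth_C op assms, of "(0, c)"]
  using linear_compose[OF linear_dd_fst[OF smooth_dd[OF smooth_C] assms] linear_scaleR[of "- (1/2)"]]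
  by (simp add: o_def)

lemma third_left: "p \<in> D \<Longrightarrow> dx a (\<lambda>p. h p b c) p = - (1/2) * dy c (dx a (dx b C)) p"
  using dd_h dd_commute[OF smooth_dd[OF smooth_C] op] by simp

lemma third_right: "p \<in> D \<Longrightarrow> dy a (\<lambda>p. h p b c) p = - (1/2) * dx b (dy a (dy c C)) p"
  using dd_h[of p "(0, a)" b c] smooth_dd_commute[OF smooth_C op, of p "(0, a)" "(0, c)" "(b, 0)"]
    dd_commute[OF smooth_dd[OF smooth_C] op, of p "(0, a)" "(b, 0)" "(0, c)"] by simp

lemma third_left_commute: "p \<in> D \<Longrightarrow> dx a (\<lambda>p. h p b c) p = dx b (\<lambda>p. h p a c) p"
  unfolding third_left using smooth_dd_commute[OF smooth_C op] by simp

lemma third_right_commute: "p \<in> D \<Longrightarrow> dy a (\<lambda>p. h p b c) p = dy c (\<lambda>p. h p b a) p"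
  unfolding third_right using smooth_dd_commute[OF smooth_C op] by simp

lemma third_left_linear:
  assumes "p \<in> D"
  shows "linear (\<lambda>c. dx a (\<lambda>p. h p b c) p)"
  unfolding third_left[OF assms]
  using linear_compose[OF linear_dd_snd[OF smooth_dd[OF smooth_dd[OF smooth_C]] assms] linear_scaleR[of "- (1/2)"]]
  by (simp add: o_def)

lemma third_right_linear:
  assumes "p \<in> D"
  shows "linear (\<lambda>b. dy a (\<lambda>p. h p b c) p)"
  unfolding third_right[OF assms]
  using linear_compose[OF linear_dd_fst[OF smooth_dd[OF smooth_dd[OF smooth_C]] assms] linear_scaleR[of "- (1/2)"]]
  by (simp add: o_def)

text \<open>The two blocks of the Christoffel function: third derivatives of the potential, two in
  one factor and one in the other, with the odd index raised by \<open>h\<close>.\<close>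

definition g1 where "g1 p a b = (SOME v. \<forall>c. h p v c = dx a (\<lambda>p. h p b c) p)"
definition g2 where "g2 p a c = (SOME v. \<forall>b. h p b v = dy a (\<lambda>p. h p b c) p)"

lemma g1:
  assumes "p \<in> D"
  shows "h p (g1 p a b) c = dx a (\<lambda>p. h p b c) p"
proof -
  have "\<exists>v. \<forall>c. h p v c = dx a (\<lambda>p. h p b c) p"
    by (rule nondegenerate_represents[of "h p"])
      (use assms linear_h_left linear_h_right nondeg_left third_left_linear in auto)
  from someI_ex[OF this] show ?thesis unfolding g1_def by blast
qed

lemma g2:
  assumes "p \<in> D"
  shows "h p b (g2 p a c) = dy a (\<lambda>p. h p b c) p"
proof -
  have "\<exists>v. \<forall>b. h p b v = dy a (\<lambda>p. h p b c) p"
    by (rule nondegenerate_represents[of "\<lambda>c b. h p b c"])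
      (use assms linear_h_left linear_h_right nondeg_right third_right_linear in auto)
  from someI_ex[OF this] show ?thesis unfolding g2_def by blast
qed

lemma eq_left:
  assumes "p \<in> D" "\<And>c. h p v c = h p w c"
  shows "v = w"
proof -
  have "v - w = 0"
    by (rule nondeg_left[OF assms(1)]) (simp add: linear_diff[OF linear_h_left[OF assms(1)]] assms(2))
  then show ?thesis by simp
qed

lemma eq_right:
  assumes "p \<in> D" "\<And>b. h p b v = h p b w"
  shows "v = w"
proof -
  have "v - w = 0"
    by (rule nondeg_right[OF assms(1)]) (simp add: linear_diff[OF linear_h_right[OF assms(1)]] assms(2))
  then show ?thesis by simp
qed

lemma h_zero: "p \<in> D \<Longrightarrow> h p 0 c = 0" "p \<in> D \<Longrightarrow> h p b 0 = 0"
  using linear_0[OF linear_h_left] linear_0[OF linear_h_right] by blast+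

lemma dd_zero: "dx 0 f p = 0" "dy 0 f p = 0"
  by (simp_all add: dd_def flip: zero_prod_def)

lemma g1_zero: "p \<in> D \<Longrightarrow> g1 p a 0 = 0" "p \<in> D \<Longrightarrow> g1 p 0 b = 0"
  by (rule eq_left, assumption, simp add: g1 third_left_commute[of _ a] h_zero dd_zero)+

lemma g2_zero: "p \<in> D \<Longrightarrow> g2 p a 0 = 0" "p \<in> D \<Longrightarrow> g2 p 0 b = 0"
  by (rule eq_right, assumption, simp add: g2 third_right_commute[of _ a _ 0] h_zero dd_zero)+

text \<open>\<open>g1\<close> absorbs the derivative of \<open>h\<close> in the first factor and
  \<open>g2\<close> that in the second, so compatibility holds without components mixing the
  factors. Torsion-freeness is the commutation of derivatives of \<open>C\<close>.\<close>

lemma lc_christoffel_gm: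
  assumes p: "p \<in> D"
  shows "lc_christoffel gm p = (\<lambda>X Y. (g1 p (fst X) (fst Y), g2 p (snd X) (snd Y)))"
proof (rule lc_christoffel_eqI)
  show "gm p u v = gm p v u" for u v by (simp add: gm_eq[OF p])
  show "gm p (u - v) w = gm p u w - gm p v w" for u v w
    by (simp add: gm_eq[OF p] linear_diff[OF linear_h_left[OF p]] linear_diff[OF linear_h_right[OF p]])
  show "u = 0" if u: "\<And>w. gm p u w = 0" for u
  proof -
    have "fst u = 0"
      by (rule nondeg_left[OF p]) (use u[of "(0, _)"] in \<open>simp add: gm_eq[OF p] h_zero[OF p]\<close>)
    moreover have "snd u = 0"
      by (rule nondeg_right[OF p]) (use u[of "(_, 0)"] in \<open>simp add: gm_eq[OF p] h_zero[OF p]\<close>)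
    ultimately show ?thesis by (simp add: prod_eq_iff)
  qed
  show "is_lc_christoffel gm p (\<lambda>X Y. (g1 p (fst X) (fst Y), g2 p (snd X) (snd Y)))"
    unfolding is_lc_christoffel_def
  proof (intro conjI allI)
    fix a b
    have "g1 p u v = g1 p v u" for u v
      by (rule eq_left[OF p]) (simp add: g1[OF p] third_left_commute[OF p, of u v])
    moreover have "g2 p u v = g2 p v u" for u v
      by (rule eq_right[OF p]) (simp add: g2[OF p] third_right_commute[OF p, of u _ v])
    ultimately show "(g1 p (fst a) (fst b), g2 p (snd a) (snd b)) = (g1 p (fst b) (fst a), g2 p (snd b) (snd a))"
      by metis
  next
    fix v b c
    have "dd v (\<lambda>p. gm p b c) p = dd v (\<lambda>p. h p (fst b) (snd c) + h p (fst c) (snd b)) p"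
      by (rule dd_cong[OF op p]) (simp add: gm_eq)
    also have "\<dots> = dd v (\<lambda>p. h p (fst b) (snd c)) p + dd v (\<lambda>p. h p (fst c) (snd b)) p"
      by (intro dd_add smooth_diff[OF smooth_h p])
    finally show "dd v (\<lambda>p. gm p b c) p = gm p (g1 p (fst v) (fst b), g2 p (snd v) (snd b)) c
        + gm p b (g1 p (fst v) (fst c), g2 p (snd v) (snd c))"
      by (simp add: gm_eq[OF p] g1[OF p] g2[OF p] dd_split[OF smooth_h p, of v])
  qed
qed

text \<open>Although \<open>g2\<close> is defined by choice, it solves a linear system whose matrix
  is the mixed Hessian in coordinates.\<close>

lemma differentiable_g2:
  assumes p: "p \<in> D"
  shows "(\<lambda>p. g2 p a c) differentiable (at p)"
proof (rule differentiable_solve(1)[OF _ op p])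
  define H where "H p = (\<chi> i j. h p (axis i 1) (axis j 1))" for p
  define r where "r p = (\<chi> i. dy a (\<lambda>p. h p (axis i 1) c) p)" for p
  show "bounded_bilinear ((*v) :: real^'d^'d \<Rightarrow> real^'d \<Rightarrow> real^'d)"
    unfolding bilinear_conv_bounded_bilinear[symmetric] bilinear_def
    by (auto intro!: linearI simp: algebra_simps scaleR_matrix_vector_assoc)
  show "H differentiable (at p)"
    unfolding H_def by (intro differentiable_vec_lambda smooth_diff[OF smooth_h p])
  show "r differentiable (at p)"
    unfolding r_def by (intro differentiable_vec_lambda smooth_diff[OF smooth_dd[OF smooth_h] p])
  have Hv: "(H p *v v) $ i = h p (axis i 1) v" if "p \<in> D" for p v i
    unfolding linear_basis_sum[OF linear_h_right[OF that], of _ v]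
    by (simp add: H_def matrix_vector_mult_def mult.commute)
  show "H p *v g2 p a c = r p" if "p \<in> D" for p
    by (simp add: vec_eq_iff Hv[OF that] g2[OF that] r_def)
  show "w = 0" if "H p *v w = 0" for w
  proof (rule nondeg_right[OF p])
    fix b
    have z: "h p (axis i 1) w = 0" for i using that Hv[OF p, of w i] by simp
    show "h p b w = 0" using z linear_basis_sum[OF linear_h_left[OF p], of b w] by simp
  qed
qed

text \<open>Linearity of \<open>h p b\<close> turns it into the inner product with a differentiable
  vector \<open>k p\<close>, to which the product rule applies.\<close>

lemma dd_h_moving:
  assumes p: "p \<in> D" and g: "g differentiable (at p)"
  shows "dd v (\<lambda>p. h p b (g p)) p = h p b (dd v g p) + dd v (\<lambda>p'. h p' b (g p)) p"
proof -
  define k where "k p = (\<chi> j. h p b (axis j 1))" for p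
  have kv: "h p b w = k p \<bullet> w" if "p \<in> D" for p w
    unfolding linear_basis_sum[OF linear_h_right[OF that], of _ w]
    by (simp add: k_def inner_vec_def mult.commute)
  have k: "k differentiable (at p)"
    unfolding k_def by (intro differentiable_vec_lambda smooth_diff[OF smooth_h p])
  have "dd v (\<lambda>p. h p b (g p)) p = dd v (\<lambda>p. k p \<bullet> g p) p"
    by (rule dd_cong[OF op p]) (rule kv)
  also have "\<dots> = k p \<bullet> dd v g p + dd v k p \<bullet> g p"
    by (rule dd_bilinear[OF bounded_bilinear_inner k g])
  also have "dd v k p \<bullet> g p = dd v (\<lambda>p'. k p' \<bullet> g p) p"
    by (rule dd_linear[OF bounded_linear_inner_left k, symmetric])
  also have "\<dots> = dd v (\<lambda>p'. h p' b (g p)) p"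
    by (rule dd_cong[OF op p]) (rule kv[symmetric])
  finally show ?thesis by (simp add: kv[OF p])
qed

text \<open>Without mixed Christoffel components the curvature vector is the derivative of
  \<open>g2 ab ab\<close> in direction \<open>a\<close>, which is found by differentiating the
  defining equation of \<open>g2\<close>. \<open>G1\<close> and \<open>G2\<close> are specified by
  equations at \<open>p\<close> only, so that they can be produced from horizontal vectors.\<close>

theorem cross_curvature:
  assumes p: "p \<in> D"
    and G1: "\<And>c. h p G1 c = - (1/2) * dy c (dx a (dx a C)) p"
    and G2: "\<And>b. h p b G2 = - (1/2) * dy ab (dy ab (dx b C)) p"
  shows "gm p (lc_curv gm p (a, 0) (0, ab) (0, ab)) (a, 0)
    = - (1/2) * dy ab (dy ab (dx a (dx a C))) p - h p G1 G2"
proof -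
  note L = lc_christoffel_gm
  have "dx a (\<lambda>p'. lc_christoffel gm p' (0, ab) (0, ab)) p = dx a (\<lambda>p. (0, g2 p ab ab)) p"
    by (rule dd_cong[OF op p]) (simp add: L g1_zero)
  also have "\<dots> = (0, dx a (\<lambda>p. g2 p ab ab) p)"
    by (rule dd_eqI) (intro has_derivative_Pair has_derivative_const has_derivative_dd differentiable_g2[OF p])
  finally have 1: "dx a (\<lambda>p'. lc_christoffel gm p' (0, ab) (0, ab)) p = (0, dx a (\<lambda>p. g2 p ab ab) p)" .
  have "dy ab (\<lambda>p'. lc_christoffel gm p' (a, 0) (0, ab)) p = dy ab (\<lambda>p'. (0, 0)) p"
    by (rule dd_cong[OF op p]) (simp add: L g1_zero g2_zero)
  then have R: "lc_curv gm p (a, 0) (0, ab) (0, ab) = (0, dx a (\<lambda>p. g2 p ab ab) p)"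
    unfolding lc_curv_def 1 by (simp add: L[OF p] g1_zero[OF p] g2_zero[OF p])
  have e1: "G1 = g1 p a a" by (rule eq_left[OF p]) (simp add: G1 g1[OF p] third_left[OF p])
  have e2: "G2 = g2 p ab ab" by (rule eq_right[OF p]) (simp add: G2 g2[OF p] dd_h[OF p])
  have "gm p (lc_curv gm p (a, 0) (0, ab) (0, ab)) (a, 0) = h p a (dx a (\<lambda>p. g2 p ab ab) p)"
    unfolding R by (simp add: gm_eq[OF p] h_zero[OF p])
  also have "\<dots> = dx a (\<lambda>p. h p a (g2 p ab ab)) p - dx a (\<lambda>p'. h p' a (g2 p ab ab)) p"
    by (simp add: dd_h_moving[OF p differentiable_g2[OF p]])
  also have "dx a (\<lambda>p'. h p' a (g2 p ab ab)) p = h p G1 G2"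
    by (simp add: e1 e2 g1[OF p])
  also have "dx a (\<lambda>p. h p a (g2 p ab ab)) p = dx a (\<lambda>p. - (1/2) * dy ab (dy ab (dx a C)) p) p"
    by (rule dd_cong[OF op p]) (simp add: g2 dd_h)
  also have "\<dots> = - (1/2) * dx a (dy ab (dy ab (dx a C))) p"
    by (intro dd_linear[OF bounded_linear_mult_right] smooth_diff[OF _ p] smooth_dd smooth_C)
  also have "dx a (dy ab (dy ab (dx a C))) p = dy ab (dx a (dy ab (dx a C))) p"
    by (rule dd_commute[OF smooth_dd[OF smooth_dd[OF smooth_C]] op p])
  also have "\<dots> = dy ab (dy ab (dx a (dx a C))) p"
    by (rule smooth_dd_commute[OF smooth_dd[OF smooth_C] op p])
  finally show ?thesis .
qed

end

section \<open>Factorisations \<open>P = x x\<^sup>T\<close>\<close>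

lemma gram_eq_0: "(A :: real^'k^'n) ** tp A = 0 \<Longrightarrow> A = 0"
proof -
  assume *: "A ** tp A = 0"
  have "A \<bullet> A = trace (A ** tp A)"
    using trace_mul_sym[of A "tp A"] by (simp add: trace_transpose_mult)
  also have "\<dots> = 0" unfolding * by (simp add: trace_def)
  finally show "A = 0" by simp
qed

text \<open>With a left inverse \<open>l\<close> of \<open>x\<close>, the candidate is
  \<open>R = l x'\<close>. It is orthogonal, and \<open>D = x' - x R\<close> vanishes because
  \<open>D D^T\<close> does.\<close>

lemma factor_unique:
  fixes x x' :: "real^'k^'n"
  assumes "rank x = CARD('k)" "x ** tp x = x' ** tp x'"
  obtains R :: "real^'k^'k" where "orthogonal_matrix R" "x' = x ** R"
proof -
  obtain l :: "real^'n^'k" where l: "l ** x = mat 1"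
    using assms(1) full_rank_injective matrix_left_invertible_injective by blast
  let ?R = "l ** x'"
  have "?R ** tp ?R = l ** (x' ** tp x') ** tp l"
    by (simp add: matrix_transpose_mul matrix_mul_assoc)
  also have "\<dots> = (l ** x) ** tp (l ** x)"
    unfolding assms(2)[symmetric] by (simp add: matrix_transpose_mul matrix_mul_assoc)
  finally have "?R ** tp ?R = mat 1" by (simp add: l)
  then have "orthogonal_matrix ?R" using matrix_left_right_inverse by (auto simp: orthogonal_matrix_def)
  moreover have "x' - x ** ?R = 0"
  proof (rule gram_eq_0)
    let ?P = "mat 1 - x ** l"
    have "(x' - x ** ?R) ** tp (x' - x ** ?R) = ?P ** (x' ** tp x') ** tp ?P"
      by (simp add: matrix_linear matrix_transpose_mul matrix_mul_assoc)
    also have "\<dots> = (x - x ** (l ** x)) ** tp (x - x ** (l ** x))"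
      unfolding assms(2)[symmetric] by (simp add: matrix_linear matrix_transpose_mul matrix_mul_assoc)
    also have "\<dots> = 0" by (simp add: l)
    finally show "(x' - x ** ?R) ** tp (x' - x ** ?R) = 0" .
  qed
  ultimately show ?thesis using that[of ?R] by simp
qed

lemma fac_orthogonal:
  fixes x :: "real^'k::finite^'n::finite"
  assumes "rank x = CARD('k)"
  obtains R :: "real^'k^'k" where "orthogonal_matrix R" "(fac (x ** tp x) :: real^'k^'n) = x ** R"
proof -
  have "\<exists>x' :: real^'k^'n. rank x' = CARD('k) \<and> x' ** tp x' = x ** tp x"
    using assms by blast
  from someI_ex[OF this] have "(fac (x ** tp x) :: real^'k^'n) ** tp (fac (x ** tp x)) = x ** tp x"
    by (simp add: fac_def)
  with factor_unique[OF assms, of "fac (x ** tp x)"] that show ?thesis by metis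
qed

text \<open>Any factors can replace those chosen by \<open>fac\<close>, as they differ by orthogonal
  matrices on the right.\<close>

lemma cost_gram:
  fixes x y :: "real^'k::finite^'n::finite"
  assumes "invertible (tp x ** y)"
  shows "cost TYPE('k) \<alpha> (x ** tp x) (y ** tp y) = - ln (\<alpha> + trace (polSigma (tp x ** y)))"
proof -
  note r = invertible_imp_full_rank[OF assms]
  obtain R :: "real^'k^'k" where R: "orthogonal_matrix R" "(fac (x ** tp x) :: real^'k^'n) = x ** R"
    using fac_orthogonal[OF r(1)] .
  obtain R' :: "real^'k^'k" where R': "orthogonal_matrix R'" "(fac (y ** tp y) :: real^'k^'n) = y ** R'"
    using fac_orthogonal[OF r(2)] .
  have "tp (fac (x ** tp x) :: real^'k^'n) ** fac (y ** tp y)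
    = tp R ** (tp x ** y) ** R'"
    by (simp add: R R' matrix_transpose_mul matrix_mul_assoc)
  then show ?thesis
    unfolding cost_def using polar_orthogonal_conj[OF assms, of "tp R" R'] R R' by simp
qed

section \<open>Gauge sections of the quotient map\<close>

definition msqrt :: "real^'k^'k \<Rightarrow> real^'k^'k" where
  "msqrt A = (THE S. sym_posdef S \<and> S ** S = A)"

text \<open>For \<open>M = z^T x\<close> the matrix under the root is \<open>z^T P z\<close> with
  \<open>P = x x^T\<close>, so the positive factor is a function of \<open>P\<close>.\<close>

lemma polSigma_msqrt: "polSigma M = msqrt (M ** tp M)"
  by (simp add: polSigma_def msqrt_def)

text \<open>The factor of \<open>P\<close> in polar gauge with respect to \<open>z\<close>: the unique \<open>x\<close> with \<open>x x\<^sup>T = P\<close>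
  and \<open>z\<^sup>T x\<close> symmetric positive definite.\<close>

definition gauge_factor :: "real^'k^'n \<Rightarrow> real^'n^'n \<Rightarrow> real^'k^'n" where
  "gauge_factor z P = P ** z ** matrix_inv (msqrt (tp z ** P ** z))"

text \<open>If \<open>z^T x = \<Sigma> U\<close>, then \<open>P z = x U^T \<Sigma>\<close>, and the
  inverse root cancels \<open>\<Sigma>\<close>.\<close>

lemma gauge_factor_eq:
  fixes x z :: "real^'k^'n"
  assumes "invertible (tp z ** x)"
  shows "gauge_factor z (x ** tp x) = x ** tp (polU (tp z ** x))"
    and "msqrt (tp z ** (x ** tp x) ** z) = polSigma (tp z ** x)"
proof -
  let ?N = "tp z ** x"
  note P = polar_decomposition[OF assms]
  show m: "msqrt (tp z ** (x ** tp x) ** z) = polSigma ?N"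
    by (simp add: polSigma_msqrt matrix_transpose_mul matrix_mul_assoc)
  have t: "tp ?N = tp (polU ?N) ** polSigma ?N"
    using arg_cong[OF P(3), of tp] posdef_sym[OF P(1)]
    by (simp add: matrix_transpose_mul)
  have "gauge_factor z (x ** tp x) = x ** tp ?N ** matrix_inv (polSigma ?N)"
    unfolding gauge_factor_def m by (simp add: matrix_transpose_mul matrix_mul_assoc)
  also have "\<dots> = x ** tp (polU ?N) ** (polSigma ?N ** matrix_inv (polSigma ?N))"
    unfolding t by (simp add: matrix_mul_assoc)
  finally show "gauge_factor z (x ** tp x) = x ** tp (polU ?N)"
    by (simp add: matrix_inv_cancel(1)[OF posdef_invertible[OF P(1)]])
qed

lemma polU_posdef: "sym_posdef S \<Longrightarrow> polU S = mat 1"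
  using polar_unique(2)[of S "mat 1"] by (simp add: orthogonal_matrix_id)

lemma gauge_factor_posdef:
  assumes "sym_posdef (tp z ** x)"
  shows "gauge_factor z (x ** tp x) = x"
  using gauge_factor_eq(1)[OF posdef_invertible[OF assms]] polU_posdef[OF assms] by simp

lemma invertible_gram_imp:
  fixes x z :: "real^'k^'n"
  assumes "invertible (tp z ** (x ** tp x) ** z)"
  shows "invertible (tp z ** x)"
proof -
  have "tp z ** (x ** tp x) ** z = (tp z ** x) ** (tp x ** z)"
    by (simp add: matrix_mul_assoc)
  then show ?thesis using assms
    by (metis invertible_det_nz det_mul mult_zero_left)
qed

lemma gauge_factor_properties:
  fixes x z :: "real^'k^'n"
  assumes "invertible (tp z ** x)"
  defines "x' \<equiv> gauge_factor z (x ** tp x)"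
  shows "x' ** tp x' = x ** tp x" "sym_posdef (tp z ** x')"
    "orthogonal_matrix (tp (polU (tp z ** x)))" "x' = x ** tp (polU (tp z ** x))"
proof -
  note P = polar_decomposition[OF assms(1)]
  show 1: "x' = x ** tp (polU (tp z ** x))"
    unfolding x'_def by (rule gauge_factor_eq(1)[OF assms(1)])
  show 2: "orthogonal_matrix (tp (polU (tp z ** x)))" using P(2) by simp
  then have u: "tp (polU (tp z ** x)) ** polU (tp z ** x) = mat 1"
     "polU (tp z ** x) ** tp (polU (tp z ** x)) = mat 1"
    by (simp_all add: orthogonal_matrix_def)
  have "x' ** tp x' = x ** (tp (polU (tp z ** x)) ** polU (tp z ** x)) ** tp x"
    unfolding 1 by (simp add: matrix_transpose_mul matrix_mul_assoc)
  then show "x' ** tp x' = x ** tp x" by (simp add: u)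
  have "tp z ** x' = (tp z ** x) ** tp (polU (tp z ** x))"
    unfolding 1 by (simp add: matrix_mul_assoc)
  also have "\<dots> = polSigma (tp z ** x) ** (polU (tp z ** x) ** tp (polU (tp z ** x)))"
    by (subst P(3)[symmetric]) (simp only: matrix_mul_assoc)
  finally show "sym_posdef (tp z ** x')" by (simp add: u P(1))
qed

lemma smooth_matrix_inv:
  fixes M :: "'a::real_normed_vector \<Rightarrow> real^'n^'n"
  assumes "open D" "smooth M D" "\<And>x. x \<in> D \<Longrightarrow> invertible (M x)"
  shows "smooth (\<lambda>x. matrix_inv (M x)) D"
  by (rule smooth_matrix_solve[OF assms(1,2) smooth_const[of "mat 1"]])
    (use assms(3) matrix_inv_cancel in auto)

lemma gram_domain:
  fixes z :: "real^'k::finite^'n::finite"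
  assumes "P \<in> SplusK TYPE('k)" "invertible (tp z ** P ** z)"
  obtains x :: "real^'k^'n" where "P = x ** tp x" "invertible (tp z ** x)"
  using assms invertible_gram_imp[of z] unfolding SplusK_def by blast

lemma smooth_gauge_factor:
  fixes \<phi> :: "'a::real_normed_vector \<Rightarrow> real^'n^'n" and z :: "real^'k::finite^'n::finite"
  assumes O: "open A" and \<phi>: "smooth \<phi> A" "\<And>u. u \<in> A \<Longrightarrow> \<phi> u \<in> SplusK TYPE('k)"
    "\<And>u. u \<in> A \<Longrightarrow> invertible (tp z ** \<phi> u ** z)"
  shows "smooth (\<lambda>u. gauge_factor z (\<phi> u)) A"
proof -
  note bl = mm.bounded_linear_left
  note br = mm.bounded_linear_right
  \<comment> \<open>Values of \<open>\<phi>\<close> factor as \<open>x x^T\<close>, so the argument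
    of the root is \<open>N N^T\<close> for the invertible \<open>N = z^T x\<close>.\<close>
  have 1: "sym_posdef (msqrt (tp z ** \<phi> u ** z))
    \<and> msqrt (tp z ** \<phi> u ** z) ** msqrt (tp z ** \<phi> u ** z) = tp z ** \<phi> u ** z"
    if u: "u \<in> A" for u
  proof -
    obtain x :: "real^'k^'n" where x: "\<phi> u = x ** tp x" "invertible (tp z ** x)"
      using gram_domain[OF \<phi>(2,3)[OF u]] .
    have "(tp z ** x) ** tp (tp z ** x) = tp z ** (x ** tp x) ** z"
      by (simp add: matrix_transpose_mul matrix_mul_assoc)
    then show ?thesis unfolding x(1) gauge_factor_eq(2)[OF x(2)]
      using polar_decomposition[OF x(2)] by simp
  qed
  have g: "smooth (\<lambda>u. tp z ** \<phi> u ** z) A"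
    by (intro smooth_linear[OF O bl] smooth_linear[OF O br] \<phi>)
  have "smooth (\<lambda>u. msqrt (tp z ** \<phi> u ** z)) A"
    by (rule smooth_sqrt[OF O _ _ g]) (use 1 in auto)
  then have "smooth (\<lambda>u. matrix_inv (msqrt (tp z ** \<phi> u ** z))) A"
    by (rule smooth_matrix_inv[OF O]) (use 1 posdef_invertible in blast)
  then show ?thesis
    unfolding gauge_factor_def
    by (intro smooth_bilinear[OF O bilinear_matmul] smooth_linear[OF O bl] \<phi>)
qed

section \<open>The dimension of the horizontal space\<close>

text \<open>The injection \<open>f\<close> stands for a linear order on the index type; swapping
  exchanges the pairs above and below the diagonal.\<close>

lemma card_upper_pairs:
  fixes f :: "'k::finite \<Rightarrow> nat"
  assumes "inj f"
  shows "card {(i, j). f i < f j} = CARD('k) * (CARD('k) - 1) div 2"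
proof -
  let ?I = "{(i, j). f i < f j}" and ?J = "{(i, j). f j < f i}" and ?D = "(\<lambda>i. (i, i)) ` (UNIV :: 'k set)"
  have "bij_betw prod.swap ?I ?J" by (auto simp: bij_betw_def inj_on_def image_iff)
  then have IJ: "card ?J = card ?I" by (metis bij_betw_same_card)
  have "(UNIV :: ('k \<times> 'k) set) = ?I \<union> ?J \<union> ?D"
    using assms by (auto simp: image_iff inj_on_def)
  then have "card (UNIV :: ('k \<times> 'k) set) = card (?I \<union> ?J \<union> ?D)" by simp
  also have "\<dots> = card ?I + card ?J + card ?D"
  proof -
    have "(?I \<union> ?J) \<inter> ?D = {}" "?I \<inter> ?J = {}" by auto
    then show ?thesis by (simp add: card_Un_disjoint)
  qed
  also have "card ?D = CARD('k)" by (simp add: card_image inj_on_def)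
  finally have "CARD('k) * CARD('k) = 2 * card ?I + CARD('k)" by (simp add: IJ)
  then show ?thesis by (simp add: diff_mult_distrib2)
qed

text \<open>Strictly upper triangular matrices embed into the skew ones by
  \<open>N - N^T\<close>.\<close>

lemma dim_skew_ge: "CARD('k) * (CARD('k) - 1) div 2 \<le> dim {a :: real^'k::finite^'k. tp a = - a}"
proof -
  obtain f :: "'k \<Rightarrow> nat" where f: "inj f" using finite_imp_inj_to_nat_seg[OF finite[of "UNIV :: 'k set"]] by blast
  define B where "B = (\<lambda>(i, j). axis i (axis j 1) :: real^'k^'k) ` {(i, j). f i < f j}"
  let ?L = "\<lambda>N :: real^'k^'k. N - tp N"
  have "card B = card {(i, j). f i < f j}"
    unfolding B_def by (rule card_image) (auto simp: inj_on_def axis_eq_axis)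
  moreover have "B \<subseteq> Basis" by (force simp: B_def Basis_vec_def)
  then have ind: "independent B" using independent_Basis independent_mono by blast
  have upper: "N $ i $ j = 0" if "N \<in> span B" "\<not> f i < f j" for N i j
  proof -
    have "subspace {N :: real^'k^'k. N $ i $ j = 0}" by (auto simp: subspace_def)
    moreover have "B \<subseteq> {N. N $ i $ j = 0}" using that(2) by (auto simp: B_def axis_def)
    ultimately show ?thesis using span_minimal that(1) by blast
  qed
  have lin: "linear ?L" by (rule linearI) (simp_all add: matrix_linear algebra_simps)
  have "inj_on ?L (span B)"
    unfolding linear_injective_on_subspace_0[OF lin subspace_span]
  proof (intro ballI impI)
    fix N assume N: "N \<in> span B" "?L N = 0"
    have "N $ i $ j = 0" for i j
    proof (cases "f i < f j")
      case True
      have "N $ i $ j = N $ j $ i" using N(2) by (simp add: vec_eq_iff transpose_def)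
      then show ?thesis using upper[OF N(1), of j i] True by simp
    qed (use upper[OF N(1)] in simp)
    then show "N = 0" by (simp add: vec_eq_iff)
  qed
  then have "dim (?L ` span B) = dim (span B)" using dim_image_eq[OF lin, of "span B"] by (simp add: span_span)
  moreover have "dim (span B) = card B" using ind by (simp add: dim_eq_card_independent)
  moreover have "dim (?L ` span B) \<le> dim {a :: real^'k^'k. tp a = - a}"
    by (intro dim_subset) (auto simp: matrix_linear)
  ultimately show ?thesis using card_upper_pairs[OF f] by simp
qed

section \<open>Horizontal vectors at a point in polar gauge\<close>

context gauge begin

definition hor :: "(real^'k^'n) set" where
  "hor = {v. tp (tp z ** v) = tp z ** v}"

lemma subspace_hor: "subspace hor"
  by (auto simp: hor_def subspace_def matrix_linear)

text \<open>An arbitrary \<open>c\<close> differs from a horizontal vector by a vertical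
  \<open>z a\<close>, to which \<open>v\<close> is orthogonal; so nondegeneracy on the whole space
  descends.\<close>

lemma hor_crossB_nondegenerate:
  assumes v: "v \<in> hor" and *: "\<And>c. tp (tp x ** c) = tp x ** c \<Longrightarrow> crossB K x z v c = 0"
  shows "v = 0"
proof (rule crossB_nondegenerate)
  interpret sw: gauge \<alpha> K S z x by (rule gauge_swap)
  fix c :: "real^'k^'n"
  define a where "a = 2 *\<^sub>R ell S (tp x ** c)"
  have a: "tp a = - a" by (simp add: a_def tp_scaleR ell_skew)
  have "mskew (tp x ** (c - z ** a)) = 0"
    using Linv_solves[OF S, of "mskew (tp x ** c)"]
    by (simp add: mm.diff_right mskew_diff matrix_mul_assoc xz mskew_S_skew[OF a])
      (simp add: a_def ell_def matrix_linear scaleR_add_right)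
  then have "crossB K x z v (c - z ** a) = 0" using * by (simp add: mskew_eq_0_iff)
  moreover have "crossB K x z v (z ** a) = 0"
  proof -
    have "mskew (tp z ** v) = 0" using v by (simp add: hor_def mskew_eq_0_iff)
    then have "crossB K z x (z ** a) v = 0" using sw.vertical_orthogonal_iff[of v] a by blast
    then show ?thesis by (simp add: crossB_swap)
  qed
  ultimately show "crossB K x z v c = 0" by (simp add: crossB_linear(4))
qed

text \<open>Sandwiching the difference between \<open>z^T\<close> and \<open>z\<close> gives a
  Sylvester equation for the symmetric \<open>z^T v\<close>, which therefore vanishes; multiplying
  by \<open>z\<close> on the right then leaves \<open>v S = 0\<close>. Hence a tangent vector of the
  quotient has at most one horizontal lift.\<close>

lemma hor_determined:
  assumes "u \<in> hor" "w \<in> hor" and eq: "u ** tp x + x ** tp u = w ** tp x + x ** tp w"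
  shows "u = w"
proof -
  define v where "v = u - w"
  let ?A = "tp z ** v"
  have v: "v \<in> hor" unfolding v_def by (rule subspace_diff[OF subspace_hor assms(1,2)])
  have z: "v ** tp x + x ** tp v = 0" using eq by (simp add: v_def matrix_linear algebra_simps)
  have "0 = tp z ** (v ** tp x + x ** tp v) ** z" by (simp add: z)
  also have "\<dots> = ?A ** (tp x ** z) + (tp z ** x) ** tp ?A"
    by (simp add: matrix_linear matrix_transpose_mul matrix_mul_assoc)
  also have "\<dots> = S ** ?A + ?A ** S" using v by (simp add: xz zx hor_def add.commute)
  finally have A: "?A = 0" using sylvester_injective[OF S S] by metis
  have "0 = (v ** tp x + x ** tp v) ** z" by (simp add: z)
  also have "\<dots> = v ** S + x ** tp ?A"
    by (simp add: matrix_linear matrix_transpose_mul matrix_mul_assoc[symmetric] xz)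
  finally have "v ** S = 0" by (simp add: A)
  then have "v ** (S ** matrix_inv S) = 0" by (simp add: matrix_mul_assoc)
  then show ?thesis by (simp add: v_def matrix_inv_cancel(1)[OF posdef_invertible[OF S]])
qed

text \<open>Horizontal vectors meet the vertical \<open>x a\<close> only in 0. The upper bound is
  enough, since a chart supplies as many independent horizontal vectors.\<close>

lemma dim_hor_le: "dim hor \<le> CARD('n) * CARD('k) - CARD('k) * (CARD('k) - 1) div 2"
proof -
  let ?V = "(\<lambda>a. x ** a) ` {a :: real^'k^'k. tp a = - a}"
  have lin: "linear (\<lambda>a :: real^'k^'k. x ** a)" by (rule linearI) (simp_all add: matrix_linear)
  have skew: "subspace {a :: real^'k^'k. tp a = - a}" by (auto simp: subspace_def matrix_linear)
  have z0: "a = 0" if "x ** a = 0" for a :: "real^'k^'k"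
  proof -
    have "S ** a = 0" using that zx by (metis matrix_mul_assoc mm.zero_right)
    then show ?thesis by (rule invertible_mult_eq_0[OF posdef_invertible[OF S]])
  qed
  then have "inj (\<lambda>a :: real^'k^'k. x ** a)" using linear_injective_0[OF lin] by blast
  then have dV: "dim ?V = dim {a :: real^'k^'k. tp a = - a}"
    using dim_image_eq[OF lin, of "{a. tp a = - a}"] by (simp add: inj_on_subset)
  have sV: "subspace ?V" by (rule linear_subspace_image[OF lin skew])
  have "hor \<inter> ?V = {0}"
  proof
    show "hor \<inter> ?V \<subseteq> {0}"
    proof
      fix v assume "v \<in> hor \<inter> ?V"
      then obtain a where a: "tp a = - a" "v = x ** a" "v \<in> hor" by auto
      have "tp z ** v = S ** a" by (simp only: a(2) matrix_mul_assoc zx)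
      then have "tp (S ** a) = S ** a" using a(3) by (simp add: hor_def)
      then have "- (a ** S) = S ** a" unfolding matrix_transpose_mul ST a(1) mm.minus_left .
      then have "S ** a + a ** S = 0" by (metis add.left_inverse add.commute)
      then have "a = 0" by (rule sylvester_injective[OF S S])
      then show "v \<in> {0}" using a by simp
    qed
    show "{0} \<subseteq> hor \<inter> ?V" using subspace_0[OF subspace_hor] subspace_0[OF sV] by simp
  qed
  moreover have "dim {u + v |u v. u \<in> hor \<and> v \<in> ?V} + dim (hor \<inter> ?V) = dim hor + dim ?V"
    by (rule dim_sums_Int[OF subspace_hor sV])
  moreover have "dim {u + v |u v. u \<in> hor \<and> v \<in> ?V} \<le> DIM(real^'k^'n)" by (rule dim_subset_UNIV)
  ultimately have "dim hor + dim ?V \<le> DIM(real^'k^'n)" by simp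
  then show ?thesis using dV dim_skew_ge[where 'k = 'k] by simp
qed

end

section \<open>Derivatives of minus the logarithm\<close>

lemmas smooth_line_deriv = differentiable_line_deriv[OF smooth_diff]

lemma dd_eq_DERIV:
  fixes g :: "'a::real_normed_vector \<Rightarrow> real"
  assumes "((\<lambda>t. g (p + t *\<^sub>R v)) has_real_derivative D) (at 0)"
  shows "dd v g p = D"
  using assms unfolding dd_def by (simp add: vector_derivative_at has_real_derivative_iff_has_vector_derivative)

locale positive_smooth =
  fixes N :: "'a::real_normed_vector \<Rightarrow> real" and D :: "'a set"
  assumes op: "open D" and sm: "smooth N D" and posN: "\<And>p. p \<in> D \<Longrightarrow> N p > 0"
begin

definition i where "i p = inverse (N p)"

text \<open>With \<open>1 / N\<close> abbreviated to \<open>i\<close>, whose derivative is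
  \<open>- N' i^2\<close>, all iterated derivatives of the logarithm stay polynomial.\<close>

lemma line_i: "p \<in> D \<Longrightarrow> ((\<lambda>t. i (p + t *\<^sub>R v)) has_real_derivative - (dd v N p * (i p)\<^sup>2)) (at 0)"
  unfolding i_def using DERIV_inverse_fun[OF smooth_line_deriv[OF sm, of p v]] posN[of p]
  by (simp add: power2_eq_square)

lemma dd_neg_ln_1:
  assumes p: "p \<in> D"
  shows "dd b (\<lambda>p. - ln (N p)) p = - (dd b N p * i p)"
  by (rule dd_eqI[of _ "\<lambda>b. - (dd b N p * i p)"])
    (use has_derivative_minus[OF has_derivative_ln[OF posN[OF p] has_derivative_dd[OF smooth_diff[OF sm p]]]]
      in \<open>simp add: i_def\<close>)

lemmas line_derivs = smooth_line_deriv[OF smooth_dd[OF sm]]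
  smooth_line_deriv[OF smooth_dd[OF smooth_dd[OF sm]]]
  smooth_line_deriv[OF smooth_dd[OF smooth_dd[OF smooth_dd[OF sm]]]] line_i

lemma dd_neg_ln_2: "p \<in> D \<Longrightarrow>
  dd c (dd b (\<lambda>p. - ln (N p))) p = - (dd c (dd b N) p * i p - dd b N p * dd c N p * (i p)^2)"
  by (rule trans[OF dd_cong[OF op]], assumption, erule dd_neg_ln_1, rule dd_eq_DERIV)
    (auto intro!: derivative_eq_intros line_derivs)

lemma dd_neg_ln_3: "p \<in> D \<Longrightarrow>
  dd d (dd c (dd b (\<lambda>p. - ln (N p)))) p = - (dd d (dd c (dd b N)) p * i p
    - (dd c (dd b N) p * dd d N p + dd d (dd b N) p * dd c N p + dd b N p * dd d (dd c N) p) * (i p)^2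
    + 2 * dd b N p * dd c N p * dd d N p * (i p)^3)"
  by (rule trans[OF dd_cong[OF op]], assumption, erule dd_neg_ln_2, rule dd_eq_DERIV)
    (auto intro!: derivative_eq_intros line_derivs simp: algebra_simps power2_eq_square power3_eq_cube)

lemma dd_neg_ln_4: "p \<in> D \<Longrightarrow>
  dd e (dd d (dd c (dd b (\<lambda>p. - ln (N p))))) p = - (dd e (dd d (dd c (dd b N))) p * i p
    - (dd d (dd c (dd b N)) p * dd e N p + dd e (dd c (dd b N)) p * dd d N p + dd e (dd d (dd b N)) p * dd c N p
       + dd b N p * dd e (dd d (dd c N)) p
       + dd c (dd b N) p * dd e (dd d N) p + dd d (dd b N) p * dd e (dd c N) p
       + dd e (dd b N) p * dd d (dd c N) p) * (i p)^2
    + 2 * (dd c (dd b N) p * dd d N p * dd e N p + dd d (dd b N) p * dd c N p * dd e N p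
         + dd b N p * dd d (dd c N) p * dd e N p + dd e (dd b N) p * dd c N p * dd d N p
         + dd b N p * dd e (dd c N) p * dd d N p + dd b N p * dd c N p * dd e (dd d N) p) * (i p)^3
    - 6 * dd b N p * dd c N p * dd d N p * dd e N p * (i p)^4)"
  by (rule trans[OF dd_cong[OF op]], assumption, erule dd_neg_ln_3, rule dd_eq_DERIV)
    (auto intro!: derivative_eq_intros line_derivs
      simp: algebra_simps power2_eq_square power3_eq_cube power4_eq_xxxx)

lemma smooth_neg_ln: "smooth (\<lambda>p. - ln (N p)) D"
proof -
  have "Dk n (\<lambda>p. ln (N p)) D" for n by (rule Dk_ln[OF op _ posN]) (use sm in \<open>auto simp: smooth_def\<close>)
  from Dk_linear[OF op bounded_linear_minus[OF bounded_linear_ident] this]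
  show ?thesis by (simp add: smooth_def)
qed

end

section \<open>Derivatives of the nuclear norm in polar gauge\<close>

text \<open>Symmetry of \<open>w^T Y\<close> is a linear condition with constant coefficients, so
  derivatives inherit it. For a gauge section this makes the first and second derivatives
  horizontal.\<close>

lemma dd_symmetric:
  fixes Y :: "'a::real_normed_vector \<Rightarrow> real^'k^'n"
  assumes "open V" "smooth Y V" "\<And>u. u \<in> V \<Longrightarrow> tp (tp w ** Y u) = tp w ** Y u" "u \<in> V"
  shows "tp (tp w ** dd a Y u) = tp w ** dd a Y u"
proof -
  note L = mm.bounded_linear_right[of "tp w"]
  note d = smooth_diff[OF assms(2,4)]
  have "dd a (\<lambda>u. tp (tp w ** Y u)) u = dd a (\<lambda>u. tp w ** Y u) u"
    by (rule dd_cong[OF assms(1,4)]) (rule assms(3))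
  then show ?thesis
    by (simp add: dd_linear[OF linear_transpose differentiable_linear[OF L d]] dd_linear[OF L d])
qed

definition "mprod F G p = tp (F (fst p)) ** G (snd p)"

text \<open>Models the two gauge sections. Positivity is imposed against the fixed \<open>z\<close>
  and \<open>x\<close>, which makes \<open>U\<close> trivial on the slices through the base
  point.\<close>

locale polar_germ = gauge \<alpha> K S x z
  for \<alpha> K S and x z :: "real^'k::finite^'n::finite" +
  fixes A B :: "'e::real_normed_vector set" and X Z :: "'e \<Rightarrow> real^'k^'n" and u0 v0 :: 'e
  assumes opA: "open A" and opB: "open B" and u0: "u0 \<in> A" and v0: "v0 \<in> B"
    and smX: "smooth X A" and smZ: "smooth Z B" and X0: "X u0 = x" and Z0: "Z v0 = z"
    and gX: "\<And>u. u \<in> A \<Longrightarrow> sym_posdef (tp z ** X u)"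
    and gZ: "\<And>v. v \<in> B \<Longrightarrow> sym_posdef (tp x ** Z v)"
    and inv: "\<And>u v. u \<in> A \<Longrightarrow> v \<in> B \<Longrightarrow> invertible (tp (X u) ** Z v)"
begin

definition "D = A \<times> B"
definition "p0 = (u0, v0)"
definition "M = mprod X Z"
definition "U p = polU (M p)"
definition "N p = \<alpha> + trace (polSigma (M p))"

lemma open_Omega: "open D" unfolding D_def by (intro open_Times opA opB)
lemma p0_simps [simp]: "fst p0 = u0" "snd p0 = v0" by (simp_all add: p0_def)
lemma p0: "p0 \<in> D" by (simp add: D_def p0_def u0 v0)

lemma smooth_fst_comp: "smooth F A \<Longrightarrow> smooth (\<lambda>p. F (fst p)) D" for F :: "'e \<Rightarrow> 'm::real_normed_vector"
  unfolding smooth_def using Dk_precompose[OF bounded_linear_fst _ _ open_Omega, of _ F A]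
  by (auto simp: D_def)

lemma smooth_snd_comp: "smooth F B \<Longrightarrow> smooth (\<lambda>p. F (snd p)) D" for F :: "'e \<Rightarrow> 'm::real_normed_vector"
  unfolding smooth_def using Dk_precompose[OF bounded_linear_snd _ _ open_Omega, of _ F B]
  by (auto simp: D_def)

lemma smooth_mprod: "smooth F A \<Longrightarrow> smooth G B \<Longrightarrow> smooth (mprod F G) D"
  unfolding mprod_def[abs_def]
  by (intro smooth_bilinear[OF open_Omega bilinear_matmul]
      smooth_linear[OF open_Omega linear_transpose] smooth_fst_comp smooth_snd_comp)

lemma dd_mprod:
  assumes "smooth F A" "smooth G B" "p \<in> D"
  shows "dd v (mprod F G) p = mprod (dd (fst v) F) G p + mprod F (dd (snd v) G) p"
proof -
  have p: "fst p \<in> A" "snd p \<in> B" using assms(3) by (auto simp: D_def)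
  have F: "((\<lambda>p. tp (F (fst p))) has_derivative (\<lambda>v. tp (dd (fst v) F (fst p)))) (at p)"
    by (intro bounded_linear.has_derivative[OF linear_transpose]
      has_derivative_compose[OF bounded_linear_imp_has_derivative[OF bounded_linear_fst]]
      has_derivative_dd smooth_diff[OF assms(1)] p)
  have G: "((\<lambda>p. G (snd p)) has_derivative (\<lambda>v. dd (snd v) G (snd p))) (at p)"
    by (intro has_derivative_compose[OF bounded_linear_imp_has_derivative[OF bounded_linear_snd]]
      has_derivative_dd smooth_diff[OF assms(2)] p)
  from dd_eqI[OF bounded_bilinear.FDERIV[OF bilinear_matmul F G]]
  show ?thesis by (simp add: mprod_def[abs_def])
qed

lemma dd_0_apply: "dd 0 F p = 0" by (simp add: dd_def)

lemma mprod_zero [simp]: "mprod (dd 0 F) G p = 0" "mprod F (dd 0 G) p = 0"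
  by (simp_all add: mprod_def dd_0_apply)

lemma dd_mprod_fst: "smooth F A \<Longrightarrow> smooth G B \<Longrightarrow> p \<in> D \<Longrightarrow> dx b (mprod F G) p = mprod (dd b F) G p"
  by (simp add: dd_mprod)

lemma dd_mprod_snd: "smooth F A \<Longrightarrow> smooth G B \<Longrightarrow> p \<in> D \<Longrightarrow> dy c (mprod F G) p = mprod F (dd c G) p"
  by (simp add: dd_mprod)

lemma smooth_M: "smooth M D" unfolding M_def by (intro smooth_mprod smX smZ)

lemma inv_M: "p \<in> D \<Longrightarrow> invertible (M p)"
  using inv by (auto simp: M_def mprod_def D_def)

lemma smooth_U: "smooth U D"
  unfolding U_def[abs_def] by (rule smooth_polar(2)[OF open_Omega smooth_M inv_M])

lemma smooth_N: "smooth N D"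
  unfolding N_def[abs_def]
  by (intro smooth_add[OF open_Omega] smooth_const smooth_linear[OF open_Omega bounded_linear_trace]
      smooth_polar(1)[OF open_Omega smooth_M inv_M])

lemma orth_U: "p \<in> D \<Longrightarrow> orthogonal_matrix (U p)"
  unfolding U_def by (rule polar_decomposition(2)[OF inv_M])

lemma N_pos: "p \<in> D \<Longrightarrow> N p > 0"
  using posdef_trace_pos[OF polar_decomposition(1)[OF inv_M]] pos by (simp add: N_def add_pos_pos)

text \<open>On this slice \<open>M\<close> is itself positive definite, because
  \<open>z^T X u\<close> is symmetric.\<close>

lemma U_slice_fst: "u \<in> A \<Longrightarrow> U (u, v0) = mat 1"
proof -
  assume "u \<in> A"
  then have "tp z ** X u = tp (tp z ** X u)" using gX posdef_sym by metis
  then have "M (u, v0) = tp z ** X u" by (simp add: M_def mprod_def Z0 matrix_transpose_mul)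
  then show ?thesis using gX[OF \<open>u \<in> A\<close>] by (simp add: U_def polU_posdef)
qed

lemma U_slice_snd: "v \<in> B \<Longrightarrow> U (u0, v) = mat 1"
  using gZ by (simp add: U_def M_def mprod_def X0 polU_posdef)

lemma dd_slice_fst:
  fixes f :: "'e \<times> 'e \<Rightarrow> 'm::real_normed_vector"
  assumes "u \<in> A" "\<And>u. u \<in> A \<Longrightarrow> f (u, v0) = c"
  shows "dx a f (u, v0) = 0"
proof -
  have "dx a f (u, v0) = dd a (\<lambda>u. f (u, v0)) u" by (simp add: dd_def)
  also have "\<dots> = dd a (\<lambda>_. c) u" by (rule dd_cong[OF opA assms(1)]) (rule assms(2))
  finally show ?thesis by simp
qed

lemma dd_slice_snd:
  fixes f :: "'e \<times> 'e \<Rightarrow> 'm::real_normed_vector"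
  assumes "v \<in> B" "\<And>v. v \<in> B \<Longrightarrow> f (u0, v) = c"
  shows "dy a f (u0, v) = 0"
proof -
  have "dy a f (u0, v) = dd a (\<lambda>v. f (u0, v)) v" by (simp add: dd_def)
  also have "\<dots> = dd a (\<lambda>_. c) v" by (rule dd_cong[OF opB assms(1)]) (rule assms(2))
  finally show ?thesis by simp
qed

lemma U_p0: "U p0 = mat 1" unfolding p0_def by (rule U_slice_fst[OF u0])
lemma dd_U_fst: "dx a U p0 = 0"
  unfolding p0_def by (rule dd_slice_fst[where f = U and c = "mat 1"]) (auto intro: U_slice_fst u0)
lemma dd_U_snd: "v \<in> B \<Longrightarrow> dy c U (u0, v) = 0"
  by (rule dd_slice_snd[where f = U and c = "mat 1"]) (auto intro: U_slice_snd)
lemma dd_U_snd0: "dy c U p0 = 0" unfolding p0_def by (rule dd_U_snd[OF v0])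
lemma dd_U_snd_snd: "dy d (dy c U) p0 = 0"
  unfolding p0_def by (rule dd_slice_snd[where f = "dy c U" and c = 0]) (auto intro: dd_U_snd v0)

lemma dd_matrix_mult:
  fixes P Q :: "'e \<times> 'e \<Rightarrow> real^'k^'k"
  assumes "smooth P D" "smooth Q D" "p \<in> D"
  shows "dd v (\<lambda>p. P p ** tp (Q p)) p = P p ** tp (dd v Q p) + dd v P p ** tp (Q p)"
  using dd_bilinear[OF bilinear_matmul smooth_diff[OF assms(1,3)]
      differentiable_linear[OF linear_transpose smooth_diff[OF assms(2,3)]]]
    dd_linear[OF linear_transpose smooth_diff[OF assms(2,3)]] by simp

lemma smooth_matrix_mult:
  fixes P Q :: "'e \<times> 'e \<Rightarrow> real^'k^'k"
  shows "smooth P D \<Longrightarrow> smooth Q D \<Longrightarrow> smooth (\<lambda>p. P p ** tp (Q p)) D"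
  by (intro smooth_bilinear[OF open_Omega bilinear_matmul]
      smooth_linear[OF open_Omega linear_transpose])

lemma dd_plus:
  fixes P Q :: "'e \<times> 'e \<Rightarrow> 'm::real_normed_vector"
  assumes "smooth P D" "smooth Q D" "p \<in> D"
  shows "dd v (\<lambda>p. P p + Q p) p = dd v P p + dd v Q p"
  by (intro dd_add smooth_diff[OF _ assms(3)] assms)

lemma dd_dd_orthogonal:
  assumes p: "p \<in> D"
  shows "U p ** tp (dd w (dd v U) p) + dd w U p ** tp (dd v U p)
       + (dd v U p ** tp (dd w U p) + dd w (dd v U) p ** tp (U p)) = 0"
proof -
  have 1: "U p ** tp (dd v U p) + dd v U p ** tp (U p) = 0" if p: "p \<in> D" for p v
  proof -
    have "dd v (\<lambda>p. U p ** tp (U p)) p = dd v (\<lambda>p. mat 1) p"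
      by (rule dd_cong[OF open_Omega p]) (use orth_U in \<open>simp add: orthogonal_matrix_def\<close>)
    then show ?thesis by (simp add: dd_matrix_mult[OF smooth_U smooth_U p])
  qed
  have "dd w (\<lambda>p. U p ** tp (dd v U p) + dd v U p ** tp (U p)) p = dd w (\<lambda>p. 0) p"
    by (rule dd_cong[OF open_Omega p]) (rule 1)
  then show ?thesis
    by (simp add: dd_plus[OF _ _ p] smooth_matrix_mult smooth_dd smooth_U dd_matrix_mult[OF _ _ p])
qed

text \<open>Here and one order higher, every product of derivatives of \<open>U\<close> in the
  differentiated relation \<open>U U^T = I\<close> contains a pure derivative, which vanishes at the
  base point.\<close>

lemma skew_U_st: "tp (dy c (dx a U) p0) = - dy c (dx a U) p0"
  using dd_dd_orthogonal[OF p0, of "(0, c)" "(a, 0)"]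
  by (simp add: U_p0 dd_U_fst dd_U_snd0 eq_neg_iff_add_eq_0)

lemma skew_U_stt:
  "tp (dy d (dy c (dx a U)) p0) = - dy d (dy c (dx a U)) p0"
proof -
  let ?s = "(a, 0) :: 'e \<times> 'e" and ?t = "(0, c) :: 'e \<times> 'e" and ?r = "(0, d) :: 'e \<times> 'e"
  have "dd ?r (\<lambda>p. U p ** tp (dd ?t (dd ?s U) p) + dd ?t U p ** tp (dd ?s U p)
       + (dd ?s U p ** tp (dd ?t U p) + dd ?t (dd ?s U) p ** tp (U p))) p0 = dd ?r (\<lambda>p. 0) p0"
    by (rule dd_cong[OF open_Omega p0]) (rule dd_dd_orthogonal)
  then show ?thesis
    by (simp add: dd_plus[OF _ _ p0] smooth_matrix_mult smooth_dd smooth_U smooth_add[OF open_Omega]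
        dd_matrix_mult[OF _ _ p0] U_p0 dd_U_fst dd_U_snd0 dd_U_snd_snd eq_neg_iff_add_eq_0)
qed

text \<open>Differentiating the symmetry of \<open>M U\<^sup>T\<close> twice determines the mixed derivative of \<open>U\<close>.\<close>

lemma U_st_eq:
  "dy c (dx a U) p0 = 2 *\<^sub>R ell S (tp (dd a X u0) ** dd c Z v0)"
proof -
  let ?s = "(a, 0) :: 'e \<times> 'e" and ?t = "(0, c) :: 'e \<times> 'e"
  let ?W = "dd ?t (dd ?s U) p0"
  have sym: "tp (M p ** tp (U p)) = M p ** tp (U p)" if "p \<in> D" for p
  proof -
    note P = polar_decomposition[OF inv_M[OF that]]
    have "M p ** tp (U p) = polSigma (M p) ** (polU (M p) ** tp (polU (M p)))"
      unfolding U_def by (subst P(3)[symmetric]) (simp only: matrix_mul_assoc)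
    also have "\<dots> = polSigma (M p)" using P(2) by (simp add: orthogonal_matrix_def)
    finally show ?thesis using posdef_sym[OF P(1)] by simp
  qed
  define Q where "Q p = M p ** tp (U p)" for p
  have sQ: "smooth Q D" unfolding Q_def[abs_def] by (intro smooth_matrix_mult smooth_M smooth_U)
  have t1: "tp (dd v Q p) = dd v Q p" if p: "p \<in> D" for v p
  proof -
    have "dd v (\<lambda>p. tp (Q p)) p = dd v Q p"
      by (rule dd_cong[OF open_Omega p]) (simp add: Q_def sym)
    then show ?thesis by (simp add: dd_linear[OF linear_transpose smooth_diff[OF sQ p]])
  qed
  have "dd ?t (\<lambda>p. tp (dd ?s Q p)) p0 = dd ?t (dd ?s Q) p0"
    by (rule dd_cong[OF open_Omega p0]) (rule t1)
  then have t2: "tp (dd ?t (dd ?s Q) p0) = dd ?t (dd ?s Q) p0"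
    by (simp add: dd_linear[OF linear_transpose smooth_diff[OF smooth_dd[OF sQ] p0]])
  have Q1: "dd ?s Q p = M p ** tp (dd ?s U p) + mprod (dd a X) Z p ** tp (U p)" if "p \<in> D" for p
    unfolding Q_def dd_matrix_mult[OF smooth_M smooth_U that]
    by (simp add: M_def dd_mprod_fst[OF smX smZ that])
  have "dd ?t (dd ?s Q) p0 = dd ?t (\<lambda>p. M p ** tp (dd ?s U p) + mprod (dd a X) Z p ** tp (U p)) p0"
    by (rule dd_cong[OF open_Omega p0]) (rule Q1)
  also have "\<dots> = M p0 ** tp ?W + dd ?t (mprod (dd a X) Z) p0"
    by (simp add: dd_plus[OF _ _ p0] smooth_matrix_mult smooth_dd smooth_U smooth_M smooth_mprod smX smZ
        dd_matrix_mult[OF _ _ p0] U_p0 dd_U_fst dd_U_snd0)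
  also have "M p0 = S" by (simp add: M_def mprod_def X0 Z0 xz)
  also have "dd ?t (mprod (dd a X) Z) p0 = tp (dd a X u0) ** dd c Z v0" (is "_ = ?E")
    by (simp add: dd_mprod_snd[OF smooth_dd[OF smX] smZ p0] mprod_def)
  finally have "dd ?t (dd ?s Q) p0 = ?E - S ** ?W" by (simp add: skew_U_st matrix_linear)
  with t2 have "mskew (?E - S ** ?W) = 0" by (simp add: mskew_eq_0_iff)
  then have "mskew ?E = mskew (S ** ?W)" by (simp add: mskew_diff)
  then have "ell S ?E = ell S (S ** ?W)" by (simp add: ell_def)
  then show ?thesis by (simp add: ell_S_skew[OF skew_U_st])
qed

section \<open>Derivatives of the trace of the positive factor\<close>

definition "pairing F G T p = mprod F G p \<bullet> T p"

lemma smooth_pairing: "smooth F A \<Longrightarrow> smooth G B \<Longrightarrow> smooth T D \<Longrightarrow> smooth (pairing F G T) D"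
  unfolding pairing_def[abs_def] by (intro smooth_bilinear[OF open_Omega bounded_bilinear_inner] smooth_mprod)

lemma dd_pairing_fst:
  assumes "smooth F A" "smooth G B" "smooth T D" "p \<in> D"
  shows "dx b (pairing F G T) p = pairing (dd b F) G T p + pairing F G (dx b T) p"
  using dd_bilinear[OF bounded_bilinear_inner smooth_diff[OF smooth_mprod[OF assms(1,2)] assms(4)]
      smooth_diff[OF assms(3,4)], of "(b, 0)"]
  by (simp add: pairing_def[abs_def] dd_mprod_fst[OF assms(1,2,4)])

lemma dd_pairing_snd:
  assumes "smooth F A" "smooth G B" "smooth T D" "p \<in> D"
  shows "dy c (pairing F G T) p = pairing F (dd c G) T p + pairing F G (dy c T) p"
  using dd_bilinear[OF bounded_bilinear_inner smooth_diff[OF smooth_mprod[OF assms(1,2)] assms(4)]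
      smooth_diff[OF assms(3,4)], of "(0, c)"]
  by (simp add: pairing_def[abs_def] dd_mprod_snd[OF assms(1,2,4)])

lemma pairing_zero: "T p = 0 \<Longrightarrow> pairing F G T p = 0"
  by (simp add: pairing_def)

lemma pairing_U_p0: "pairing F G U p0 = F u0 \<bullet> G v0"
  by (simp add: pairing_def mprod_def U_p0 trace_inner_mat1[symmetric] trace_transpose_mult)

text \<open>The first derivative of the trace is \<open>M' . U\<close>, free of derivatives of
  \<open>U\<close>. Later derivatives act on the three slots of \<open>pairing\<close> by the
  product rule.\<close>

lemma N_fst: "p \<in> D \<Longrightarrow> dx b N p = pairing (dd b X) Z U p"
  and N_snd: "p \<in> D \<Longrightarrow> dy c N p = pairing X (dd c Z) U p"
proof -
  assume p: "p \<in> D"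
  have "dd v N p = dd v M p \<bullet> U p" for v
  proof -
    have "smooth (\<lambda>p. trace (polSigma (M p))) D"
      by (intro smooth_linear[OF open_Omega bounded_linear_trace] smooth_polar(1)[OF open_Omega smooth_M inv_M])
    then have "dd v N p = dd v (\<lambda>p. trace (polSigma (M p))) p"
      unfolding N_def[abs_def] by (simp add: dd_plus[OF smooth_const _ p])
    also have "\<dots> = dd v M p \<bullet> U p"
      unfolding U_def by (rule dd_polar(4)[OF open_Omega p smooth_diff[OF smooth_M p] inv_M])
    finally show ?thesis .
  qed
  then show "dx b N p = pairing (dd b X) Z U p" "dy c N p = pairing X (dd c Z) U p"
    by (simp_all add: pairing_def M_def dd_mprod_fst[OF smX smZ p] dd_mprod_snd[OF smX smZ p])
qed

lemmas smooth_parts = smX smZ smooth_U smooth_dd smooth_pairing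

abbreviation "E b \<equiv> dd b X u0"
abbreviation "E2 a \<equiv> dd a (dd a X) u0"
abbreviation "F2 c \<equiv> dd c (dd c Z) v0"
abbreviation "Om a c \<equiv> ell S (tp (dd c Z v0) ** dd a X u0)"
abbreviation "F c \<equiv> dd c Z v0"

lemma E_hor: "tp (tp z ** E b) = tp z ** E b"
  by (rule dd_symmetric[OF opA smX posdef_sym[OF gX] u0])

lemma F_hor: "tp (tp x ** F c) = tp x ** F c"
  by (rule dd_symmetric[OF opB smZ posdef_sym[OF gZ] v0])

text \<open>The first two slots form a symmetric matrix at the base point, so a skew third slot
  contributes nothing.\<close>

lemma pairing_skew:
  assumes "tp (T p0) = - T p0"
  shows "pairing (dd a X) Z T p0 = 0"
proof -
  have "mprod (dd a X) Z p0 = tp (tp z ** E a)"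
    by (simp add: mprod_def Z0 matrix_transpose_mul)
  then show ?thesis unfolding pairing_def
    using inner_skew_sym[OF assms, of "tp z ** E a"] E_hor[of a] by (simp add: inner_commute)
qed

lemma N_p0: "N p0 = K"
  using polar_unique(1)[OF S orthogonal_matrix_id] by (simp add: N_def M_def mprod_def X0 Z0 xz K)

lemma N_b: "dx b N p0 = E b \<bullet> z"
  by (simp add: N_fst[OF p0] pairing_U_p0 Z0)

lemma N_c: "dy c N p0 = F c \<bullet> x"
  by (simp add: N_snd[OF p0] pairing_U_p0 X0 inner_commute)

lemmas dd_N = trans[OF dd_cong[OF open_Omega]]

lemma N_bc_eq: "p \<in> D \<Longrightarrow> dy c (dx b N) p
    = pairing (dd b X) (dd c Z) U p + pairing (dd b X) Z (dy c U) p"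
  by (rule dd_N, assumption, erule N_fst) (simp add: dd_pairing_snd smooth_parts)

lemma N_bc: "dy c (dx b N) p0 = E b \<bullet> F c"
  by (simp add: N_bc_eq[OF p0] pairing_U_p0 pairing_zero dd_U_snd0)

lemma N_cc: "dy c (dy c N) p0 = F2 c \<bullet> x"
  by (rule dd_N[OF p0], erule N_snd)
    (simp add: dd_pairing_snd[OF _ _ _ p0] smooth_parts pairing_U_p0 pairing_zero dd_U_snd0 X0 inner_commute)

lemma N_bcc: "dy c (dy c (dx b N)) p0 = E b \<bullet> F2 c"
  by (rule dd_N[OF p0], erule N_bc_eq)
    (simp add: dd_plus[OF _ _ p0] dd_pairing_snd[OF _ _ _ p0] smooth_parts pairing_U_p0 pairing_zero
        dd_U_snd0 dd_U_snd_snd)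

lemma N_aa_eq: "p \<in> D \<Longrightarrow> dx a (dx a N) p
    = pairing (dd a (dd a X)) Z U p + pairing (dd a X) Z (dx a U) p"
  by (rule dd_N, assumption, erule N_fst) (simp add: dd_pairing_fst smooth_parts)

lemma N_aa: "dx a (dx a N) p0 = E2 a \<bullet> z"
  by (simp add: N_aa_eq[OF p0] pairing_U_p0 pairing_zero dd_U_fst Z0)

lemma N_aac_eq: "p \<in> D \<Longrightarrow> dy c (dx a (dx a N)) p
    = pairing (dd a (dd a X)) (dd c Z) U p + pairing (dd a (dd a X)) Z (dy c U) p
    + (pairing (dd a X) (dd c Z) (dx a U) p + pairing (dd a X) Z (dy c (dx a U)) p)"
  by (rule dd_N, assumption, erule N_aa_eq) (simp add: dd_plus dd_pairing_snd smooth_parts)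

lemma N_aac: "dy c (dx a (dx a N)) p0 = E2 a \<bullet> F c"
  by (simp add: N_aac_eq[OF p0] pairing_U_p0 pairing_zero dd_U_fst dd_U_snd0 pairing_skew skew_U_st)

text \<open>Of the terms with derivatives of \<open>U\<close> only those with its mixed second
  derivative and a differentiated \<open>Z\<close> survive. There are two of them, because either
  derivative in direction \<open>c\<close> can fall on \<open>Z\<close>.\<close>

lemma N_aacc: "dy c (dy c (dx a (dx a N))) p0
  = E2 a \<bullet> F2 c
    + 8 * (Om a c \<bullet> (S ** Om a c))"
proof -
  have "dy c (dy c (dx a (dx a N))) p0
    = E2 a \<bullet> F2 c + 2 * pairing (dd a X) (dd c Z) (dy c (dx a U)) p0"
    by (rule dd_N[OF p0], erule N_aac_eq)
      (simp add: dd_plus[OF _ _ p0] dd_pairing_snd[OF _ _ _ p0] smooth_parts smooth_add[OF open_Omega]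
        pairing_U_p0 pairing_zero dd_U_snd0 dd_U_snd_snd dd_U_fst pairing_skew skew_U_stt)
  \<comment> \<open>The 4 is a product of two factors 2: one from the mixed derivative of
    \<open>U\<close>, one from the two equal halves of the Sylvester operator.\<close>
  also have "pairing (dd a X) (dd c Z) (dy c (dx a U)) p0
      = 4 * (Om a c \<bullet> (S ** Om a c))"
  proof -
    let ?A = "tp (E a) ** F c"
    have t: "Om a c = - ell S ?A"
      unfolding ell_transpose[symmetric] by (simp add: matrix_transpose_mul)
    have "pairing (dd a X) (dd c Z) (dy c (dx a U)) p0 = 2 * (?A \<bullet> ell S ?A)"
      by (simp add: pairing_def mprod_def U_st_eq)
    also have "?A \<bullet> ell S ?A = mskew ?A \<bullet> ell S ?A" by (rule mskew_inner_skew[OF ell_skew, symmetric])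
    also have "\<dots> = (S ** ell S ?A + ell S ?A ** S) \<bullet> ell S ?A"
      using Linv_solves[OF S, of "mskew ?A"] by (simp add: ell_def)
    also have "\<dots> = 2 * (ell S ?A \<bullet> (S ** ell S ?A))"
    proof -
      have "(ell S ?A ** S) \<bullet> ell S ?A = tp (ell S ?A ** S) \<bullet> tp (ell S ?A)"
        by (rule inner_transpose[symmetric])
      also have "\<dots> = (S ** ell S ?A) \<bullet> ell S ?A"
        by (simp add: matrix_transpose_mul ST ell_skew matrix_linear)
      finally show ?thesis by (simp add: inner_add_left inner_commute[of "S ** ell S ?A"])
    qed
    finally show ?thesis by (simp add: t matrix_linear)
  qed
  finally show ?thesis by simp
qed

definition "C p = - ln (N p)"

text \<open>The vectors \<open>E2 a - (2 (E a . z) / K) E a\<close> and their counterparts represent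
  the Christoffel vectors. In the last identity the second derivatives of the sections cancel, and
  only the O'Neill term and the squared pairing remain.\<close>

lemma C_mixed: "dy c (dx b C) p0 = - 2 * crossB K x z (E b) (F c)" (is ?mixed)
  and C_aac: "dy c (dx a (dx a C)) p0
    = - 2 * crossB K x z (E2 a - (2 * (E a \<bullet> z) / K) *\<^sub>R E a) (F c)" (is ?aac)
  and C_bcc: "dy c (dy c (dx b C)) p0
    = - 2 * crossB K x z (E b) (F2 c - (2 * (F c \<bullet> x) / K) *\<^sub>R F c)" (is ?bcc)
  and C_aacc: "- (1/2) * dy c (dy c (dx a (dx a C))) p0
    - crossB K x z (E2 a - (2 * (E a \<bullet> z) / K) *\<^sub>R E a) (F2 c - (2 * (F c \<bullet> x) / K) *\<^sub>R F c)
    = 4 * ((Om a c \<bullet> (S ** Om a c)) / K)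
      - (2 * crossB K x z (E a) (F c))\<^sup>2" (is ?aacc)
  and smooth_C: "smooth C D"
proof -
  interpret P: positive_smooth N D using open_Omega smooth_N N_pos by unfold_locales
  have C: "C = (\<lambda>p. - ln (N p))" by (simp add: C_def fun_eq_iff)
  define k where "k = inverse K"
  have i: "P.i p0 = k" by (simp add: P.i_def N_p0 k_def)
  have dK: "r / K = r * k" for r by (simp add: k_def divide_inverse)
  note val = i N_aacc N_aac N_bcc N_bc N_b N_c N_aa N_cc dK inner_diff_left inner_diff_right
    inner_scaleR_left inner_scaleR_right k_def[symmetric]
  note alg = algebra_simps power2_eq_square power3_eq_cube power4_eq_xxxx add_divide_distrib diff_divide_distrib
  show "smooth C D" unfolding C by (rule P.smooth_neg_ln)
  show ?mixed unfolding C P.dd_neg_ln_2[OF p0] crossB_inverse val by (simp add: alg)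
  show ?aac unfolding C P.dd_neg_ln_3[OF p0] crossB_inverse val by (simp add: alg)
  show ?bcc unfolding C P.dd_neg_ln_3[OF p0] crossB_inverse val by (simp add: alg)
  show ?aacc unfolding C P.dd_neg_ln_4[OF p0] crossB_inverse val by (simp add: alg)
qed

end

section \<open>Charts\<close>

lemma iterdd_cong_open:
  assumes "open D" "\<And>x. x \<in> D \<Longrightarrow> f x = g x" "p \<in> D"
  shows "iterdd vs f p = iterdd vs g p"
  using assms(3)
proof (induction vs arbitrary: p)
  case (Cons v vs)
  then show ?case using dd_cong[OF assms(1), of p "iterdd vs f" "iterdd vs g"] by simp
qed (simp add: assms(2))

context gauge begin

text \<open>\<open>L\<close> is injective into a space whose dimension is at most that of its
  domain.\<close>

lemma hor_surjective:
  fixes L :: "real^'d::finite \<Rightarrow> real^'k^'n"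
  assumes L: "linear L" and hor: "\<And>b. L b \<in> hor" and inj: "\<And>b. L b = 0 \<Longrightarrow> b = 0"
    and d: "CARD('d) = CARD('n) * CARD('k) - CARD('k) * (CARD('k) - 1) div 2"
    and v: "v \<in> hor"
  obtains b where "L b = v"
proof -
  have "inj L" using inj linear_injective_0[OF L] by blast
  then have "dim (range L) = CARD('d)" using dim_image_eq[OF L, of UNIV] by simp
  moreover have "subspace (range L)" by (rule linear_subspace_image[OF L subspace_UNIV])
  ultimately have "range L = hor"
    using subspace_dim_equal[OF _ subspace_hor, of "range L"] hor dim_hor_le d by auto
  then show ?thesis using v that by (metis imageE)
qed

end

lemma chart_section:
  fixes f :: "real^'d::finite \<Rightarrow> real^'n::finite^'n" and w :: "real^'k::finite^'n"
  assumes "is_chart TYPE('k) V f"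
  defines "V' \<equiv> {u \<in> V. invertible (tp w ** f u ** w)}"
  shows "open V'" "smooth (\<lambda>u. gauge_factor w (f u)) V'"
    "\<And>u. u \<in> V' \<Longrightarrow> gauge_factor w (f u) ** tp (gauge_factor w (f u)) = f u"
    "\<And>u. u \<in> V' \<Longrightarrow> sym_posdef (tp w ** gauge_factor w (f u))"
proof -
  have V: "open V" "smooth f V" and im: "\<And>u. u \<in> V \<Longrightarrow> f u \<in> SplusK TYPE('k)"
    using assms(1) smooth_on_imp_smooth unfolding is_chart_def by (auto simp: smooth_on_def)
  have sub: "V' \<subseteq> V" "\<And>u. u \<in> V' \<Longrightarrow> invertible (tp w ** f u ** w)" by (auto simp: V'_def)
  note bl = mm.bounded_linear_left
  note br = mm.bounded_linear_right
  have "smooth (\<lambda>u. tp w ** f u ** w) V"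
    by (intro smooth_linear[OF V(1) bl] smooth_linear[OF V(1) br] V)
  then have "continuous_on V (\<lambda>u. tp w ** f u ** w)"
    using smooth_continuous continuous_at_imp_continuous_on by blast
  from continuous_open_preimage[OF this V(1) open_invertible]
  show op: "open V'" by (simp add: V'_def vimage_def Int_def)
  show "smooth (\<lambda>u. gauge_factor w (f u)) V'"
    by (rule smooth_gauge_factor[OF op smooth_subset[OF V(2) sub(1)] im sub(2)]) (use sub(1) in blast)
  fix u assume u: "u \<in> V'"
  obtain x' :: "real^'k^'n" where x': "f u = x' ** tp x'" "invertible (tp w ** x')"
    using gram_domain[OF im sub(2)] u sub(1) by blast
  from gauge_factor_properties[OF x'(2)]
  show "gauge_factor w (f u) ** tp (gauge_factor w (f u)) = f u"
    "sym_posdef (tp w ** gauge_factor w (f u))" by (simp_all add: x'(1))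
qed

text \<open>The base point is a parameter, since the cost has to be analysed at every point of the
  two charts, each time with a lift and gauge of its own.\<close>

locale chart_point = Qpoint \<alpha> q for \<alpha> and q :: "('k::finite,'n::finite) amb" +
  fixes W Wb :: "(real^'d::finite) set" and \<phi> \<psi> :: "real^'d \<Rightarrow> real^'n^'n" and u0 v0 :: "real^'d"
  assumes chart1: "is_chart TYPE('k) W \<phi>" and chart2: "is_chart TYPE('k) Wb \<psi>"
    and u0: "u0 \<in> W" and v0: "v0 \<in> Wb"
    and Bset: "\<And>u v. u \<in> W \<Longrightarrow> v \<in> Wb \<Longrightarrow> (\<phi> u, \<psi> v) \<in> Bset TYPE('k)"
    and base: "(\<phi> u0, \<psi> v0) = qmap q"
begin

lemma chart_dim: "CARD('d) = CARD('n) * CARD('k) - CARD('k) * (CARD('k) - 1) div 2"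
  using chart1 by (simp add: is_chart_def)

definition "A = {u \<in> W. invertible (tp z ** \<phi> u ** z)}"
definition "B = {v \<in> Wb. invertible (tp x ** \<psi> v ** x)}"
definition "X u = gauge_factor z (\<phi> u)"
definition "Z v = gauge_factor x (\<psi> v)"
definition "C0 r = cost TYPE('k) \<alpha> (\<phi> (fst r)) (\<psi> (snd r))"

lemma base_eq: "\<phi> u0 = x ** tp x" "\<psi> v0 = z ** tp z"
  using base by (auto simp: qmap_def matrix_transpose_mul matrix_mul_assoc)

lemma sym_posdef_zx: "sym_posdef (tp z ** x)" and sym_posdef_xz: "sym_posdef (tp x ** z)"
  unfolding zx xz by (rule S)+

lemmas section1 = chart_section[OF chart1, where w = z, folded A_def, unfolded X_def[symmetric]]
lemmas section2 = chart_section[OF chart2, where w = x, folded B_def, unfolded Z_def[symmetric]]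

text \<open>The sections differ from any lift \<open>q'\<close> of the same point by orthogonal
  factors on the right, so invertibility and cost carry over.\<close>

lemma XZ:
  assumes "u \<in> A" "v \<in> B"
  shows "invertible (tp (X u) ** Z v)"
    and "cost TYPE('k) \<alpha> (\<phi> u) (\<psi> v) = - ln (\<alpha> + trace (polSigma (tp (X u) ** Z v)))"
proof -
  have "(\<phi> u, \<psi> v) \<in> Bset TYPE('k)" using Bset assms by (simp add: A_def B_def)
  then obtain q' :: "('k,'n) amb" where q': "q' \<in> Qset" "(\<phi> u, \<psi> v) = qmap q'" unfolding Bset_def by blast
  define x' where "x' = fst q'"
  define y' where "y' = snd q'"
  have e: "\<phi> u = x' ** tp x'" "\<psi> v = y' ** tp y'" and i: "invertible (tp x' ** y')"
    using q' by (simp_all add: qmap_def x'_def y'_def Qset_iff)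
  have "invertible (tp z ** x')" "invertible (tp x ** y')"
    using assms e by (auto simp: A_def B_def intro: invertible_gram_imp)
  note g1 = gauge_factor_properties[OF this(1)] and g2 = gauge_factor_properties[OF this(2)]
  define R where "R = tp (polU (tp z ** x'))"
  define R' where "R' = tp (polU (tp x ** y'))"
  have R: "orthogonal_matrix R" "orthogonal_matrix R'" "X u = x' ** R" "Z v = y' ** R'"
    using g1 g2 by (simp_all add: X_def Z_def e R_def R'_def)
  have eq: "tp (X u) ** Z v = tp R ** (tp x' ** y') ** R'"
    by (simp add: R matrix_transpose_mul matrix_mul_assoc)
  have "invertible (tp R)" "invertible R'"
    using R by (auto simp: orthogonal_matrix_def invertible_def)
  then show "invertible (tp (X u) ** Z v)"
    unfolding eq by (intro invertible_mult i)
  show "cost TYPE('k) \<alpha> (\<phi> u) (\<psi> v) = - ln (\<alpha> + trace (polSigma (tp (X u) ** Z v)))"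
    unfolding eq e cost_gram[OF i] using polar_orthogonal_conj[OF i, of "tp R" R'] R by simp
qed

sublocale g: polar_germ \<alpha> K S x z A B X Z u0 v0
proof
  show "open A" "open B" "smooth X A" "smooth Z B" by (rule section1 section2)+
  have "tp z ** (x ** tp x) ** z = (tp z ** x) ** (tp x ** z)"
    "tp x ** (z ** tp z) ** x = (tp x ** z) ** (tp z ** x)"
    by (simp_all only: matrix_mul_assoc)
  then have "tp z ** (x ** tp x) ** z = S ** S" "tp x ** (z ** tp z) ** x = S ** S"
    by (simp_all only: xz zx)
  then show "u0 \<in> A" "v0 \<in> B"
    using u0 v0 posdef_invertible[OF S] by (simp_all add: A_def B_def base_eq invertible_mult)
  show "X u0 = x" "Z v0 = z"
    using gauge_factor_posdef[OF sym_posdef_zx] gauge_factor_posdef[OF sym_posdef_xz]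
    by (simp_all add: X_def Z_def base_eq)
  show "sym_posdef (tp z ** X u)" if "u \<in> A" for u by (rule section1(4)[OF that])
  show "sym_posdef (tp x ** Z v)" if "v \<in> B" for v by (rule section2(4)[OF that])
  show "invertible (tp (X u) ** Z v)" if "u \<in> A" "v \<in> B" for u v by (rule XZ(1)[OF that])
qed

lemma C0_germ: "p \<in> g.D \<Longrightarrow> C0 p = g.C p"
  using XZ(2) by (auto simp: C0_def g.C_def g.N_def g.M_def mprod_def g.D_def)

lemma dd_C0:
  "dd v1 (dd v2 C0) g.p0 = dd v1 (dd v2 g.C) g.p0"
  "dd v1 (dd v2 (dd v3 C0)) g.p0 = dd v1 (dd v2 (dd v3 g.C)) g.p0"
  "dd v1 (dd v2 (dd v3 (dd v4 C0))) g.p0 = dd v1 (dd v2 (dd v3 (dd v4 g.C))) g.p0"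
  using iterdd_cong_open[OF g.open_Omega C0_germ g.p0, where vs = "[v1, v2]"]
    iterdd_cong_open[OF g.open_Omega C0_germ g.p0, where vs = "[v1, v2, v3]"]
    iterdd_cong_open[OF g.open_Omega C0_germ g.p0, where vs = "[v1, v2, v3, v4]"] by simp_all

lemma smooth_C0: "smooth C0 g.D"
  by (rule smooth_cong[OF g.open_Omega g.smooth_C]) (rule C0_germ[symmetric])

lemma mixed_C0: "mixed_hessian C0 g.p0 b c = crossB K x z (g.E b) (g.F c)"
  by (simp add: mixed_hessian_def dd_C0 g.C_mixed)

lemma dd_gram_at:
  fixes Y :: "real^'d \<Rightarrow> real^'k^'n"
  assumes "open V" "u \<in> V" "smooth Y V" "\<And>u. u \<in> V \<Longrightarrow> Y u ** tp (Y u) = f u"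
  shows "dd b f u = dd b Y u ** tp (Y u) + Y u ** tp (dd b Y u)"
proof -
  have Y: "Y differentiable (at u)" by (rule smooth_diff[OF assms(3,2)])
  have "dd b f u = dd b (\<lambda>u. Y u ** tp (Y u)) u"
    by (rule dd_cong[OF assms(1,2)]) (simp add: assms(4))
  then show ?thesis
    by (simp add: dd_bilinear[OF bilinear_matmul Y differentiable_linear[OF linear_transpose Y]]
        dd_linear[OF linear_transpose Y] add.commute)
qed

lemma dd_phi: "dd b \<phi> u0 = g.E b ** tp x + x ** tp (g.E b)"
  using dd_gram_at[OF g.opA g.u0 g.smX section1(3)] g.X0 by simp

lemma dd_psi: "dd c \<psi> v0 = g.F c ** tp z + z ** tp (g.F c)"
  using dd_gram_at[OF g.opB g.v0 g.smZ section2(3)] g.Z0 by simp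

lemma E_hor: "g.E b \<in> hor" and F_hor: "g.F c \<in> sw.hor"
  using g.E_hor g.F_hor by (simp_all add: hor_def sw.hor_def)

lemma linear_E: "linear g.E" and linear_F: "linear g.F"
  by (rule linear_dd[OF smooth_diff[OF g.smX g.u0]],
      rule linear_dd[OF smooth_diff[OF g.smZ g.v0]])

lemma E_zero: "g.E b = 0 \<Longrightarrow> b = 0" and F_zero: "g.F c = 0 \<Longrightarrow> c = 0"
  using chart1 chart2 u0 v0 dd_phi[of b] dd_psi[of c] by (auto simp: is_chart_def)

lemmas E_surjective = hor_surjective[OF linear_E E_hor E_zero chart_dim]
lemmas F_surjective = sw.hor_surjective[OF linear_F F_hor F_zero chart_dim]

lemma nondegenerate_left:
  assumes "\<And>c. mixed_hessian C0 g.p0 b c = 0"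
  shows "b = 0"
proof (rule E_zero, rule hor_crossB_nondegenerate[OF E_hor])
  fix c :: "real^'k^'n" assume "tp (tp x ** c) = tp x ** c"
  then obtain c' where "g.F c' = c" using F_surjective[of c] by (auto simp: sw.hor_def)
  then show "crossB K x z (g.E b) c = 0" using assms[of c'] by (simp add: mixed_C0)
qed

lemma nondegenerate_right:
  assumes "\<And>b. mixed_hessian C0 g.p0 b c = 0"
  shows "c = 0"
proof (rule F_zero, rule sw.hor_crossB_nondegenerate[OF F_hor])
  fix b :: "real^'k^'n" assume "tp (tp z ** b) = tp z ** b"
  then obtain b' where "g.E b' = b" using E_surjective[of b] by (auto simp: hor_def)
  then show "crossB K z x (g.F c) b = 0" using assms[of b'] by (simp add: mixed_C0 crossB_swap[of K z])
qed

lemma second_hor: "dd a (dd a X) u0 \<in> hor" "dd c (dd c Z) v0 \<in> sw.hor"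
  unfolding hor_def sw.hor_def mem_Collect_eq
  using dd_symmetric[OF g.opA smooth_dd[OF g.smX] dd_symmetric[OF g.opA g.smX] g.u0]
    dd_symmetric[OF g.opB smooth_dd[OF g.smZ] dd_symmetric[OF g.opB g.smZ] g.v0]
    posdef_sym[OF g.gX] posdef_sym[OF g.gZ] by blast+

text \<open>The derivative of a gauge section is a horizontal lift of the derivative of the chart,
  and such a lift is unique.\<close>

lemma lift_unique:
  assumes "(e, eb) \<in> Hor \<alpha> q" "(dd c \<phi> u0, dd cb \<psi> v0) = dqmap q (e, eb)"
  shows "g.E c = e" "g.F cb = eb ** tp U"
proof -
  have h: "e \<in> hor" "eb ** tp U \<in> sw.hor"
    using assms(1) by (simp_all add: Hor_iff hor_def sw.hor_def mskew_eq_0_iff)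
  show "g.E c = e"
    by (rule hor_determined[OF E_hor h(1)]) (use assms(2) in \<open>simp add: dqmap_def dd_phi\<close>)
  show "g.F cb = eb ** tp U"
    by (rule sw.hor_determined[OF F_hor h(2)])
      (use assms(2) in \<open>simp add: dqmap_def dd_psi matrix_transpose_mul matrix_mul_assoc\<close>)
qed

text \<open>The coordinate formula differentiates Christoffel functions, so it asks for smoothness
  and nondegeneracy on the whole product; both are checked point by point.\<close>

lemma km_coordinates_charts: "km_coordinates (W \<times> Wb) C0 (km_coord TYPE('k) \<alpha> \<phi> \<psi>)"
proof -
  have pt: "(\<exists>D'. p \<in> D' \<and> smooth C0 D') \<and> ((\<forall>c. mixed_hessian C0 p b c = 0) \<longrightarrow> b = 0)
     \<and> ((\<forall>b. mixed_hessian C0 p b c = 0) \<longrightarrow> c = 0)" if p: "p \<in> W \<times> Wb" for p b c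
  proof -
    have "(\<phi> (fst p), \<psi> (snd p)) \<in> Bset TYPE('k)" using Bset p by auto
    then obtain q' :: "('k,'n) amb" where q': "q' \<in> Qset" "(\<phi> (fst p), \<psi> (snd p)) = qmap q'" unfolding Bset_def by blast
    \<comment> \<open>A fresh gauge at a lift of \<open>p\<close>: the sections at the original base
      point need not reach \<open>p\<close>.\<close>
    interpret c: chart_point \<alpha> q' W Wb \<phi> \<psi> "fst p" "snd p"
      by unfold_locales (use alpha q' p chart1 chart2 Bset in auto)
    have P: "c.g.p0 = p" by (simp add: c.g.p0_def)
    show ?thesis
      using c.smooth_C0 c.g.p0 c.nondegenerate_left c.nondegenerate_right unfolding P by blast
  qed
  show ?thesis
  proof
    show "open (W \<times> Wb)" using chart1 chart2 by (simp add: is_chart_def smooth_on_def open_Times)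
    show "smooth C0 (W \<times> Wb)" by (rule smooth_local) (use pt in blast)
    show "km_coord TYPE('k) \<alpha> \<phi> \<psi> p X Y =
       - (1/2) * (dd (fst X, 0) (dd (0, snd Y) C0) p + dd (0, snd X) (dd (fst Y, 0) C0) p)" for p X Y
      by (simp add: km_coord_def Let_def C0_def[abs_def])
  qed (use pt in blast)+
qed

theorem cross_curv_eq:
  assumes h: "(e, eb) \<in> Hor \<alpha> q" and d: "(dd c \<phi> u0, dd cb \<psi> v0) = dqmap q (e, eb)"
  shows "cross_curv_coord TYPE('k) \<alpha> \<phi> \<psi> u0 v0 c cb =
    4 * gq (oA e eb) (oA e eb) - (gq (e, eb) (e, eb))\<^sup>2"
proof -
  interpret km: km_coordinates "W \<times> Wb" C0 "km_coord TYPE('k) \<alpha> \<phi> \<psi>" by (rule km_coordinates_charts)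
  note l = lift_unique[OF h d]
  let ?g1 = "g.E2 c - (2 * (g.E c \<bullet> z) / K) *\<^sub>R g.E c"
  let ?g2 = "g.F2 cb - (2 * (g.F cb \<bullet> x) / K) *\<^sub>R g.F cb"
  have "?g1 \<in> hor" "?g2 \<in> sw.hor"
    by (intro subspace_diff subspace_scale subspace_hor sw.subspace_hor second_hor E_hor F_hor)+
  \<comment> \<open>\<open>E\<close> and \<open>F\<close> are onto the horizontal spaces, so the
    Christoffel vectors can be expressed in the charts.\<close>
  then obtain G1 G2 where G: "g.E G1 = ?g1" "g.F G2 = ?g2"
    using E_surjective F_surjective by metis
  have "cross_curv_coord TYPE('k) \<alpha> \<phi> \<psi> u0 v0 c cb
     = - (1/2) * dy cb (dy cb (dx c (dx c C0))) g.p0 - mixed_hessian C0 g.p0 G1 G2"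
    unfolding cross_curv_coord_def Let_def g.p0_def[symmetric]
  proof (rule km.cross_curvature)
    show "g.p0 \<in> W \<times> Wb" by (simp add: g.p0_def u0 v0)
    show "mixed_hessian C0 g.p0 G1 b = - (1/2) * dy b (dx c (dx c C0)) g.p0" for b
      by (simp add: mixed_C0 dd_C0 g.C_aac G)
    show "mixed_hessian C0 g.p0 b G2 = - (1/2) * dy cb (dy cb (dx b C0)) g.p0" for b
      by (simp add: mixed_C0 dd_C0 g.C_bcc G)
  qed
  also have "\<dots> = 4 * ((g.Om c cb \<bullet> (S ** g.Om c cb)) / K)
      - (2 * crossB K x z (g.E c) (g.F cb))\<^sup>2"
    unfolding mixed_C0 dd_C0 G by (rule g.C_aacc)
  \<comment> \<open>\<open>gq\<close> of a vector with itself is twice the pairing of its two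
    components.\<close>
  also have "\<dots> = 4 * gq (oA e eb) (oA e eb) - (gq (e, eb) (e, eb))\<^sup>2"
    unfolding l oneillA_norm(2)[OF h] by (simp add: gQ_eq matrix_transpose_mul)
  finally show ?thesis .
qed

end

theorem mainTheorem16:
  fixes \<alpha> :: real and x y :: "real^'k::finite^'n::finite"
  defines "q \<equiv> (x, y)"
  defines "\<Sigma> \<equiv> SigQ q" and "U \<equiv> UQ q" and "K \<equiv> KQ \<alpha> q"
  assumes "\<alpha> > 0" and "CARD('k) \<le> CARD('n)" and "q \<in> Qset"
  shows
   "(\<forall>w wb. hproj \<alpha> q (w, wb) =
       (w - 2 *\<^sub>R (x ** Linv \<Sigma> (mskew (U ** transpose y ** w))),
        wb - 2 *\<^sub>R (y ** transpose U ** Linv \<Sigma> (mskew (transpose x ** wb ** transpose U)) ** U)))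
  \<and> (\<forall>a ab b bb. lc_christoffel (gQ \<alpha>) q (a, ab) (b, bb) =
       (- (1/K) *\<^sub>R (trace (transpose b ** y ** transpose U) *\<^sub>R a + trace (transpose a ** y ** transpose U) *\<^sub>R b)
        + x ** Linv \<Sigma> (mskew (U ** (transpose ab ** b + transpose bb ** a)))
        + a ** Linv \<Sigma> (mskew (transpose x ** bb ** transpose U + transpose b ** y ** transpose U))
        + b ** Linv \<Sigma> (mskew (transpose x ** ab ** transpose U + transpose a ** y ** transpose U))
        + (1/K) *\<^sub>R (trace (transpose x ** bb ** transpose U - transpose b ** y ** transpose U)
                        *\<^sub>R (x ** Linv \<Sigma> (mskew (transpose a ** y ** transpose U)))
                    + trace (transpose x ** ab ** transpose U - transpose a ** y ** transpose U)
                        *\<^sub>R (x ** Linv \<Sigma> (mskew (transpose b ** y ** transpose U)))),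
        - (1/K) *\<^sub>R (trace (transpose bb ** x ** U) *\<^sub>R ab + trace (transpose ab ** x ** U) *\<^sub>R bb)
        - y ** transpose U ** Linv \<Sigma> (mskew (U ** (transpose ab ** b + transpose bb ** a))) ** U
        + ab ** transpose U ** Linv \<Sigma> (mskew (U ** transpose y ** b + U ** transpose bb ** x)) ** U
        + bb ** transpose U ** Linv \<Sigma> (mskew (U ** transpose y ** a + U ** transpose ab ** x)) ** U
        + (1/K) *\<^sub>R (trace (transpose b ** y ** transpose U - transpose x ** bb ** transpose U)
                        *\<^sub>R (y ** transpose U ** Linv \<Sigma> (mskew (U ** transpose ab ** x)) ** U)
                    + trace (transpose a ** y ** transpose U - transpose x ** ab ** transpose U)
                        *\<^sub>R (y ** transpose U ** Linv \<Sigma> (mskew (U ** transpose bb ** x)) ** U))))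
  \<and> (\<forall>e eb. (e, eb) \<in> Hor \<alpha> q \<longrightarrow>
       oneillA \<alpha> q (e, 0) (0, eb) =
         (x ** Linv \<Sigma> (mskew (U ** transpose eb ** e)),
          - (y ** transpose U ** Linv \<Sigma> (mskew (transpose e ** eb ** transpose U)) ** U))
     \<and> gQ \<alpha> q (oneillA \<alpha> q (e, 0) (0, eb)) (oneillA \<alpha> q (e, 0) (0, eb)) =
         (1/K) * trace (Linv \<Sigma> (mskew (U ** transpose eb ** e)) ** \<Sigma>
                        ** Linv \<Sigma> (mskew (transpose e ** eb ** transpose U)))
     \<and> gQ \<alpha> q (oneillA \<alpha> q (e, 0) (0, eb)) (oneillA \<alpha> q (e, 0) (0, eb)) \<ge> 0
     \<and> (\<forall>(W :: (real^'d::finite) set) \<phi> Wb \<psi> u0 ub0 c cb.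
          is_chart TYPE('k) W \<phi> \<and> is_chart TYPE('k) Wb \<psi> \<and> u0 \<in> W \<and> ub0 \<in> Wb
          \<and> (\<forall>u\<in>W. \<forall>ub\<in>Wb. (\<phi> u, \<psi> ub) \<in> Bset TYPE('k))
          \<and> (\<phi> u0, \<psi> ub0) = qmap q
          \<and> (dd c \<phi> u0, dd cb \<psi> ub0) = dqmap q (e, eb)
          \<longrightarrow> cross_curv_coord TYPE('k) \<alpha> \<phi> \<psi> u0 ub0 c cb =
                4 * gQ \<alpha> q (oneillA \<alpha> q (e, 0) (0, eb)) (oneillA \<alpha> q (e, 0) (0, eb))
                - (gQ \<alpha> q (e, eb) (e, eb))^2
            \<and> (gQ \<alpha> q (e, eb) (e, eb) = 0 \<longrightarrow>
                 cross_curv_coord TYPE('k) \<alpha> \<phi> \<psi> u0 ub0 c cb \<ge> 0 \<and>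
                 (cross_curv_coord TYPE('k) \<alpha> \<phi> \<psi> u0 ub0 c cb = 0 \<longleftrightarrow>
                    transpose (U ** transpose eb ** e) = U ** transpose eb ** e))))" (is "?hproj \<and> ?chr \<and> (\<forall>e eb. _ \<longrightarrow> ?A e eb \<and> ?n e eb \<and> ?p e eb
  \<and> (\<forall>W \<phi> Wb \<psi> u0 ub0 c cb. ?asm e eb W \<phi> Wb \<psi> u0 ub0 c cb \<longrightarrow> ?curv e eb W \<phi> Wb \<psi> u0 ub0 c cb))")
proof -
  interpret Qpoint \<alpha> q using assms by unfold_locales simp_all
  have xy: "fst q = x" "snd q = y" by (simp_all add: q_def)
  have 1: "?hproj"
    using hproj_eq unfolding xy ell_def \<Sigma>_def U_def
    by (simp add: matrix_transpose_mul matrix_mul_assoc)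
  have 2: "?chr"
    unfolding lc_christoffel_gQ chrQ_def Let_def chr_same_def chr_cross_def prod_eq_iff fst_conv snd_conv
      trace_sub \<Sigma>_def U_def K_def ell_def[symmetric] trace_gauge[unfolded xy] xy
    \<comment> \<open>Transposed arguments of \<open>ell\<close> are brought to one form by
      \<open>ell_swap\<close>, the source of the sign of the \<open>y U^T\<close> term in the second
      component.\<close>
    by (simp add: matrix_transpose_mul ell_add matrix_linear ell_swap matrix_mul_assoc algebra_simps
        scaleR_diff_left scaleR_add_right scaleR_diff_right)
  have 3: "?A e eb" if "(e, eb) \<in> Hor \<alpha> q" for e eb
    using oneillA_eq[OF that] unfolding xy ell_def \<Sigma>_def U_def .
  have 4: "?n e eb" "?p e eb" if "(e, eb) \<in> Hor \<alpha> q" for e eb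
    using oneillA_norm(1)[OF that] oneillA_norm_nonneg(1)[OF that] unfolding ell_def \<Sigma>_def U_def K_def by blast+
  have 5: "?curv e eb W \<phi> Wb \<psi> u0 v0 c cb"
    if h: "(e, eb) \<in> Hor \<alpha> q" and ch: "?asm e eb W \<phi> Wb \<psi> u0 v0 c cb" for e eb W \<phi> Wb \<psi> u0 v0 c cb
  proof -
    interpret chart_point \<alpha> q W Wb \<phi> \<psi> u0 v0 by unfold_locales (use ch in auto)
    \<comment> \<open>For a null vector the curvature is four times the O'Neill norm, whose sign and
      zero set are known.\<close>
    show ?thesis using cross_curv_eq[OF h] ch oneillA_norm_nonneg[OF h] by (simp add: U_def)
  qed
  show ?thesis
    by (rule conjI[OF 1 conjI[OF 2]], intro allI impI, intro conjI, erule 3, erule 4(1), erule 4(2),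
        intro allI impI, erule 5)
qed

end
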